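(* Let $I_1,I_2,I_3>0$ be the principal moments of inertia of a rigid body with a fixed point, satisfying the strict triangle inequalities $I_1<I_2+I_3$, $I_2<I_3+I_1$, $I_3<I_1+I_2$. Let $\tilde V$ be a smooth function on the unit sphere $S^2=\{\alpha_1^2+\alpha_2^2+\alpha_3^2=1\}\subset\mathbf{R}^3$, and consider the natural mechanical system $(SO(3),m,V)$, $V=\tilde V\circ p$, of the motion of the rigid body in an axially symmetric force field with the symmetry group $G$ of rotations about the force axis. For each $k\in\mathbf{R}$ its reduced system corresponding to the momentum value $k$ is (the dynamical system of) the mechanical system with gyroscopic forces $(S^2,\tilde m,\tilde V_k,k\,\tilde{\mathfrak g})$, where for $\nu=(\alpha_1,\alpha_2,\alpha_3)\in S^2$ and $\dot\nu=(\dot\alpha_1,\dot\alpha_2,\dot\alpha_3)\in T_\nu S^2$ $$\tilde m(\dot\nu,\dot\nu)=\frac{I_1I_2I_3\left(\frac{\dot\alpha_1^2}{I_1}+\frac{\dot\alpha_2^2}{I_2}+\frac{\dot\alpha_3^2}{I_3}\right)}{I_1\alpha_1^2+I_2\alpha_2^2+I_3\alpha_3^2},$$ $$\tilde V_k(\alpha_1,\alpha_2,\alpha_3)=\tilde V(\alpha_1,\alpha_2,\alpha_3)+\frac{k^2}{2(I_1\alpha_1^2+I_2\alpha_2^2+I_3\alpha_3^2)},$$ $$k\,\tilde{\mathfrak g}=k\,\frac{(I_2+I_3-I_1)I_1\alpha_1^2+(I_3+I_1-I_2)I_2\alpha_2^2+(I_1+I_2-I_3)I_3\alpha_3^2}{(I_1\alpha_1^2+I_2\alpha_2^2+I_3\alpha_3^2)^2}\,(\alpha_1\,\mathrm{d}\alpha_2\wedge\mathrm{d}\alpha_3+\alpha_2\,\mathrm{d}\alpha_3\wedge\mathrm{d}\alpha_1+\alpha_3\,\mathrm{d}\alpha_1\wedge\mathrm{d}\alpha_2).$$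 Thus the form of gyroscopic forces $k\,\tilde{\mathfrak g}$ is the product of the momentum constant $k$, the volume form of the 2-sphere induced from $\mathbf{R}^3$, and an everywhere positive function on the sphere.
   Context: Rigid body. For $\Omega\in\mathfrak{so}(3)$, $$\Omega=\begin{pmatrix}0&-\omega_3&\omega_2\\ \omega_3&0&-\omega_1\\ -\omega_2&\omega_1&0\end{pmatrix},$$ put $f(\Omega)=(\omega_1,\omega_2,\omega_3)^T\in\mathbf{R}^3$. For $(Q,\dot Q)\in T(SO(3))$ the spin is $\omega=f(Q^{-1}\dot Q)$. The metric on $SO(3)$ is $m_Q(\omega^1,\omega^2)=I\omega^1\cdot\omega^2$, where $I=\mathrm{diag}(I_1,I_2,I_3)$, $\omega^1,\omega^2$ are the spins of the two tangent vectors at $Q$ and $\cdot$ is the standard scalar product. The group $G=\{g^\tau\}$ acts by $g^\tau(Q)=Q^\tau Q$ with $$Q^\tau=\begin{pmatrix}1&0&0\\0&\cos\tau&-\sin\tau\\0&\sin\tau&\cos\tau\end{pmatrix}.$$ Its generating field $v(Q)=\frac{d}{d\tau}|_{\tau=0}g^\tau(Q)$ has spin $\nu=(\alpha_1,\alpha_2,\alpha_3)^T$, the first row of $Q$. The map $p:SO(3)\to S^2$, $Q\mapsto\nu$, is the quotient map of the principal $G$-bundle $(SO(3),p,S^2)$. The group $G$ preserves $m$ and $V=\tilde V\circ p$. Reduction (applied with $M=SO(3)$, $\tilde M=S^2$). For a natural system $(M,m,V)$, $m=\langle\cdot,\cdot\rangle$, with such a symmetry group, let $p_N:T(N)\to N$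 be the tangent bundle projection of a manifold $N$. The Lagrange forms of a Riemannian metric $n$ on $N$ are $\theta_w(Y)=n(w,Tp_N(Y))$, $Y\in T_w(T(N))$, and $\sigma_n=\mathrm{d}\theta$. The dynamics of $(M,m,V)$ is the vector field $X$ on $T(M)$ with $\mathrm{i}_X\sigma_m=-\mathrm{d}(K+V\circ p_M)$, $K(w)=\frac12\langle w,w\rangle$. The momentum is $J(w)=\langle v,w\rangle$, a first integral of $X$; $J_k=J^{-1}(k)$ and $\rho_k=Tp|_{J_k}:J_k\to T(\tilde M)$. The reduced system corresponding to $k$ is the unique vector field $\tilde X_k$ on $T(\tilde M)$ with $T\rho_k\circ X=\tilde X_k\circ\rho_k$ on $J_k$. A mechanical system with gyroscopic forces is a 4-tuple $(N,n,U,\varkappa)$ (manifold, Riemannian metric, function, closed 2-form, all smooth); its dynamical system is the unique vector field $Y$ on $T(N)$ with $\mathrm{i}_Y(\sigma_n+p_N^*\varkappa)=-\mathrm{d}(K_n+U\circ p_N)$, $K_n(w)=\frac12n(w,w)$. In the general construction the elements of the reduced system are: $\tilde m(\tilde w_1,\tilde w_2)=\langle w_1,w_2\rangle$, where $w_i\in J_0$ are vectors at a common point with $Tp(w_i)=\tilde w_i$; $\tilde V_k(p(x))=V(x)+k^2/(2\langle v(x),v(x)\rangle)$; and $\tilde{\mathfrak g}$, the 2-form on $\tilde M$ with $p^*\tilde{\mathfrak g}=\mathrm{d}\mathfrak h$, $\mathfrak h(w)=\langle v,w\rangle/\langle v,v\rangle$. *)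

theory Defs
  imports "HOL-Analysis.Analysis"
begin

section \<open>Calculus on embedded submanifolds of Euclidean spaces\<close>

text \<open>
  A manifold is a subset \<open>N\<close> of a Euclidean space, and its tangent vectors at \<open>x\<close> are the
  velocities at \<open>x\<close> of smooth curves in \<open>N\<close>.  The tangent bundle of \<open>N\<close> is again a subset of a
  Euclidean space, so that \<open>T(T(N))\<close> needs no separate treatment.  A field on \<open>N\<close> assigns to \<open>x\<close>
  the vector part of the tangent vector at \<open>x\<close>.
\<close>

primrec Ck_on :: "nat \<Rightarrow> ('a::euclidean_space \<Rightarrow> 'b::euclidean_space) \<Rightarrow> 'a set \<Rightarrow> bool" where
  "Ck_on 0 f U \<longleftrightarrow> continuous_on U f"
| "Ck_on (Suc r) f U \<longleftrightarrow>
     (\<forall>x\<in>U. f differentiable (at x)) \<and> (\<forall>v. Ck_on r (\<lambda>x. frechet_derivative f (at x) v) U)"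

text \<open>Used for open \<open>U\<close> only.\<close>

definition smooth_on :: "'a::euclidean_space set \<Rightarrow> ('a \<Rightarrow> 'b::euclidean_space) \<Rightarrow> bool" where
  "smooth_on U f \<longleftrightarrow> (\<forall>r. Ck_on r f U)"

definition smooth_map :: "'a::euclidean_space set \<Rightarrow> ('a \<Rightarrow> 'b::euclidean_space) \<Rightarrow> bool" where
  "smooth_map N f \<longleftrightarrow>
     (\<forall>x\<in>N. \<exists>U g. open U \<and> x \<in> U \<and> smooth_on U g \<and> (\<forall>y\<in>N \<inter> U. g y = f y))"

text \<open>
  Embedded submanifolds of constant codimension \<open>c\<close>, given locally as a regular level set of a
  submersion onto a linear space \<open>W\<close> of dimension \<open>c\<close>.
\<close>

definition submanifold :: "'a::euclidean_space set \<Rightarrow> bool" where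
  "submanifold N \<longleftrightarrow>
     (\<exists>c. \<forall>x\<in>N. \<exists>U W (F :: 'a \<Rightarrow> 'a).
        open U \<and> x \<in> U \<and> subspace W \<and> dim W = c \<and> smooth_on U F \<and> F ` U \<subseteq> W \<and>
        range (frechet_derivative F (at x)) = W \<and> N \<inter> U = {y\<in>U. F y = 0})"

definition curve_at :: "'a::euclidean_space set \<Rightarrow> 'a \<Rightarrow> 'a \<Rightarrow> (real \<Rightarrow> 'a) \<Rightarrow> bool" where
  "curve_at N x u \<gamma> \<longleftrightarrow>
     (\<exists>e>0. smooth_on {-e<..<e} \<gamma> \<and> \<gamma> ` {-e<..<e} \<subseteq> N) \<and> \<gamma> 0 = x \<and>
     (\<gamma> has_vector_derivative u) (at 0)"

definition tangent_space :: "'a::euclidean_space set \<Rightarrow> 'a \<Rightarrow> 'a set" where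
  "tangent_space N x = {u. \<exists>\<gamma>. curve_at N x u \<gamma>}"

definition tangent_bundle :: "'a::euclidean_space set \<Rightarrow> ('a \<times> 'a) set" where
  "tangent_bundle N = {(x, u). x \<in> N \<and> u \<in> tangent_space N x}"

text \<open>
  The derivative of \<open>f\<close>, restricted to \<open>N\<close>, at \<open>x\<close> along the tangent vector \<open>u\<close>.
\<close>

definition tderiv ::
  "'a::euclidean_space set \<Rightarrow> ('a \<Rightarrow> 'b::euclidean_space) \<Rightarrow> 'a \<Rightarrow> 'a \<Rightarrow> 'b" where
  "tderiv N f x u =
     (THE d. \<forall>\<gamma>. curve_at N x u \<gamma> \<longrightarrow> ((f \<circ> \<gamma>) has_vector_derivative d) (at 0))"

definition tangent_map ::
  "'a::euclidean_space set \<Rightarrow> ('a \<Rightarrow> 'b::euclidean_space) \<Rightarrow> 'a \<times> 'a \<Rightarrow> 'b \<times> 'b" where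
  "tangent_map N f = (\<lambda>(x, u). (f x, tderiv N f x u))"

text \<open>
  Extensionality makes equality of fields on \<open>N\<close> the equality of functions.
\<close>

definition vector_field :: "'a::euclidean_space set \<Rightarrow> ('a \<Rightarrow> 'a) \<Rightarrow> bool" where
  "vector_field N X \<longleftrightarrow>
     smooth_map N X \<and> (\<forall>x\<in>N. X x \<in> tangent_space N x) \<and> X \<in> extensional N"

definition lie_bracket ::
  "'a::euclidean_space set \<Rightarrow> ('a \<Rightarrow> 'a) \<Rightarrow> ('a \<Rightarrow> 'a) \<Rightarrow> 'a \<Rightarrow> 'a" where
  "lie_bracket N X Y x = tderiv N Y x (X x) - tderiv N X x (Y x)"

text \<open>
  A 1-form is a function \<open>\<theta> x u\<close> and a 2-form a function \<open>\<kappa> x u v\<close> of a point and tangent vectors.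
  Exterior derivatives are given by the invariant formula, with the normalization
  \<open>d\<theta>(X,Y) = X(\<theta>(Y)) - Y(\<theta>(X)) - \<theta>([X,Y])\<close>, i.e. \<open>d(x dy)(\<partial>x, \<partial>y) = 1\<close>.
\<close>

definition ext_deriv ::
  "'a::euclidean_space set \<Rightarrow> ('a \<Rightarrow> 'a \<Rightarrow> real) \<Rightarrow> 'a \<Rightarrow> 'a \<Rightarrow> 'a \<Rightarrow> real" where
  "ext_deriv N \<theta> x u v =
     (THE c. \<forall>X Y. vector_field N X \<and> vector_field N Y \<and> X x = u \<and> Y x = v \<longrightarrow>
        c = tderiv N (\<lambda>y. \<theta> y (Y y)) x u - tderiv N (\<lambda>y. \<theta> y (X y)) x v
            - \<theta> x (lie_bracket N X Y x))"

text \<open>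
  A 2-form is set to zero off the tangent vectors of \<open>N\<close>, so that it is determined as a function.
\<close>

definition two_form :: "'a::euclidean_space set \<Rightarrow> ('a \<Rightarrow> 'a \<Rightarrow> 'a \<Rightarrow> real) \<Rightarrow> bool" where
  "two_form N \<kappa> \<longleftrightarrow>
     (\<forall>x\<in>N. \<forall>u\<in>tangent_space N x. \<forall>v\<in>tangent_space N x. \<forall>w\<in>tangent_space N x. \<forall>r s.
        \<kappa> x (r *\<^sub>R u + s *\<^sub>R v) w = r * \<kappa> x u w + s * \<kappa> x v w \<and> \<kappa> x u v = - \<kappa> x v u) \<and>
     (\<forall>X Y. vector_field N X \<and> vector_field N Y \<longrightarrow> smooth_map N (\<lambda>x. \<kappa> x (X x) (Y x))) \<and>
     (\<forall>x u v. \<not> (x \<in> N \<and> u \<in> tangent_space N x \<and> v \<in> tangent_space N x) \<longrightarrow> \<kappa> x u v = 0)"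

definition closed_form :: "'a::euclidean_space set \<Rightarrow> ('a \<Rightarrow> 'a \<Rightarrow> 'a \<Rightarrow> real) \<Rightarrow> bool" where
  "closed_form N \<kappa> \<longleftrightarrow>
     (\<forall>X Y Z. vector_field N X \<and> vector_field N Y \<and> vector_field N Z \<longrightarrow>
        (\<forall>x\<in>N. tderiv N (\<lambda>y. \<kappa> y (Y y) (Z y)) x (X x)
               - tderiv N (\<lambda>y. \<kappa> y (X y) (Z y)) x (Y x)
               + tderiv N (\<lambda>y. \<kappa> y (X y) (Y y)) x (Z x)
               - \<kappa> x (lie_bracket N X Y x) (Z x)
               + \<kappa> x (lie_bracket N X Z x) (Y x)
               - \<kappa> x (lie_bracket N Y Z x) (X x) = 0))"

definition riemannian_metric :: "'a::euclidean_space set \<Rightarrow> ('a \<Rightarrow> 'a \<Rightarrow> 'a \<Rightarrow> real) \<Rightarrow> bool" where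
  "riemannian_metric N n \<longleftrightarrow>
     (\<forall>x\<in>N. \<forall>u\<in>tangent_space N x. \<forall>v\<in>tangent_space N x. \<forall>w\<in>tangent_space N x. \<forall>r s.
        n x (r *\<^sub>R u + s *\<^sub>R v) w = r * n x u w + s * n x v w \<and> n x u v = n x v u \<and>
        (u \<noteq> 0 \<longrightarrow> n x u u > 0)) \<and>
     (\<forall>X Y. vector_field N X \<and> vector_field N Y \<longrightarrow> smooth_map N (\<lambda>x. n x (X x) (Y x)))"


section \<open>Mechanical systems and reduction\<close>

definition lagrange_form ::
  "'a::euclidean_space set \<Rightarrow> ('a \<Rightarrow> 'a \<Rightarrow> 'a \<Rightarrow> real) \<Rightarrow> 'a \<times> 'a \<Rightarrow> 'a \<times> 'a \<Rightarrow> real" where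
  "lagrange_form N n w Z = n (fst w) (snd w) (tderiv (tangent_bundle N) fst w Z)"

definition lagrange_2form ::
  "'a::euclidean_space set \<Rightarrow> ('a \<Rightarrow> 'a \<Rightarrow> 'a \<Rightarrow> real) \<Rightarrow>
     'a \<times> 'a \<Rightarrow> 'a \<times> 'a \<Rightarrow> 'a \<times> 'a \<Rightarrow> real" where
  "lagrange_2form N n = ext_deriv (tangent_bundle N) (lagrange_form N n)"

definition energy ::
  "('a \<Rightarrow> 'a \<Rightarrow> 'a \<Rightarrow> real) \<Rightarrow> ('a \<Rightarrow> real) \<Rightarrow> 'a \<times> 'a \<Rightarrow> real" where
  "energy n U w = n (fst w) (snd w) (snd w) / 2 + U (fst w)"

definition natural_system ::
  "'a::euclidean_space set \<Rightarrow> ('a \<Rightarrow> 'a \<Rightarrow> 'a \<Rightarrow> real) \<Rightarrow> ('a \<Rightarrow> real) \<Rightarrow> bool" where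
  "natural_system M m V \<longleftrightarrow> submanifold M \<and> riemannian_metric M m \<and> smooth_map M V"

definition natural_dynamics ::
  "'a::euclidean_space set \<Rightarrow> ('a \<Rightarrow> 'a \<Rightarrow> 'a \<Rightarrow> real) \<Rightarrow> ('a \<Rightarrow> real) \<Rightarrow>
     ('a \<times> 'a \<Rightarrow> 'a \<times> 'a) \<Rightarrow> bool" where
  "natural_dynamics M m V X \<longleftrightarrow>
     vector_field (tangent_bundle M) X \<and>
     (\<forall>w\<in>tangent_bundle M. \<forall>Z\<in>tangent_space (tangent_bundle M) w.
        lagrange_2form M m w (X w) Z = - tderiv (tangent_bundle M) (energy m V) w Z)"

definition gyroscopic_system ::
  "'a::euclidean_space set \<Rightarrow> ('a \<Rightarrow> 'a \<Rightarrow> 'a \<Rightarrow> real) \<Rightarrow> ('a \<Rightarrow> real) \<Rightarrow>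
     ('a \<Rightarrow> 'a \<Rightarrow> 'a \<Rightarrow> real) \<Rightarrow> bool" where
  "gyroscopic_system N n U \<kappa> \<longleftrightarrow>
     submanifold N \<and> riemannian_metric N n \<and> smooth_map N U \<and> two_form N \<kappa> \<and> closed_form N \<kappa>"

definition gyroscopic_dynamics ::
  "'a::euclidean_space set \<Rightarrow> ('a \<Rightarrow> 'a \<Rightarrow> 'a \<Rightarrow> real) \<Rightarrow> ('a \<Rightarrow> real) \<Rightarrow>
     ('a \<Rightarrow> 'a \<Rightarrow> 'a \<Rightarrow> real) \<Rightarrow> ('a \<times> 'a \<Rightarrow> 'a \<times> 'a) \<Rightarrow> bool" where
  "gyroscopic_dynamics N n U \<kappa> Y \<longleftrightarrow>
     vector_field (tangent_bundle N) Y \<and>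
     (\<forall>w\<in>tangent_bundle N. \<forall>Z\<in>tangent_space (tangent_bundle N) w.
        lagrange_2form N n w (Y w) Z
        + \<kappa> (fst w) (tderiv (tangent_bundle N) fst w (Y w)) (tderiv (tangent_bundle N) fst w Z)
        = - tderiv (tangent_bundle N) (energy n U) w Z)"

text \<open>
  In the following, \<open>v\<close> is the generating field of the symmetry group and \<open>p\<close> the quotient map
  from \<open>M\<close> to the manifold \<open>Mt\<close>.
\<close>

definition momentum ::
  "('a \<Rightarrow> 'a \<Rightarrow> 'a \<Rightarrow> real) \<Rightarrow> ('a \<Rightarrow> 'a) \<Rightarrow> 'a \<times> 'a \<Rightarrow> real" where
  "momentum m v w = m (fst w) (v (fst w)) (snd w)"

definition momentum_level ::
  "'a::euclidean_space set \<Rightarrow> ('a \<Rightarrow> 'a \<Rightarrow> 'a \<Rightarrow> real) \<Rightarrow> ('a \<Rightarrow> 'a) \<Rightarrow> real \<Rightarrow> ('a \<times> 'a) set" where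
  "momentum_level M m v k = {w \<in> tangent_bundle M. momentum m v w = k}"

definition reduced_system ::
  "'a::euclidean_space set \<Rightarrow> ('a \<Rightarrow> 'a \<Rightarrow> 'a \<Rightarrow> real) \<Rightarrow> ('a \<Rightarrow> real) \<Rightarrow> ('a \<Rightarrow> 'a) \<Rightarrow>
     'b::euclidean_space set \<Rightarrow> ('a \<Rightarrow> 'b) \<Rightarrow> real \<Rightarrow> ('b \<times> 'b \<Rightarrow> 'b \<times> 'b) \<Rightarrow> bool" where
  "reduced_system M m V v Mt p k Xt \<longleftrightarrow>
     vector_field (tangent_bundle Mt) Xt \<and>
     (\<exists>X. natural_dynamics M m V X \<and>
        (\<forall>w\<in>momentum_level M m v k.
           X w \<in> tangent_space (momentum_level M m v k) w \<and>
           tderiv (momentum_level M m v k) (tangent_map M p) w (X w) = Xt (tangent_map M p w)))"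

definition reduced_metric ::
  "'a::euclidean_space set \<Rightarrow> ('a \<Rightarrow> 'a \<Rightarrow> 'a \<Rightarrow> real) \<Rightarrow> ('a \<Rightarrow> 'a) \<Rightarrow>
     ('a \<Rightarrow> 'b::euclidean_space) \<Rightarrow> 'b \<Rightarrow> 'b \<Rightarrow> 'b \<Rightarrow> real" where
  "reduced_metric M m v p y a b =
     (THE c. \<forall>x w1 w2.
        (x, w1) \<in> momentum_level M m v 0 \<and> (x, w2) \<in> momentum_level M m v 0 \<and>
        tangent_map M p (x, w1) = (y, a) \<and> tangent_map M p (x, w2) = (y, b) \<longrightarrow> c = m x w1 w2)"

definition reduced_potential ::
  "'a::euclidean_space set \<Rightarrow> ('a \<Rightarrow> 'a \<Rightarrow> 'a \<Rightarrow> real) \<Rightarrow> ('a \<Rightarrow> real) \<Rightarrow> ('a \<Rightarrow> 'a) \<Rightarrow>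
     ('a \<Rightarrow> 'b::euclidean_space) \<Rightarrow> real \<Rightarrow> 'b \<Rightarrow> real" where
  "reduced_potential M m V v p k y =
     (THE c. \<forall>x\<in>M. p x = y \<longrightarrow> c = V x + k\<^sup>2 / (2 * m x (v x) (v x)))"

definition connection_form ::
  "('a \<Rightarrow> 'a \<Rightarrow> 'a \<Rightarrow> real) \<Rightarrow> ('a \<Rightarrow> 'a) \<Rightarrow> 'a \<Rightarrow> 'a \<Rightarrow> real" where
  "connection_form m v x u = m x (v x) u / m x (v x) (v x)"

definition gyroscopic_form ::
  "'a::euclidean_space set \<Rightarrow> ('a \<Rightarrow> 'a \<Rightarrow> 'a \<Rightarrow> real) \<Rightarrow> ('a \<Rightarrow> 'a) \<Rightarrow>
     'b::euclidean_space set \<Rightarrow> ('a \<Rightarrow> 'b) \<Rightarrow> 'b \<Rightarrow> 'b \<Rightarrow> 'b \<Rightarrow> real" where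
  "gyroscopic_form M m v Mt p =
     (THE g. two_form Mt g \<and>
        (\<forall>x\<in>M. \<forall>a\<in>tangent_space M x. \<forall>b\<in>tangent_space M x.
           g (p x) (tderiv M p x a) (tderiv M p x b) = ext_deriv M (connection_form m v) x a b))"


section \<open>The rigid body\<close>

definition SO3 :: "(real^3^3) set" where
  "SO3 = {Q. rotation_matrix Q}"

definition S2 :: "(real^3) set" where
  "S2 = sphere 0 1"

definition so3_vec :: "real^3^3 \<Rightarrow> real^3" where
  "so3_vec A = vector [A$3$2, A$1$3, A$2$1]"

definition spin :: "real^3^3 \<Rightarrow> real^3^3 \<Rightarrow> real^3" where
  "spin Q A = so3_vec (matrix_inv Q ** A)"

definition inertia :: "real \<Rightarrow> real \<Rightarrow> real \<Rightarrow> real^3^3" where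
  "inertia I1 I2 I3 = vector [vector [I1, 0, 0], vector [0, I2, 0], vector [0, 0, I3]]"

definition body_metric ::
  "real \<Rightarrow> real \<Rightarrow> real \<Rightarrow> real^3^3 \<Rightarrow> real^3^3 \<Rightarrow> real^3^3 \<Rightarrow> real" where
  "body_metric I1 I2 I3 Q A B = (inertia I1 I2 I3 *v spin Q A) \<bullet> spin Q B"

definition axis_rotation :: "real \<Rightarrow> real^3^3" where
  "axis_rotation \<tau> =
     vector [vector [1, 0, 0], vector [0, cos \<tau>, - sin \<tau>], vector [0, sin \<tau>, cos \<tau>]]"

definition body_field :: "real^3^3 \<Rightarrow> real^3^3" where
  "body_field Q = vector_derivative (\<lambda>\<tau>. axis_rotation \<tau> ** Q) (at 0)"

definition body_proj :: "real^3^3 \<Rightarrow> real^3" where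
  "body_proj Q = row 1 Q"

definition wedge :: "3 \<Rightarrow> 3 \<Rightarrow> real^3 \<Rightarrow> real^3 \<Rightarrow> real" where
  "wedge i j a b = a$i * b$j - a$j * b$i"

text \<open>
  The volume form of the sphere is the contraction of the volume form of the ambient space with
  the outer unit normal, which at \<open>\<nu>\<close> is \<open>\<nu>\<close> itself.
\<close>

definition sphere_volume :: "real^3 \<Rightarrow> real^3 \<Rightarrow> real^3 \<Rightarrow> real" where
  "sphere_volume \<nu> a b = det (vector [\<nu>, a, b] :: real^3^3)"

end

theory Submission
  imports Defs
begin

text \<open>
  Everything is described by the angular velocity \<open>w\<close> in the body frame: a tangent vector at the
  rotation \<open>Q\<close> is \<open>Q ** hat w\<close>, the projection to the sphere maps \<open>Q\<close> to its first row \<open>x\<close> and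
  this tangent vector to \<open>cross3 x w\<close>, the symmetry field has spin \<open>x\<close>, and the momentum is
  \<open>ang_mom x \<bullet> w\<close>, where \<open>ang_mom\<close> is multiplication by the inertia matrix.  The decisive algebraic
  fact is Lagrange's identity (\<open>lagrange_identity\<close>)
  \<open>axis_moment x * (ang_mom a \<bullet> b) - (ang_mom x \<bullet> a) * (ang_mom x \<bullet> b) =
    cofactor_form (cross3 x a) (cross3 x b)\<close>.
  Its right-hand side, divided by the moment of inertia about the axis \<open>x\<close>, is the reduced metric.

  Consequently, on the level \<open>k\<close> of the momentum the Lagrange form of the body is the sum of the
  pull-backs of the Lagrange form of the reduced metric and of \<open>k\<close> times the connection form, and
  the energy is the pull-back of the reduced energy with the potential increased by
  \<open>k\<^sup>2 / (2 * axis_moment x)\<close> (\<open>lform_J_ext_deriv\<close>, \<open>energy_J\<close>).  The exterior derivative of the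
  connection form is a function times the pulled back area form (\<open>ambient_ext_deriv_connection\<close>),
  and this function is positive because of the triangle inequalities.  The flow of the body is given by
  Euler's equations and is tangent to the levels of the momentum by Noether's theorem
  (\<open>body_flow_equation\<close>, \<open>body_flow_tangent_J\<close>).  Restricting its equation to a level
  and taking the exterior derivative, which commutes with pull-backs, gives exactly the equation of the
  system with gyroscopic forces for the projected flow (\<open>red_flow_dynamics\<close>).  Both dynamical
  systems are unique because the 2-forms are nondegenerate (\<open>gyroscopic_dynamics_unique\<close>), and the
  level projects onto the whole tangent bundle of the sphere (\<open>\<rho>_lift\<close>).

  To make differential forms on submanifolds and on their tangent bundles computable, the manifolds
  are treated as smooth retracts of open sets.  The invariant exterior derivative of a form that
  extends to the ambient space is then the coordinate expression of the extension
  (\<open>ext_deriv_eq\<close>); this needs that Lie brackets of tangent fields are tangent, hence the symmetry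
  of second derivatives.
\<close>

section \<open>Smooth maps between Euclidean spaces\<close>

abbreviation fderiv ::
  "('a::euclidean_space \<Rightarrow> 'b::euclidean_space) \<Rightarrow> 'a \<Rightarrow> 'a \<Rightarrow> 'b" where
  "fderiv f x \<equiv> frechet_derivative f (at x)"

lemma has_derivative_fderiv:
  "f differentiable (at x) \<Longrightarrow> (f has_derivative fderiv f x) (at x)"
  by (simp add: frechet_derivative_works)

lemma fderiv_eqI: "(f has_derivative f') (at x) \<Longrightarrow> fderiv f x = f'"
  by (metis frechet_derivative_at)

lemma linear_fderiv: "f differentiable (at x) \<Longrightarrow> linear (fderiv f x)"
  using has_derivative_fderiv has_derivative_linear by blast

lemma
  assumes "open U" "x \<in> U" "\<And>y. y \<in> U \<Longrightarrow> f y = g y"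
  shows differentiable_cong_open: "f differentiable (at x) \<longleftrightarrow> g differentiable (at x)"
    and fderiv_cong_open: "fderiv f x = fderiv g x"
proof -
  have eq: "(f has_derivative f') (at x) \<longleftrightarrow> (g has_derivative f') (at x)" for f'
    using has_derivative_transform_within_open[of f f' x UNIV U g]
      has_derivative_transform_within_open[of g f' x UNIV U f] assms by auto
  show "f differentiable (at x) \<longleftrightarrow> g differentiable (at x)"
    unfolding differentiable_def eq ..
  show "fderiv f x = fderiv g x"
    unfolding frechet_derivative_def eq ..
qed

lemma Ck_on_cong:
  assumes "open U" "\<And>y. y \<in> U \<Longrightarrow> f y = g y"
  shows "Ck_on r f U \<longleftrightarrow> Ck_on r g U"
  using assms
proof (induction r arbitrary: f g)
  case 0
  then show ?case by (simp cong: continuous_on_cong)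
next
  case (Suc r)
  have "Ck_on r (\<lambda>x. fderiv f x v) U \<longleftrightarrow> Ck_on r (\<lambda>x. fderiv g x v) U" for v
    by (rule Suc.IH[OF Suc.prems(1)]) (metis fderiv_cong_open Suc.prems)
  then show ?case
    using differentiable_cong_open[OF Suc.prems(1), of _ f g] Suc.prems(2) by simp
qed

text \<open>
  The definition refers to one particular choice of derivative; closure proofs supply a derivative
  by the rules of calculus instead.
\<close>

lemma Ck_on_SucI:
  assumes "open U" "\<And>x. x \<in> U \<Longrightarrow> (f has_derivative f' x) (at x)"
    and "\<And>v. Ck_on r (\<lambda>x. f' x v) U"
  shows "Ck_on (Suc r) f U"
proof -
  have "Ck_on r (\<lambda>x. fderiv f x v) U" for v
    using assms(3)[of v] Ck_on_cong[OF assms(1), of "\<lambda>x. fderiv f x v" "\<lambda>x. f' x v"]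
      fderiv_eqI[OF assms(2)] by simp
  then show ?thesis
    using assms(2) by (auto simp: differentiable_def)
qed

lemma Ck_on_SucD:
  assumes "Ck_on (Suc r) f U"
  shows "x \<in> U \<Longrightarrow> (f has_derivative fderiv f x) (at x)" "Ck_on r (\<lambda>x. fderiv f x v) U"
  using assms has_derivative_fderiv by auto

lemma Ck_on_Suc_imp: "Ck_on (Suc r) f U \<Longrightarrow> Ck_on r f U"
proof (induction r arbitrary: f)
  case 0
  then show ?case
    by (auto intro!: continuous_at_imp_continuous_on differentiable_imp_continuous_within)
next
  case (Suc r)
  then show ?case by simp
qed

lemma Ck_on_subset: "Ck_on r f U \<Longrightarrow> V \<subseteq> U \<Longrightarrow> Ck_on r f V"
  by (induction r arbitrary: f) (auto intro: continuous_on_subset)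

text \<open>
  Smoothness is local, because the definition consists of pointwise conditions apart from
  continuity.
\<close>

lemma Ck_on_local:
  assumes "\<And>x. x \<in> U \<Longrightarrow> \<exists>W. open W \<and> x \<in> W \<and> Ck_on r f W"
  shows "Ck_on r f U"
  using assms
proof (induction r arbitrary: f)
  case 0
  then show ?case
    by (auto intro!: continuous_at_imp_continuous_on) (meson continuous_on_eq_continuous_at)
next
  case (Suc r)
  then show ?case by simp meson
qed

lemma Ck_on_const: "Ck_on r (\<lambda>x. c) U"
  by (induction r arbitrary: c) auto

lemma Ck_on_bounded_linear:
  assumes "bounded_linear L" "open U" "Ck_on r f U"
  shows "Ck_on r (\<lambda>x. L (f x)) U"
  using assms(3)
proof (induction r arbitrary: f)
  case 0
  then show ?case
    by (simp add: bounded_linear.continuous_on[OF assms(1)])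
next
  case (Suc r)
  show ?case
  proof (rule Ck_on_SucI[OF assms(2)])
    show "((\<lambda>x. L (f x)) has_derivative (\<lambda>v. L (fderiv f x v))) (at x)" if "x \<in> U" for x
      by (rule bounded_linear.has_derivative[OF assms(1) Ck_on_SucD(1)[OF Suc.prems that]])
    show "Ck_on r (\<lambda>x. L (fderiv f x v)) U" for v
      by (rule Suc.IH[OF Ck_on_SucD(2)[OF Suc.prems]])
  qed
qed

lemma Ck_on_add:
  assumes "open U" "Ck_on r f U" "Ck_on r g U"
  shows "Ck_on r (\<lambda>x. f x + g x) U"
  using assms(2,3)
proof (induction r arbitrary: f g)
  case 0
  then show ?case by (simp add: continuous_on_add)
next
  case (Suc r)
  show ?case
  proof (rule Ck_on_SucI[OF assms(1)])
    show "((\<lambda>x. f x + g x) has_derivative (\<lambda>v. fderiv f x v + fderiv g x v)) (at x)"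
      if "x \<in> U" for x
      by (rule has_derivative_add[OF Ck_on_SucD(1)[OF Suc.prems(1) that]
            Ck_on_SucD(1)[OF Suc.prems(2) that]])
    show "Ck_on r (\<lambda>x. fderiv f x v + fderiv g x v) U" for v
      by (rule Suc.IH[OF Ck_on_SucD(2)[OF Suc.prems(1)] Ck_on_SucD(2)[OF Suc.prems(2)]])
  qed
qed

lemma Ck_on_bounded_bilinear:
  assumes "bounded_bilinear B" "open U" "Ck_on r f U" "Ck_on r g U"
  shows "Ck_on r (\<lambda>x. B (f x) (g x)) U"
  using assms(3,4)
proof (induction r arbitrary: f g)
  case 0
  then show ?case by (simp add: bounded_bilinear.continuous_on[OF assms(1)])
next
  case (Suc r)
  show ?case
  proof (rule Ck_on_SucI[OF assms(2)])
    show "((\<lambda>x. B (f x) (g x)) has_derivative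
        (\<lambda>v. B (f x) (fderiv g x v) + B (fderiv f x v) (g x))) (at x)" if "x \<in> U" for x
      by (rule bounded_bilinear.FDERIV[OF assms(1) Ck_on_SucD(1)[OF Suc.prems(1) that]
            Ck_on_SucD(1)[OF Suc.prems(2) that]])
    show "Ck_on r (\<lambda>x. B (f x) (fderiv g x v) + B (fderiv f x v) (g x)) U" for v
      by (rule Ck_on_add[OF assms(2)
            Suc.IH[OF Ck_on_Suc_imp[OF Suc.prems(1)] Ck_on_SucD(2)[OF Suc.prems(2)]]
            Suc.IH[OF Ck_on_SucD(2)[OF Suc.prems(1)] Ck_on_Suc_imp[OF Suc.prems(2)]]])
  qed
qed

lemma Ck_on_sum:
  assumes "open U" "\<And>i. i \<in> A \<Longrightarrow> Ck_on r (f i) U"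
  shows "Ck_on r (\<lambda>x. \<Sum>i\<in>A. f i x) U"
  using assms(2)
  by (induction A rule: infinite_finite_induct) (auto intro: Ck_on_const Ck_on_add assms(1))

text \<open>
  A derivative in a variable direction is a combination of derivatives in constant directions,
  whose smoothness the definition provides.
\<close>

lemma fderiv_basis_expansion:
  assumes "f differentiable (at x)"
  shows "fderiv f x v = (\<Sum>b\<in>Basis. (v \<bullet> b) *\<^sub>R fderiv f x b)"
proof -
  have "fderiv f x (\<Sum>b\<in>Basis. (v \<bullet> b) *\<^sub>R b) = (\<Sum>b\<in>Basis. (v \<bullet> b) *\<^sub>R fderiv f x b)"
    by (simp only: linear_sum[OF linear_fderiv[OF assms]] linear_scale[OF linear_fderiv[OF assms]])
  then show ?thesis by (simp only: euclidean_representation)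
qed

lemma Ck_on_compose:
  assumes "open U" "open V" "Ck_on r f U" "Ck_on r g V" "f ` U \<subseteq> V"
  shows "Ck_on r (\<lambda>x. g (f x)) U"
  using assms(3,4)
proof (induction r arbitrary: g)
  case 0
  then show ?case using continuous_on_compose2 assms(5) by auto
next
  case (Suc r)
  have fr: "Ck_on r f U" by (rule Ck_on_Suc_imp[OF Suc.prems(1)])
  have gd: "x \<in> U \<Longrightarrow> g differentiable (at (f x))" for x
    using Suc.prems(2) assms(5) by auto
  show ?case
  proof (rule Ck_on_SucI[OF assms(1)])
    show "((\<lambda>x. g (f x)) has_derivative (\<lambda>v. fderiv g (f x) (fderiv f x v))) (at x)"
      if "x \<in> U" for x
      by (rule has_derivative_compose[OF Ck_on_SucD(1)[OF Suc.prems(1) that]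
            has_derivative_fderiv[OF gd[OF that]]])
    show "Ck_on r (\<lambda>x. fderiv g (f x) (fderiv f x v)) U" for v
    proof -
      have "Ck_on r (\<lambda>x. \<Sum>b\<in>Basis. (fderiv f x v \<bullet> b) *\<^sub>R fderiv g (f x) b) U"
        by (intro Ck_on_sum Ck_on_bounded_bilinear[OF bounded_bilinear_scaleR]
            Ck_on_bounded_linear[OF bounded_linear_inner_left] Suc.IH fr assms(1)
            Ck_on_SucD(2)[OF Suc.prems(1)] Ck_on_SucD(2)[OF Suc.prems(2)])
      then show ?thesis
        by (subst Ck_on_cong[OF assms(1) fderiv_basis_expansion[OF gd]])
    qed
  qed
qed

lemma Ck_on_inverse: "Ck_on r (inverse :: real \<Rightarrow> real) (- {0})"
proof (induction r)
  case 0
  then show ?case by (auto intro!: continuous_intros)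
next
  case (Suc r)
  show ?case
  proof (rule Ck_on_SucI)
    show "Ck_on r (\<lambda>x. - (inverse x * v * inverse x)) (- {0})" for v :: real
      by (intro Ck_on_bounded_linear[OF bounded_linear_minus[OF bounded_linear_ident]]
          Ck_on_bounded_bilinear[OF bounded_bilinear_mult] Suc Ck_on_const) auto
  qed (auto intro: has_derivative_inverse')
qed

lemma Ck_on_sqrt: "Ck_on r sqrt {0<..}"
proof (induction r)
  case 0
  then show ?case by (auto intro!: continuous_intros)
next
  case (Suc r)
  show ?case
  proof (rule Ck_on_SucI)
    show "(sqrt has_derivative (\<lambda>v. (inverse (sqrt x) / 2) * v)) (at x)" if "x \<in> {0<..}" for x
      using DERIV_real_sqrt[of x] that unfolding has_field_derivative_def by (simp only: greaterThan_iff)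
    have "Ck_on r (\<lambda>x. inverse (sqrt x)) {0<..}"
      by (rule Ck_on_compose[OF _ _ Suc Ck_on_inverse]) auto
    moreover have "bounded_linear (\<lambda>y::real. y / 2 * v)" for v
      unfolding linear_conv_bounded_linear[symmetric]
      by (rule linearI) (auto simp: field_simps)
    ultimately show "Ck_on r (\<lambda>x. (inverse (sqrt x) / 2) * v) {0<..}" for v
      using Ck_on_bounded_linear[of "\<lambda>y. y / 2 * v" "{0<..}"] open_greaterThan by blast
  qed auto
qed

lemma smooth_on_cong:
  "open U \<Longrightarrow> (\<And>y. y \<in> U \<Longrightarrow> f y = g y) \<Longrightarrow> smooth_on U f \<longleftrightarrow> smooth_on U g"
  using Ck_on_cong unfolding smooth_on_def by blast

lemma smooth_on_subset: "smooth_on U f \<Longrightarrow> V \<subseteq> U \<Longrightarrow> smooth_on V f"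
  using Ck_on_subset unfolding smooth_on_def by blast

lemma smooth_on_differentiable: "smooth_on U f \<Longrightarrow> x \<in> U \<Longrightarrow> f differentiable (at x)"
  unfolding smooth_on_def by (metis Ck_on.simps(2))

lemma smooth_on_has_derivative:
  "smooth_on U f \<Longrightarrow> x \<in> U \<Longrightarrow> (f has_derivative fderiv f x) (at x)"
  using smooth_on_differentiable has_derivative_fderiv by blast

lemma smooth_on_continuous_on: "smooth_on U f \<Longrightarrow> continuous_on U f"
  unfolding smooth_on_def by (metis Ck_on.simps(1))

lemma smooth_on_fderiv: "smooth_on U f \<Longrightarrow> smooth_on U (\<lambda>x. fderiv f x v)"
  unfolding smooth_on_def by (metis Ck_on.simps(2))

lemma smooth_on_local:
  assumes "\<And>x. x \<in> U \<Longrightarrow> \<exists>W. open W \<and> x \<in> W \<and> smooth_on W f"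
  shows "smooth_on U f"
  using assms Ck_on_local unfolding smooth_on_def by meson

lemma smooth_on_const: "smooth_on U (\<lambda>x. c)"
  unfolding smooth_on_def using Ck_on_const by blast

lemma smooth_on_bounded_linear:
  "bounded_linear L \<Longrightarrow> open U \<Longrightarrow> smooth_on U f \<Longrightarrow> smooth_on U (\<lambda>x. L (f x))"
  unfolding smooth_on_def using Ck_on_bounded_linear by blast

lemma smooth_on_id: "smooth_on U (\<lambda>x. x)"
proof -
  have "Ck_on r (\<lambda>x. x) (UNIV :: 'a set)" for r
  proof (cases r)
    case (Suc s)
    then show ?thesis using Ck_on_SucI[of UNIV "\<lambda>x. x" "\<lambda>x v. v" s] Ck_on_const by auto
  qed auto
  then show ?thesis unfolding smooth_on_def using Ck_on_subset by blast
qed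

lemma smooth_on_linear: "bounded_linear L \<Longrightarrow> smooth_on U L"
  using smooth_on_bounded_linear[of L UNIV "\<lambda>x. x"] smooth_on_id smooth_on_subset by blast

lemma smooth_on_add:
  "open U \<Longrightarrow> smooth_on U f \<Longrightarrow> smooth_on U g \<Longrightarrow> smooth_on U (\<lambda>x. f x + g x)"
  unfolding smooth_on_def using Ck_on_add by blast

lemma smooth_on_minus: "open U \<Longrightarrow> smooth_on U f \<Longrightarrow> smooth_on U (\<lambda>x. - f x)"
  by (rule smooth_on_bounded_linear[OF bounded_linear_minus[OF bounded_linear_ident]])

lemma smooth_on_diff:
  "open U \<Longrightarrow> smooth_on U f \<Longrightarrow> smooth_on U g \<Longrightarrow> smooth_on U (\<lambda>x. f x - g x)"
  using smooth_on_add[of U f "\<lambda>x. - g x"] smooth_on_minus[of U g] by simp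

lemma smooth_on_sum:
  "open U \<Longrightarrow> (\<And>i. i \<in> A \<Longrightarrow> smooth_on U (f i)) \<Longrightarrow> smooth_on U (\<lambda>x. \<Sum>i\<in>A. f i x)"
  by (simp add: smooth_on_def Ck_on_sum)

lemma smooth_on_bounded_bilinear:
  "bounded_bilinear B \<Longrightarrow> open U \<Longrightarrow> smooth_on U f \<Longrightarrow> smooth_on U g \<Longrightarrow>
    smooth_on U (\<lambda>x. B (f x) (g x))"
  by (simp add: smooth_on_def Ck_on_bounded_bilinear)

lemmas smooth_on_scaleR = smooth_on_bounded_bilinear[OF bounded_bilinear_scaleR]
lemmas smooth_on_inner = smooth_on_bounded_bilinear[OF bounded_bilinear_inner]

lemma smooth_on_mult:
  "open U \<Longrightarrow> smooth_on U f \<Longrightarrow> smooth_on U g \<Longrightarrow> smooth_on U (\<lambda>x. f x * g x :: real)"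
  by (rule smooth_on_bounded_bilinear[OF bounded_bilinear_mult])

lemma smooth_on_power:
  "open U \<Longrightarrow> smooth_on U f \<Longrightarrow> smooth_on U (\<lambda>x. f x ^ n :: real)"
  by (induction n) (auto intro: smooth_on_const smooth_on_mult)

lemma smooth_on_compose:
  "open U \<Longrightarrow> open V \<Longrightarrow> smooth_on U f \<Longrightarrow> smooth_on V g \<Longrightarrow> f ` U \<subseteq> V \<Longrightarrow>
    smooth_on U (\<lambda>x. g (f x))"
  by (simp add: smooth_on_def Ck_on_compose)

lemma smooth_on_divide:
  fixes f g :: "'a::euclidean_space \<Rightarrow> real"
  assumes "open U" "smooth_on U f" "smooth_on U g" "\<And>x. x \<in> U \<Longrightarrow> g x \<noteq> 0"
  shows "smooth_on U (\<lambda>x. f x / g x)"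
proof -
  have "smooth_on (- {0}) (inverse :: real \<Rightarrow> real)"
    using Ck_on_inverse unfolding smooth_on_def by blast
  then have "smooth_on U (\<lambda>x. inverse (g x))"
    using assms by (intro smooth_on_compose[of U "- {0}" g inverse]) auto
  then show ?thesis
    using smooth_on_mult[OF assms(1,2)] by (simp add: divide_inverse)
qed

lemma smooth_on_sqrt:
  assumes "open U" "smooth_on U f" "\<And>x. x \<in> U \<Longrightarrow> f x > 0"
  shows "smooth_on U (\<lambda>x. sqrt (f x))"
proof -
  have "smooth_on {0<..} sqrt"
    using Ck_on_sqrt unfolding smooth_on_def by blast
  then show ?thesis
    using assms by (intro smooth_on_compose[of U "{0<..}" f sqrt]) auto
qed

lemma smooth_on_norm:
  assumes "open U" "smooth_on U f" "\<And>x. x \<in> U \<Longrightarrow> f x \<noteq> 0"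
  shows "smooth_on U (\<lambda>x. norm (f x))"
  unfolding norm_eq_sqrt_inner using assms by (intro smooth_on_sqrt smooth_on_inner) auto

lemma smooth_on_Pair:
  assumes "open U" "smooth_on U f" "smooth_on U g"
  shows "smooth_on U (\<lambda>x. (f x, g x))"
proof -
  have "smooth_on U (\<lambda>x. (f x, 0) + (0, g x))"
    using assms
    by (intro smooth_on_add smooth_on_bounded_linear[of "\<lambda>y. (y, 0)"]
        smooth_on_bounded_linear[of "\<lambda>y. (0, y)"])
      (auto intro!: bounded_linear_intros)
  then show ?thesis by simp
qed

lemma smooth_on_fst: "open U \<Longrightarrow> smooth_on U f \<Longrightarrow> smooth_on U (\<lambda>x. fst (f x))"
  by (rule smooth_on_bounded_linear[OF bounded_linear_fst])

lemma smooth_on_snd: "open U \<Longrightarrow> smooth_on U f \<Longrightarrow> smooth_on U (\<lambda>x. snd (f x))"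
  by (rule smooth_on_bounded_linear[OF bounded_linear_snd])

lemma smooth_on_nth: "open U \<Longrightarrow> smooth_on U f \<Longrightarrow> smooth_on U (\<lambda>x. f x $ i)"
  by (rule smooth_on_bounded_linear[OF bounded_linear_vec_nth])

lemma smooth_on_vec:
  fixes f :: "'a::euclidean_space \<Rightarrow> 'b::euclidean_space ^ 'n"
  assumes "open U" "\<And>i. smooth_on U (\<lambda>x. f x $ i)"
  shows "smooth_on U f"
proof -
  have lin: "bounded_linear (\<lambda>y::'b. axis i y :: 'b ^ 'n)" for i
    unfolding linear_conv_bounded_linear[symmetric]
    by (rule linearI) (auto simp: axis_def vec_eq_iff)
  have "smooth_on U (\<lambda>x. \<Sum>i\<in>UNIV. axis i (f x $ i))"
    by (intro smooth_on_sum smooth_on_bounded_linear[OF lin] assms)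
  moreover have "(\<Sum>i\<in>UNIV. axis i (y $ i)) = y" for y :: "'b ^ 'n"
    by (simp add: vec_eq_iff axis_def if_distrib cong: if_cong)
  ultimately show ?thesis by simp
qed

lemma smooth_on_fderiv_apply:
  assumes "open U" "open V" "smooth_on V f" "smooth_on U p" "p ` U \<subseteq> V" "smooth_on U w"
  shows "smooth_on U (\<lambda>x. fderiv f (p x) (w x))"
proof -
  have "smooth_on U (\<lambda>x. \<Sum>b\<in>Basis. (w x \<bullet> b) *\<^sub>R fderiv f (p x) b)"
    by (intro smooth_on_sum smooth_on_scaleR smooth_on_inner smooth_on_const assms(1,6)
        smooth_on_compose[OF assms(1,2,4) smooth_on_fderiv[OF assms(3)] assms(5)])
  moreover have "f differentiable (at (p x))" if "x \<in> U" for x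
    using that assms(3,5) smooth_on_differentiable by blast
  ultimately show ?thesis
    by (subst smooth_on_cong[OF assms(1) fderiv_basis_expansion])
qed

section \<open>Symmetry of second derivatives\<close>

lemma has_vector_derivative_chain:
  "(\<gamma> has_vector_derivative u) (at t) \<Longrightarrow> (f has_derivative f') (at (\<gamma> t)) \<Longrightarrow>
    ((\<lambda>s. f (\<gamma> s)) has_vector_derivative f' u) (at t)"
  unfolding has_vector_derivative_def
  by (drule (1) has_derivative_compose) (simp add: has_derivative_linear linear_scale)

lemma has_real_derivative_along_line:
  fixes f :: "'a::euclidean_space \<Rightarrow> real"
  assumes "f differentiable (at (x + t *\<^sub>R u))"
  shows "((\<lambda>s. f (x + s *\<^sub>R u)) has_real_derivative fderiv f (x + t *\<^sub>R u) u) (at t)"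
proof -
  have "((\<lambda>s. x + s *\<^sub>R u) has_vector_derivative u) (at t)"
    by (auto intro!: derivative_eq_intros simp: has_vector_derivative_def)
  from has_vector_derivative_chain[OF this has_derivative_fderiv[OF assms]]
  show ?thesis by (simp add: has_real_derivative_iff_has_vector_derivative)
qed

text \<open>
  The argument of Schwarz: the second difference over a small parallelogram is symmetric in the two
  directions, and the mean value theorem, applied once in each direction, expresses it by either of
  the mixed derivatives at some point of the parallelogram.
\<close>

lemma second_difference_mvt:
  fixes f :: "'a::euclidean_space \<Rightarrow> real"
  assumes sm: "smooth_on U f" and t: "t > 0"
    and box: "\<And>s r. 0 \<le> s \<Longrightarrow> s \<le> t \<Longrightarrow> 0 \<le> r \<Longrightarrow> r \<le> t \<Longrightarrow> x + s *\<^sub>R u + r *\<^sub>R v \<in> U"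
  shows "\<exists>s r. 0 < s \<and> s < t \<and> 0 < r \<and> r < t \<and>
    f (x + t *\<^sub>R u + t *\<^sub>R v) - f (x + t *\<^sub>R u) - f (x + t *\<^sub>R v) + f x =
      t\<^sup>2 * fderiv (\<lambda>y. fderiv f y u) (x + s *\<^sub>R u + r *\<^sub>R v) v"
proof -
  have *: "((\<lambda>s. f (x + s *\<^sub>R u + r *\<^sub>R v)) has_real_derivative
      fderiv f (x + s *\<^sub>R u + r *\<^sub>R v) u) (at s)"
    if "0 \<le> s" "s \<le> t" "0 \<le> r" "r \<le> t" for s r
    using has_real_derivative_along_line[of f "x + r *\<^sub>R v" s u]
      smooth_on_differentiable[OF sm box[OF that]] by (simp add: ac_simps)
  have "\<exists>s>0. s < t \<and>
      (f (x + t *\<^sub>R u + t *\<^sub>R v) - f (x + t *\<^sub>R u + 0 *\<^sub>R v))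
        - (f (x + 0 *\<^sub>R u + t *\<^sub>R v) - f (x + 0 *\<^sub>R u + 0 *\<^sub>R v)) =
      (t - 0) * (fderiv f (x + s *\<^sub>R u + t *\<^sub>R v) u - fderiv f (x + s *\<^sub>R u + 0 *\<^sub>R v) u)"
    using t by (intro MVT2 derivative_intros *) auto
  then obtain s where s: "0 < s" "s < t"
    "(f (x + t *\<^sub>R u + t *\<^sub>R v) - f (x + t *\<^sub>R u + 0 *\<^sub>R v))
        - (f (x + 0 *\<^sub>R u + t *\<^sub>R v) - f (x + 0 *\<^sub>R u + 0 *\<^sub>R v)) =
      t * (fderiv f (x + s *\<^sub>R u + t *\<^sub>R v) u - fderiv f (x + s *\<^sub>R u + 0 *\<^sub>R v) u)"
    by auto
  have "\<exists>r>0. r < t \<and>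
      fderiv f (x + s *\<^sub>R u + t *\<^sub>R v) u - fderiv f (x + s *\<^sub>R u + 0 *\<^sub>R v) u =
      (t - 0) * fderiv (\<lambda>y. fderiv f y u) (x + s *\<^sub>R u + r *\<^sub>R v) v"
    using t s by (intro MVT2 has_real_derivative_along_line
        smooth_on_differentiable[OF smooth_on_fderiv[OF sm]] box) auto
  then obtain r where "0 < r" "r < t"
    "fderiv f (x + s *\<^sub>R u + t *\<^sub>R v) u - fderiv f (x + s *\<^sub>R u + 0 *\<^sub>R v) u =
      t * fderiv (\<lambda>y. fderiv f y u) (x + s *\<^sub>R u + r *\<^sub>R v) v"
    by auto
  then show ?thesis
    using s by (intro exI[of _ s] exI[of _ r]) (simp add: power2_eq_square algebra_simps)
qed

lemma fderiv_commute_real: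
  fixes f :: "'a::euclidean_space \<Rightarrow> real"
  assumes U: "open U" and sm: "smooth_on U f" and x: "x \<in> U"
  shows "fderiv (\<lambda>y. fderiv f y u) x v = fderiv (\<lambda>y. fderiv f y v) x u"
proof -
  let ?A = "\<lambda>y. fderiv (\<lambda>y. fderiv f y u) y v"
  let ?B = "\<lambda>y. fderiv (\<lambda>y. fderiv f y v) y u"
  have "\<bar>?A x - ?B x\<bar> \<le> 0 + e" if e: "e > 0" for e
  proof -
    have "isCont ?A x" "isCont ?B x"
      using smooth_on_continuous_on[OF smooth_on_fderiv[OF smooth_on_fderiv[OF sm]]]
        continuous_on_eq_continuous_at[OF U] x by blast+
    then obtain d1 d2 where d12: "d1 > 0" "\<And>y. dist y x < d1 \<Longrightarrow> dist (?A y) (?A x) < e / 2"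
      "d2 > 0" "\<And>y. dist y x < d2 \<Longrightarrow> dist (?B y) (?B x) < e / 2"
      unfolding continuous_at_eps_delta using e by (metis half_gt_zero)
    obtain d0 where d0: "d0 > 0" "ball x d0 \<subseteq> U" using U x openE by blast
    define d where "d = min d0 (min d1 d2)"
    define t where "t = d / (2 * (norm u + norm v + 1))"
    have d: "d > 0" using d0 d12 by (simp add: d_def)
    then have t: "t > 0" by (simp add: t_def add_nonneg_pos)
    have tb: "t * (norm u + norm v) < d"
    proof -
      have "t * (norm u + norm v) \<le> t * (norm u + norm v + 1)"
        using t by (intro mult_left_mono) auto
      also have "\<dots> = d / 2"
        unfolding t_def using add_nonneg_pos[of "norm u + norm v" 1]
        by (simp add: field_simps)
      finally show ?thesis using d by simp
    qed
    have near: "dist (x + s *\<^sub>R u + r *\<^sub>R v) x < d" if "0 \<le> s" "s \<le> t" "0 \<le> r" "r \<le> t" for s r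
    proof -
      have "dist (x + s *\<^sub>R u + r *\<^sub>R v) x = norm (s *\<^sub>R u + r *\<^sub>R v)"
        by (simp add: dist_norm ac_simps)
      also have "\<dots> \<le> s * norm u + r * norm v"
        using norm_triangle_ineq[of "s *\<^sub>R u" "r *\<^sub>R v"] that by simp
      also have "\<dots> \<le> t * norm u + t * norm v"
        using that by (intro add_mono mult_right_mono) auto
      finally show ?thesis using tb by (simp add: algebra_simps)
    qed
    have box: "x + s *\<^sub>R u + r *\<^sub>R v \<in> U" if "0 \<le> s" "s \<le> t" "0 \<le> r" "r \<le> t" for s r
      using near[OF that] d0(2) by (auto simp: d_def dist_commute subset_iff)
    have box': "x + s *\<^sub>R v + r *\<^sub>R u \<in> U" if "0 \<le> s" "s \<le> t" "0 \<le> r" "r \<le> t" for s r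
      using box[of r s] that by (simp add: ac_simps)
    obtain s r where sr: "0 < s" "s < t" "0 < r" "r < t"
      "f (x + t *\<^sub>R u + t *\<^sub>R v) - f (x + t *\<^sub>R u) - f (x + t *\<^sub>R v) + f x =
        t\<^sup>2 * ?A (x + s *\<^sub>R u + r *\<^sub>R v)"
      using second_difference_mvt[of U f t x u v, OF sm t box] by blast
    obtain s' r' where sr': "0 < s'" "s' < t" "0 < r'" "r' < t"
      "f (x + t *\<^sub>R v + t *\<^sub>R u) - f (x + t *\<^sub>R v) - f (x + t *\<^sub>R u) + f x =
        t\<^sup>2 * ?B (x + s' *\<^sub>R v + r' *\<^sub>R u)"
      using second_difference_mvt[of U f t x v u, OF sm t box'] by blast
    have swap: "x + t *\<^sub>R v + t *\<^sub>R u = x + t *\<^sub>R u + t *\<^sub>R v"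
      "x + s' *\<^sub>R v + r' *\<^sub>R u = x + r' *\<^sub>R u + s' *\<^sub>R v"
      by (simp_all add: ac_simps)
    have "t\<^sup>2 * ?A (x + s *\<^sub>R u + r *\<^sub>R v) = t\<^sup>2 * ?B (x + r' *\<^sub>R u + s' *\<^sub>R v)"
      using sr(5) sr'(5)[unfolded swap] by linarith
    then have eq: "?A (x + s *\<^sub>R u + r *\<^sub>R v) = ?B (x + r' *\<^sub>R u + s' *\<^sub>R v)"
      using t by simp
    have "dist (?A (x + s *\<^sub>R u + r *\<^sub>R v)) (?A x) < e / 2"
      using near[of s r] sr by (intro d12(2)) (auto simp: d_def)
    moreover have "dist (?B (x + r' *\<^sub>R u + s' *\<^sub>R v)) (?B x) < e / 2"
      using near[of r' s'] sr' by (intro d12(4)) (auto simp: d_def)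
    ultimately show ?thesis
      unfolding eq dist_real_def by linarith
  qed
  then have "\<bar>?A x - ?B x\<bar> \<le> 0" by (rule field_le_epsilon)
  then show ?thesis by simp
qed

lemma fderiv_inner: "f differentiable (at y) \<Longrightarrow> fderiv (\<lambda>y. f y \<bullet> b) y u = fderiv f y u \<bullet> b"
  using fderiv_eqI[OF has_derivative_inner_left[OF has_derivative_fderiv]] by metis

lemma fderiv_commute:
  assumes U: "open U" and sm: "smooth_on U f" and x: "x \<in> U"
  shows "fderiv (\<lambda>y. fderiv f y u) x v = fderiv (\<lambda>y. fderiv f y v) x u"
proof (rule euclidean_eqI)
  fix b :: 'b
  have sb: "smooth_on U (\<lambda>y. f y \<bullet> b)"
    by (intro smooth_on_inner smooth_on_const U sm)
  have *: "fderiv (\<lambda>y. fderiv f y u) x v \<bullet> b = fderiv (\<lambda>y. fderiv (\<lambda>y. f y \<bullet> b) y u) x v"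
    for u v
  proof -
    have "fderiv (\<lambda>y. fderiv (\<lambda>y. f y \<bullet> b) y u) x = fderiv (\<lambda>y. fderiv f y u \<bullet> b) x"
      by (rule fderiv_cong_open[OF U x]) (rule fderiv_inner[OF smooth_on_differentiable[OF sm]])
    then show ?thesis
      using fderiv_inner[OF smooth_on_differentiable[OF smooth_on_fderiv[OF sm] x]] by simp
  qed
  show "fderiv (\<lambda>y. fderiv f y u) x v \<bullet> b = fderiv (\<lambda>y. fderiv f y v) x u \<bullet> b"
    unfolding * by (rule fderiv_commute_real[OF U sb x])
qed

text \<open>
  The product rule for a form applied to a field.  Expanding in a basis reduces it to the
  differentiability of the coefficients \<open>\<alpha> z e\<close>, and \<open>V\<close> admits families such as \<open>fderiv r\<close> that are
  linear only where \<open>r\<close> is differentiable.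
\<close>

lemma has_derivative_linear_family:
  fixes \<alpha> :: "'a::euclidean_space \<Rightarrow> 'b::euclidean_space \<Rightarrow> 'c::euclidean_space"
    and p :: "'d::euclidean_space \<Rightarrow> 'a"
  assumes V: "open V" "p y \<in> V" and lin: "\<And>z. z \<in> V \<Longrightarrow> linear (\<alpha> z)"
    and diff: "\<And>e. (\<lambda>z. \<alpha> z e) differentiable (at (p y))"
    and p: "(p has_derivative p') (at y)" and w: "(w has_derivative w') (at y)"
  shows "((\<lambda>y. \<alpha> (p y) (w y)) has_derivative
      (\<lambda>h. fderiv (\<lambda>z. \<alpha> z (w y)) (p y) (p' h) + \<alpha> (p y) (w' h))) (at y)"
proof -
  have rep: "\<alpha> z e = (\<Sum>b\<in>Basis. (e \<bullet> b) *\<^sub>R \<alpha> z b)" if "z \<in> V" for z e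
    by (subst euclidean_representation[of e, symmetric])
      (simp only: linear_sum[OF lin[OF that]] linear_scale[OF lin[OF that]])
  have "fderiv (\<lambda>z. \<alpha> z (w y)) (p y) = fderiv (\<lambda>z. \<Sum>b\<in>Basis. (w y \<bullet> b) *\<^sub>R \<alpha> z b) (p y)"
    by (rule fderiv_cong_open[OF V]) (rule rep)
  also have "\<dots> = (\<lambda>h. \<Sum>b\<in>Basis. (w y \<bullet> b) *\<^sub>R fderiv (\<lambda>z. \<alpha> z b) (p y) h)"
    by (intro fderiv_eqI has_derivative_sum has_derivative_scaleR_right has_derivative_fderiv diff)
  finally have 1: "fderiv (\<lambda>z. \<alpha> z (w y)) (p y) =
    (\<lambda>h. \<Sum>b\<in>Basis. (w y \<bullet> b) *\<^sub>R fderiv (\<lambda>z. \<alpha> z b) (p y) h)" .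
  have "((\<lambda>y. \<Sum>b\<in>Basis. (w y \<bullet> b) *\<^sub>R \<alpha> (p y) b) has_derivative
      (\<lambda>h. \<Sum>b\<in>Basis. (w y \<bullet> b) *\<^sub>R fderiv (\<lambda>z. \<alpha> z b) (p y) (p' h) + (w' h \<bullet> b) *\<^sub>R \<alpha> (p y) b))
      (at y)"
    by (intro has_derivative_sum has_derivative_scaleR has_derivative_inner_left w
        has_derivative_compose[OF p has_derivative_fderiv[OF diff]])
  then have 2: "((\<lambda>y. \<Sum>b\<in>Basis. (w y \<bullet> b) *\<^sub>R \<alpha> (p y) b) has_derivative
      (\<lambda>h. fderiv (\<lambda>z. \<alpha> z (w y)) (p y) (p' h) + \<alpha> (p y) (w' h))) (at y)"
    unfolding 1 by (simp only: sum.distrib rep[OF V(2), of "w' _"])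
  have "\<forall>\<^sub>F z in at y. p z \<in> V"
    using has_derivative_continuous[OF p] V
    by (simp add: continuous_within topological_tendstoD)
  then have "\<forall>\<^sub>F z in at y. (\<Sum>b\<in>Basis. (w z \<bullet> b) *\<^sub>R \<alpha> (p z) b) = \<alpha> (p z) (w z)"
    by (rule eventually_mono) (rule rep[symmetric])
  then show ?thesis
    using rep[OF V(2), of "w y", symmetric]
    by (intro has_derivative_transform_eventually[OF 2]) simp_all
qed

section \<open>Curves and tangent vectors\<close>

lemma curve_at_imp_tangent: "curve_at N x u \<gamma> \<Longrightarrow> u \<in> tangent_space N x"
  by (auto simp: tangent_space_def)

lemma curve_at_image:
  assumes c: "curve_at N x u \<gamma>" and W: "open W" "x \<in> W" and f: "smooth_on W f"
    and im: "\<And>y. y \<in> N \<Longrightarrow> y \<in> W \<Longrightarrow> f y \<in> N'"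
  shows "curve_at N' (f x) (fderiv f x u) (\<lambda>t. f (\<gamma> t))"
proof -
  obtain e where e: "e > 0" "smooth_on {-e<..<e} \<gamma>" "\<gamma> ` {-e<..<e} \<subseteq> N" "\<gamma> 0 = x"
    "(\<gamma> has_vector_derivative u) (at 0)"
    using c unfolding curve_at_def by blast
  have "open ({-e<..<e} \<inter> \<gamma> -` W)"
    by (intro continuous_open_preimage smooth_on_continuous_on e W) auto
  then obtain d where d: "d > 0" "ball 0 d \<subseteq> {-e<..<e} \<inter> \<gamma> -` W"
    using openE[of "{-e<..<e} \<inter> \<gamma> -` W" 0] e W by auto
  have sub: "{-d<..<d} \<subseteq> {-e<..<e} \<inter> \<gamma> -` W"
    using d(2) by (auto simp: subset_iff dist_real_def)
  have "smooth_on {-d<..<d} (\<lambda>t. f (\<gamma> t))"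
    by (rule smooth_on_compose[OF _ W(1) smooth_on_subset[OF e(2)] f]) (use sub in auto)
  moreover have "(\<lambda>t. f (\<gamma> t)) ` {-d<..<d} \<subseteq> N'"
    using sub e(3) im by blast
  moreover have "((\<lambda>t. f (\<gamma> t)) has_vector_derivative fderiv f x u) (at 0)"
    using smooth_on_has_derivative[OF f W(2)] e(4)
    by (intro has_vector_derivative_chain[OF e(5)]) simp
  ultimately show ?thesis
    unfolding curve_at_def using d(1) e(4) by auto
qed

lemma tangent_space_image:
  assumes "u \<in> tangent_space N x" "open W" "x \<in> W" "smooth_on W f"
    "\<And>y. y \<in> N \<Longrightarrow> y \<in> W \<Longrightarrow> f y \<in> N'"
  shows "fderiv f x u \<in> tangent_space N' (f x)"
  using assms curve_at_image[of N x u _ W f N'] unfolding tangent_space_def by blast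

lemma tangent_space_mono: "N \<subseteq> N' \<Longrightarrow> tangent_space N x \<subseteq> tangent_space N' x"
  unfolding tangent_space_def curve_at_def by fastforce

text \<open>
  Tangential derivatives are computed from any extension of the map that is differentiable at the
  point, which is how all of them are computed below.
\<close>

lemma tderiv_eqI:
  assumes u: "u \<in> tangent_space N x" and W: "open W" "x \<in> W"
    and g: "(g has_derivative g') (at x)" and eq: "\<And>y. y \<in> N \<Longrightarrow> y \<in> W \<Longrightarrow> f y = g y"
  shows "tderiv N f x u = g' u"
proof -
  have *: "((f \<circ> \<gamma>) has_vector_derivative g' u) (at 0)" if c: "curve_at N x u \<gamma>" for \<gamma>
  proof -
    obtain e where e: "e > 0" "\<gamma> ` {-e<..<e} \<subseteq> N" "\<gamma> 0 = x"
      "(\<gamma> has_vector_derivative u) (at 0)"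
      using c unfolding curve_at_def by blast
    have "((\<lambda>t. g (\<gamma> t)) has_vector_derivative g' u) (at 0)"
      using g e(3) by (intro has_vector_derivative_chain[OF e(4)]) simp
    moreover have "\<forall>\<^sub>F t in at 0. \<gamma> t \<in> W"
      using has_vector_derivative_continuous[OF e(4)] W e(3)
      by (simp add: continuous_within topological_tendstoD)
    moreover have "\<forall>\<^sub>F t in at (0::real). t \<in> {-e<..<e}"
      using e(1) by (intro eventually_at_in_open') auto
    ultimately have "\<forall>\<^sub>F t in at 0. \<gamma> t \<in> W \<and> t \<in> {-e<..<e}"
      by (intro eventually_conj)
    then have "\<forall>\<^sub>F t in at 0. g (\<gamma> t) = (f \<circ> \<gamma>) t"
      by (rule eventually_mono) (use e(2) eq in \<open>simp add: image_subset_iff\<close>)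
    moreover have "x \<in> N" using e by force
    ultimately show ?thesis
      using \<open>((\<lambda>t. g (\<gamma> t)) has_vector_derivative g' u) (at 0)\<close> eq W e(3)
      unfolding has_vector_derivative_def
      by (intro has_derivative_transform_eventually[of "\<lambda>t. g (\<gamma> t)" _ 0 UNIV "f \<circ> \<gamma>"]) auto
  qed
  obtain \<gamma> where "curve_at N x u \<gamma>" using u by (auto simp: tangent_space_def)
  note \<gamma> = this
  show ?thesis
    unfolding tderiv_def
  proof (rule the_equality)
    fix d assume "\<forall>\<gamma>. curve_at N x u \<gamma> \<longrightarrow> ((f \<circ> \<gamma>) has_vector_derivative d) (at 0)"
    then show "d = g' u"
      using \<gamma> *[OF \<gamma>] vector_derivative_unique_at by blast
  qed (use * in blast)
qed

lemma tderiv_bounded_linear: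
  "bounded_linear L \<Longrightarrow> u \<in> tangent_space N x \<Longrightarrow> tderiv N L x u = L u"
  using tderiv_eqI[of u N x UNIV L L L] by (simp add: bounded_linear_imp_has_derivative)

section \<open>Smooth retracts\<close>

text \<open>
  The exterior derivative of a 1-form on the ambient space, by the coordinate formula: the vectors
  are extended to constant fields, which commute.
\<close>

definition ambient_ext_deriv ::
  "('a::euclidean_space \<Rightarrow> 'a \<Rightarrow> real) \<Rightarrow> 'a \<Rightarrow> 'a \<Rightarrow> 'a \<Rightarrow> real" where
  "ambient_ext_deriv \<alpha> x u v = fderiv (\<lambda>y. \<alpha> y v) x u - fderiv (\<lambda>y. \<alpha> y u) x v"

text \<open>
  A smooth retraction \<open>r\<close> of a neighbourhood takes the place of charts.  Composition with \<open>r\<close>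
  extends every smooth map from \<open>N\<close> to \<open>U\<close>, the derivative of \<open>r\<close> projects onto the tangent spaces,
  and the property passes from \<open>N\<close> to its tangent bundle.
\<close>

locale smooth_retract =
  fixes N U :: "'a::euclidean_space set" and r :: "'a \<Rightarrow> 'a"
  assumes open_U: "open U" and N_sub: "N \<subseteq> U" and smooth_r: "smooth_on U r"
    and r_in: "\<And>y. y \<in> U \<Longrightarrow> r y \<in> N" and r_fix: "\<And>y. y \<in> N \<Longrightarrow> r y = y"
begin

lemma N_in_U: "y \<in> N \<Longrightarrow> y \<in> U"
  using N_sub by blast

lemma has_derivative_r: "y \<in> U \<Longrightarrow> (r has_derivative fderiv r y) (at y)"
  by (rule smooth_on_has_derivative[OF smooth_r])

lemma linear_fderiv_r: "y \<in> U \<Longrightarrow> linear (fderiv r y)"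
  by (rule linear_fderiv[OF smooth_on_differentiable[OF smooth_r]])

lemma fderiv_r_tangent:
  assumes "x \<in> N"
  shows "fderiv r x u \<in> tangent_space N x"
proof -
  have *: "((\<lambda>t. x + t *\<^sub>R u) has_vector_derivative u) (at 0)"
    by (auto intro!: derivative_eq_intros simp: has_vector_derivative_def)
  have "smooth_on {-1<..<1} (\<lambda>t::real. x + t *\<^sub>R u)"
    by (intro smooth_on_add smooth_on_scaleR smooth_on_const smooth_on_id) auto
  then have "curve_at UNIV x u (\<lambda>t. x + t *\<^sub>R u)"
    using * unfolding curve_at_def by (auto intro: exI[of _ 1])
  from tangent_space_image[OF curve_at_imp_tangent[OF this] open_U N_in_U[OF assms] smooth_r]
  show ?thesis using r_in r_fix[OF assms] by auto
qed

lemma fderiv_r_fix: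
  assumes "x \<in> N" "u \<in> tangent_space N x"
  shows "fderiv r x u = u"
proof -
  have "fderiv r x u = tderiv N r x u"
    by (rule tderiv_eqI[OF assms(2) open_U N_in_U[OF assms(1)]
          has_derivative_r[OF N_in_U[OF assms(1)]], symmetric]) simp
  also have "\<dots> = u"
    by (rule tderiv_eqI[OF assms(2) open_UNIV UNIV_I has_derivative_ident]) (simp add: r_fix)
  finally show ?thesis .
qed

lemma tangent_space_iff: "x \<in> N \<Longrightarrow> u \<in> tangent_space N x \<longleftrightarrow> fderiv r x u = u"
  using fderiv_r_fix fderiv_r_tangent by metis

lemma subspace_tangent_space: "x \<in> N \<Longrightarrow> subspace (tangent_space N x)"
  using linear_fderiv_r[OF N_in_U]
  by (auto intro!: subspaceI simp: tangent_space_iff linear_0 linear_add linear_scale)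

lemma smooth_map_iff: "smooth_map N f \<longleftrightarrow> smooth_on U (\<lambda>y. f (r y))"
proof
  assume f: "smooth_map N f"
  show "smooth_on U (\<lambda>y. f (r y))"
  proof (rule smooth_on_local)
    fix y assume y: "y \<in> U"
    obtain W g where W: "open W" "r y \<in> W" "smooth_on W g" "\<forall>z\<in>N \<inter> W. g z = f z"
      using f r_in[OF y] unfolding smooth_map_def by blast
    have op: "open (U \<inter> r -` W)"
      by (intro continuous_open_preimage smooth_on_continuous_on smooth_r open_U W)
    have "smooth_on (U \<inter> r -` W) (\<lambda>y. g (r y))"
      by (rule smooth_on_compose[OF op W(1) smooth_on_subset[OF smooth_r] W(3)]) auto
    moreover have "smooth_on (U \<inter> r -` W) (\<lambda>y. g (r y)) \<longleftrightarrow> smooth_on (U \<inter> r -` W) (\<lambda>y. f (r y))"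
      by (rule smooth_on_cong[OF op]) (use W(4) r_in in auto)
    ultimately show "\<exists>V. open V \<and> y \<in> V \<and> smooth_on V (\<lambda>y. f (r y))"
      using op y W(2) by blast
  qed
next
  assume "smooth_on U (\<lambda>y. f (r y))"
  then show "smooth_map N f"
    unfolding smooth_map_def using open_U N_in_U r_fix by (metis IntD1)
qed

lemma smooth_mapI: "smooth_on U g \<Longrightarrow> (\<And>y. y \<in> N \<Longrightarrow> f y = g y) \<Longrightarrow> smooth_map N f"
  unfolding smooth_map_def using open_U N_in_U by (metis IntD1)

lemma tderiv_vector_field:
  assumes "smooth_map N f" "x \<in> N" "u \<in> tangent_space N x"
  shows "tderiv N f x u = fderiv (\<lambda>y. f (r y)) x u"
  using assms(1)
  by (intro tderiv_eqI[OF assms(3) open_U N_in_U[OF assms(2)]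
        smooth_on_has_derivative[OF _ N_in_U[OF assms(2)]]])
    (simp_all add: smooth_map_iff r_fix)

text \<open>
  The derivative of the retraction projects onto the tangent spaces, so that it extends a tangent
  vector to a vector field.
\<close>

lemma vector_field_extension:
  assumes "x \<in> N" "u \<in> tangent_space N x"
  shows "\<exists>X. vector_field N X \<and> X x = u"
proof (intro exI conjI)
  let ?X = "restrict (\<lambda>y. fderiv r y u) N"
  show "vector_field N ?X"
    unfolding vector_field_def
    using fderiv_r_tangent smooth_mapI[OF smooth_on_fderiv[OF smooth_r]] by auto
  show "?X x = u" using assms fderiv_r_fix by simp
qed

text \<open>
  A tangent field \<open>X\<close> satisfies \<open>Dr(X) = X\<close> on \<open>N\<close>.  In the difference of the derivatives of this
  equation for \<open>Y\<close> along \<open>X\<close> and for \<open>X\<close> along \<open>Y\<close> the second derivatives of \<open>r\<close> cancel.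
\<close>

lemma
  assumes X: "vector_field N X" and Y: "vector_field N Y" and x: "x \<in> N"
  shows lie_bracket_eq:
      "lie_bracket N X Y x = fderiv (\<lambda>y. Y (r y)) x (X x) - fderiv (\<lambda>y. X (r y)) x (Y x)"
    and lie_bracket_tangent: "lie_bracket N X Y x \<in> tangent_space N x"
proof -
  have T: "X x \<in> tangent_space N x" "Y x \<in> tangent_space N x"
    using X Y x by (auto simp: vector_field_def)
  show eq: "lie_bracket N X Y x = fderiv (\<lambda>y. Y (r y)) x (X x) - fderiv (\<lambda>y. X (r y)) x (Y x)"
    unfolding lie_bracket_def
    using X Y T x by (simp add: tderiv_vector_field vector_field_def)
  have xU: "x \<in> U" by (rule N_in_U[OF x])
  have D: "fderiv (\<lambda>y. Z (r y)) x v =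
      fderiv (\<lambda>y. fderiv r y (Z x)) x v + fderiv r x (fderiv (\<lambda>y. Z (r y)) x v)"
    if Z: "vector_field N Z" and v: "v \<in> tangent_space N x" for Z v
  proof -
    have smZ: "smooth_on U (\<lambda>y. Z (r y))"
      using Z by (simp add: vector_field_def smooth_map_iff)
    have "((\<lambda>y. fderiv r (r y) (Z (r y))) has_derivative
        (\<lambda>h. fderiv (\<lambda>z. fderiv r z (Z (r x))) (r x) (fderiv r x h) +
          fderiv r (r x) (fderiv (\<lambda>y. Z (r y)) x h))) (at x)"
    proof (rule has_derivative_linear_family[OF open_U _ linear_fderiv_r])
      show "(\<lambda>z. fderiv r z e) differentiable (at (r x))" for e
        using smooth_on_differentiable[OF smooth_on_fderiv[OF smooth_r]] xU r_fix[OF x] by simp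
    qed (use xU r_fix[OF x] has_derivative_r smooth_on_has_derivative[OF smZ] in auto)
    then have "fderiv (\<lambda>y. fderiv r (r y) (Z (r y))) x v =
      fderiv (\<lambda>y. fderiv r y (Z x)) x v + fderiv r x (fderiv (\<lambda>y. Z (r y)) x v)"
      using fderiv_eqI r_fix[OF x] fderiv_r_fix[OF x v] by fastforce
    moreover have "fderiv (\<lambda>y. fderiv r (r y) (Z (r y))) x = fderiv (\<lambda>y. Z (r y)) x"
      by (rule fderiv_cong_open[OF open_U xU])
        (use Z r_in fderiv_r_fix in \<open>auto simp: vector_field_def\<close>)
    ultimately show ?thesis by simp
  qed
  have "fderiv r x (lie_bracket N X Y x) = lie_bracket N X Y x"
    unfolding eq linear_diff[OF linear_fderiv_r[OF xU]]
    using D[OF Y T(1)] D[OF X T(2)] fderiv_commute[OF open_U smooth_r xU, of "Y x" "X x"]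
    by (metis add_diff_cancel_left)
  then show "lie_bracket N X Y x \<in> tangent_space N x"
    using tangent_space_iff[OF x] by blast
qed

lemma tderiv_one_form_vector_field:
  assumes x: "x \<in> N" and v: "v \<in> tangent_space N x"
    and lin: "\<And>y. linear (\<alpha> y)" and diff: "\<And>e. (\<lambda>y. \<alpha> y e) differentiable (at x)"
    and Z: "vector_field N Z" and eq: "\<And>y w. y \<in> N \<Longrightarrow> w \<in> tangent_space N y \<Longrightarrow> \<theta> y w = \<alpha> y w"
  shows "tderiv N (\<lambda>y. \<theta> y (Z y)) x v =
    fderiv (\<lambda>y. \<alpha> y (Z x)) x v + \<alpha> x (fderiv (\<lambda>y. Z (r y)) x v)"
proof -
  have xU: "x \<in> U" by (rule N_in_U[OF x])
  have smZ: "smooth_on U (\<lambda>y. Z (r y))"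
    using Z by (simp add: vector_field_def smooth_map_iff)
  have "((\<lambda>y. \<alpha> y (Z (r y))) has_derivative
      (\<lambda>h. fderiv (\<lambda>z. \<alpha> z (Z (r x))) x h + \<alpha> x (fderiv (\<lambda>y. Z (r y)) x h))) (at x)"
    by (rule has_derivative_linear_family[of UNIV "\<lambda>y. y" x \<alpha> "\<lambda>h. h"])
      (use lin diff smooth_on_has_derivative[OF smZ xU] in auto)
  from tderiv_eqI[OF v open_U xU this, of "\<lambda>y. \<theta> y (Z y)"] show ?thesis
    using Z r_fix x eq by (simp add: vector_field_def)
qed

text \<open>
  In the invariant formula the derivatives of the fields \<open>X\<close> and \<open>Y\<close> cancel against the Lie bracket.
  That the bracket is again tangent is essential, since \<open>\<theta>\<close> and \<open>\<alpha>\<close> agree on tangent vectors only.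
\<close>

theorem ext_deriv_eq:
  assumes x: "x \<in> N" and u: "u \<in> tangent_space N x" and v: "v \<in> tangent_space N x"
    and lin: "\<And>y. linear (\<alpha> y)" and diff: "\<And>e. (\<lambda>y. \<alpha> y e) differentiable (at x)"
    and eq: "\<And>y w. y \<in> N \<Longrightarrow> w \<in> tangent_space N y \<Longrightarrow> \<theta> y w = \<alpha> y w"
  shows "ext_deriv N \<theta> x u v = ambient_ext_deriv \<alpha> x u v"
proof -
  have *: "tderiv N (\<lambda>y. \<theta> y (Y y)) x u - tderiv N (\<lambda>y. \<theta> y (X y)) x v
      - \<theta> x (lie_bracket N X Y x) = ambient_ext_deriv \<alpha> x u v"
    if X: "vector_field N X" "X x = u" and Y: "vector_field N Y" "Y x = v" for X Y
    using tderiv_one_form_vector_field[OF x u lin diff Y(1) eq]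
      tderiv_one_form_vector_field[OF x v lin diff X(1) eq]
      eq[OF x lie_bracket_tangent[OF X(1) Y(1) x]] lie_bracket_eq[OF X(1) Y(1) x]
    by (simp add: ambient_ext_deriv_def linear_diff[OF lin] X(2) Y(2))
  obtain X Y where XY: "vector_field N X" "X x = u" "vector_field N Y" "Y x = v"
    using vector_field_extension[OF x u] vector_field_extension[OF x v] by blast
  show ?thesis
    unfolding ext_deriv_def
  proof (rule the_equality)
    fix c assume "\<forall>X Y. vector_field N X \<and> vector_field N Y \<and> X x = u \<and> Y x = v \<longrightarrow>
      c = tderiv N (\<lambda>y. \<theta> y (Y y)) x u - tderiv N (\<lambda>y. \<theta> y (X y)) x v
            - \<theta> x (lie_bracket N X Y x)"
    then show "c = ambient_ext_deriv \<alpha> x u v" using *[OF XY] XY by metis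
  qed (use * in auto)
qed

text \<open>
  Applied to a difference, this transfers an identity between restrictions of forms to their exterior
  derivatives.
\<close>

lemma ambient_ext_deriv_zero_on:
  assumes x: "x \<in> N" and u: "u \<in> tangent_space N x" and v: "v \<in> tangent_space N x"
    and lin: "\<And>y. linear (\<alpha> y)" and diff: "\<And>e. (\<lambda>y. \<alpha> y e) differentiable (at x)"
    and zero: "\<And>y w. y \<in> N \<Longrightarrow> w \<in> tangent_space N y \<Longrightarrow> \<alpha> y w = 0"
  shows "ambient_ext_deriv \<alpha> x u v = 0"
proof -
  have "ambient_ext_deriv \<alpha> x u v = ext_deriv N (\<lambda>_ _. 0) x u v"
    by (rule ext_deriv_eq[OF x u v lin diff, symmetric]) (simp add: zero)
  also have "\<dots> = ambient_ext_deriv (\<lambda>_ _. 0) x u v"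
    by (rule ext_deriv_eq[OF x u v]) (auto intro: linearI)
  finally show ?thesis by (simp add: ambient_ext_deriv_def)
qed

section \<open>The tangent bundle of a retract\<close>

abbreviation rT :: "'a \<times> 'a \<Rightarrow> 'a \<times> 'a" where
  "rT w \<equiv> (r (fst w), fderiv r (r (fst w)) (snd w))"

lemma open_times_UNIV: "open (U \<times> (UNIV :: 'a set))"
  by (intro open_Times open_U open_UNIV)

text \<open>
  This makes the double tangent bundle, on which the dynamics is defined, accessible to the same
  lemmas.
\<close>

lemma smooth_retract_tangent_bundle: "smooth_retract (tangent_bundle N) (U \<times> UNIV) rT"
proof
  have fst: "smooth_on (U \<times> UNIV) (\<lambda>w :: 'a \<times> 'a. r (fst w))"
    by (rule smooth_on_compose[OF open_times_UNIV open_U _ smooth_r])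
      (auto intro!: smooth_on_fst smooth_on_id open_times_UNIV)
  show "smooth_on (U \<times> UNIV) rT"
    by (intro smooth_on_Pair fst smooth_on_fderiv_apply[OF open_times_UNIV open_U smooth_r]
        smooth_on_snd smooth_on_id open_times_UNIV) (use r_in N_in_U in auto)
  show "rT w \<in> tangent_bundle N" if "w \<in> U \<times> UNIV" for w
    using that r_in fderiv_r_tangent by (auto simp: tangent_bundle_def)
  show "rT w = w" if "w \<in> tangent_bundle N" for w
    using that r_fix fderiv_r_fix by (auto simp: tangent_bundle_def)
qed (use open_times_UNIV N_in_U in \<open>auto simp: tangent_bundle_def\<close>)

lemma tangent_bundle_iff: "w \<in> tangent_bundle N \<longleftrightarrow> fst w \<in> N \<and> snd w \<in> tangent_space N (fst w)"
  by (auto simp: tangent_bundle_def)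

lemma fst_tangent:
  assumes "Z \<in> tangent_space (tangent_bundle N) w"
  shows "fst Z \<in> tangent_space N (fst w)"
proof -
  have "fderiv fst w Z \<in> tangent_space N (fst w)"
    by (rule tangent_space_image[OF assms open_UNIV UNIV_I smooth_on_linear[OF bounded_linear_fst]])
      (simp add: tangent_bundle_iff)
  then show ?thesis
    using fderiv_eqI[OF bounded_linear_imp_has_derivative[OF bounded_linear_fst]] by metis
qed

lemma tderiv_fst:
  "Z \<in> tangent_space (tangent_bundle N) w \<Longrightarrow> tderiv (tangent_bundle N) fst w Z = fst Z"
  by (rule tderiv_bounded_linear[OF bounded_linear_fst])

lemma vertical_tangent:
  assumes w: "w \<in> tangent_bundle N" and b: "b \<in> tangent_space N (fst w)"
  shows "(0, b) \<in> tangent_space (tangent_bundle N) w"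
proof (rule curve_at_imp_tangent)
  have sub: "subspace (tangent_space N (fst w))"
    using w subspace_tangent_space by (simp add: tangent_bundle_iff)
  have "smooth_on {-1<..<1} (\<lambda>t::real. w + t *\<^sub>R (0, b))"
    by (intro smooth_on_add smooth_on_scaleR smooth_on_const smooth_on_id) auto
  moreover have "w + t *\<^sub>R (0, b) \<in> tangent_bundle N" for t
    using w b sub by (auto simp: tangent_bundle_iff subspace_add subspace_scale)
  moreover have "((\<lambda>t. w + t *\<^sub>R (0, b)) has_vector_derivative (0, b)) (at 0)"
    by (auto intro!: derivative_eq_intros simp: has_vector_derivative_def)
  ultimately show "curve_at (tangent_bundle N) w (0, b) (\<lambda>t. w + t *\<^sub>R (0, b))"
    unfolding curve_at_def by (auto intro!: exI[of _ 1] simp: zero_prod_def[symmetric])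
qed

lemma vertical_tangentD:
  assumes w: "w \<in> tangent_bundle N" and b: "(0, b) \<in> tangent_space (tangent_bundle N) w"
  shows "b \<in> tangent_space N (fst w)"
proof -
  have x: "fst w \<in> N" using w by (simp add: tangent_bundle_iff)
  note xU = N_in_U[OF x]
  have d: "((\<lambda>w. fderiv r (fst w) (snd w)) has_derivative
      (\<lambda>Z. fderiv (\<lambda>z. fderiv r z (snd w)) (fst w) (fst Z) + fderiv r (fst w) (snd Z))) (at w)"
    using xU linear_fderiv_r smooth_on_differentiable[OF smooth_on_fderiv[OF smooth_r]]
    by (intro has_derivative_linear_family[OF open_U])
      (auto intro!: bounded_linear_imp_has_derivative bounded_linear_fst bounded_linear_snd)
  have lin: "linear (fderiv (\<lambda>z. fderiv r z (snd w)) (fst w))"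
    by (rule linear_fderiv[OF smooth_on_differentiable[OF smooth_on_fderiv[OF smooth_r] xU]])
  have "b = tderiv (tangent_bundle N) snd w (0, b)"
    using tderiv_bounded_linear[OF bounded_linear_snd b] by simp
  also have "\<dots> = fderiv r (fst w) b"
    by (subst tderiv_eqI[OF b open_UNIV UNIV_I d])
      (auto simp: tangent_bundle_iff fderiv_r_fix linear_0[OF lin])
  finally show ?thesis using tangent_space_iff[OF x] by simp
qed

lemma horizontal_tangent:
  assumes w: "w \<in> tangent_bundle N" and a: "a \<in> tangent_space N (fst w)"
  shows "\<exists>b. (a, b) \<in> tangent_space (tangent_bundle N) w"
proof -
  obtain x u where xu: "w = (x, u)" by fastforce
  then have x: "x \<in> N" and u: "u \<in> tangent_space N x" and a': "a \<in> tangent_space N x"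
    using w a by (auto simp: tangent_bundle_iff)
  let ?f = "\<lambda>y. (y, fderiv r y u)"
  have "smooth_on U ?f"
    by (intro smooth_on_Pair smooth_on_id smooth_on_fderiv smooth_r open_U)
  then have "fderiv ?f x a \<in> tangent_space (tangent_bundle N) (?f x)"
    using fderiv_r_tangent
    by (intro tangent_space_image[OF a' open_U N_in_U[OF x]]) (auto simp: tangent_bundle_iff)
  moreover have "fderiv ?f x a = (a, fderiv (\<lambda>y. fderiv r y u) x a)"
    using fderiv_eqI[OF has_derivative_Pair[OF has_derivative_ident
          smooth_on_has_derivative[OF smooth_on_fderiv[OF smooth_r] N_in_U[OF x]]]]
    by (simp add: fun_eq_iff)
  ultimately show ?thesis using fderiv_r_fix[OF x u] xu by metis
qed

end

section \<open>Riemannian metrics on retracts\<close>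

text \<open>
  The extension \<open>g\<close> of the metric to a smooth family of bilinear forms on the ambient space extends
  the Lagrange form as well, so that its exterior derivative has an explicit formula.
\<close>

locale metric_retract = smooth_retract N U r
  for N U :: "'a::euclidean_space set" and r +
  fixes n g :: "'a \<Rightarrow> 'a \<Rightarrow> 'a \<Rightarrow> real"
  assumes bilin: "\<And>x. bilinear (g x)"
    and smooth_g: "\<And>X Y. smooth_on U X \<Longrightarrow> smooth_on U Y \<Longrightarrow> smooth_on U (\<lambda>x. g x (X x) (Y x))"
    and n_eq: "\<And>x u v. x \<in> N \<Longrightarrow> u \<in> tangent_space N x \<Longrightarrow> v \<in> tangent_space N x \<Longrightarrow> n x u v = g x u v"
    and g_sym: "\<And>x u v. x \<in> N \<Longrightarrow> u \<in> tangent_space N x \<Longrightarrow> v \<in> tangent_space N x \<Longrightarrow> g x u v = g x v u"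
    and g_pos: "\<And>x u. x \<in> N \<Longrightarrow> u \<in> tangent_space N x \<Longrightarrow> u \<noteq> 0 \<Longrightarrow> g x u u > 0"
begin

lemma linear_g: "linear (g x u)" "linear (\<lambda>u. g x u v)"
  using bilin[of x] by (auto simp: bilinear_def)

lemmas g_simps =
  linear_add[OF linear_g(1)] linear_scale[OF linear_g(1)] linear_diff[OF linear_g(1)]
  linear_add[OF linear_g(2)] linear_scale[OF linear_g(2)] linear_diff[OF linear_g(2)]
  linear_0[OF linear_g(1)] linear_0[OF linear_g(2)]

lemma riemannian_metric: "riemannian_metric N n"
  unfolding riemannian_metric_def
proof (intro conjI ballI allI impI)
  fix x u v w and a b :: real
  assume x: "x \<in> N" and T: "u \<in> tangent_space N x" "v \<in> tangent_space N x" "w \<in> tangent_space N x"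
  have "a *\<^sub>R u + b *\<^sub>R v \<in> tangent_space N x"
    using subspace_tangent_space[OF x] T by (simp add: subspace_add subspace_scale)
  then show "n x (a *\<^sub>R u + b *\<^sub>R v) w = a * n x u w + b * n x v w"
    using x T by (simp add: n_eq g_simps)
  show "n x u v = n x v u" "u \<noteq> 0 \<Longrightarrow> n x u u > 0"
    using x T by (simp_all add: n_eq g_sym g_pos)
next
  fix X Y assume "vector_field N X \<and> vector_field N Y"
  then have XY: "smooth_on U (\<lambda>y. X (r y))" "smooth_on U (\<lambda>y. Y (r y))"
    "\<And>x. x \<in> N \<Longrightarrow> X x \<in> tangent_space N x" "\<And>x. x \<in> N \<Longrightarrow> Y x \<in> tangent_space N x"
    by (auto simp: vector_field_def smooth_map_iff)
  show "smooth_map N (\<lambda>x. n x (X x) (Y x))"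
    by (rule smooth_mapI[OF smooth_g[OF XY(1,2)]]) (simp add: n_eq XY r_fix)
qed

lemma smooth_on_g: "smooth_on U (\<lambda>x. g x u v)"
  by (rule smooth_g[OF smooth_on_const smooth_on_const])

text \<open>The Lagrange form, extended to the ambient space of the tangent bundle.\<close>

definition lform :: "'a \<times> 'a \<Rightarrow> 'a \<times> 'a \<Rightarrow> real" where
  "lform w Z = g (fst w) (snd w) (fst Z)"

lemma linear_lform: "linear (lform w)"
  by (rule linearI) (simp_all add: lform_def g_simps)

lemma has_derivative_g:
  assumes "fst w \<in> U"
  shows "((\<lambda>w. g (fst w) (snd w) e) has_derivative
    (\<lambda>Z. fderiv (\<lambda>y. g y (snd w) e) (fst w) (fst Z) + g (fst w) (snd Z) e)) (at w)"
proof (rule has_derivative_linear_family[of UNIV fst w "\<lambda>y u. g y u e" fst snd snd])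
  show "(fst has_derivative fst) (at w)" "(snd has_derivative snd) (at w)"
    by (simp_all add: bounded_linear_imp_has_derivative bounded_linear_fst bounded_linear_snd)
qed (use assms linear_g smooth_on_differentiable[OF smooth_on_g] in auto)

lemma lform_differentiable: "fst w \<in> U \<Longrightarrow> (\<lambda>w. lform w Z) differentiable (at w)"
  unfolding lform_def using has_derivative_g differentiable_def by blast

lemma lagrange_2form_ambient:
  assumes w: "w \<in> tangent_bundle N"
    and Z: "Z \<in> tangent_space (tangent_bundle N) w" "Z' \<in> tangent_space (tangent_bundle N) w"
  shows "lagrange_2form N n w Z Z' = ambient_ext_deriv lform w Z Z'"
  unfolding lagrange_2form_def
proof (rule smooth_retract.ext_deriv_eq[OF smooth_retract_tangent_bundle w Z linear_lform
      lform_differentiable])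
  show "fst w \<in> U" using w N_in_U by (simp add: tangent_bundle_iff)
  show "lagrange_form N n y V = lform y V"
    if "y \<in> tangent_bundle N" "V \<in> tangent_space (tangent_bundle N) y" for y V
    unfolding lagrange_form_def lform_def tderiv_fst[OF that(2)]
    using n_eq that fst_tangent[OF that(2)] by (simp add: tangent_bundle_iff)
qed

lemma ambient_lform_eq:
  assumes "fst w \<in> U"
  shows "ambient_ext_deriv lform w Z Z' =
    fderiv (\<lambda>y. g y (snd w) (fst Z')) (fst w) (fst Z) + g (fst w) (snd Z) (fst Z')
    - fderiv (\<lambda>y. g y (snd w) (fst Z)) (fst w) (fst Z') - g (fst w) (snd Z') (fst Z)"
  unfolding ambient_ext_deriv_def lform_def fderiv_eqI[OF has_derivative_g[OF assms]] by simp

lemma gyroscopic_dynamics_iff: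
  "gyroscopic_dynamics N n E \<kappa> Y \<longleftrightarrow>
    vector_field (tangent_bundle N) Y \<and>
    (\<forall>w\<in>tangent_bundle N. \<forall>Z\<in>tangent_space (tangent_bundle N) w.
      ambient_ext_deriv lform w (Y w) Z + \<kappa> (fst w) (fst (Y w)) (fst Z) =
      - tderiv (tangent_bundle N) (energy n E) w Z)"
  unfolding gyroscopic_dynamics_def
proof (intro conj_cong ball_cong refl)
  fix w Z assume Y: "vector_field (tangent_bundle N) Y" and w: "w \<in> tangent_bundle N"
    and Z: "Z \<in> tangent_space (tangent_bundle N) w"
  have "Y w \<in> tangent_space (tangent_bundle N) w"
    using Y w by (simp add: vector_field_def)
  then show "(lagrange_2form N n w (Y w) Z +
      \<kappa> (fst w) (tderiv (tangent_bundle N) fst w (Y w)) (tderiv (tangent_bundle N) fst w Z) =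
      - tderiv (tangent_bundle N) (energy n E) w Z) \<longleftrightarrow>
    (ambient_ext_deriv lform w (Y w) Z + \<kappa> (fst w) (fst (Y w)) (fst Z) =
      - tderiv (tangent_bundle N) (energy n E) w Z)"
    by (simp only: lagrange_2form_ambient[OF w _ Z] tderiv_fst[OF Z] tderiv_fst)
qed

text \<open>
  The form \<open>\<sigma>\<^sub>n + p\<^sub>N\<^sup>*\<kappa>\<close> is nondegenerate: paired with vertical vectors it determines the
  horizontal part of a vector, and paired with all others then the vertical part.
\<close>

lemma gyroscopic_dynamics_unique:
  assumes Y1: "gyroscopic_dynamics N n E \<kappa> Y1" and Y2: "gyroscopic_dynamics N n E \<kappa> Y2"
    and \<kappa>: "\<And>x v. x \<in> N \<Longrightarrow> v \<in> tangent_space N x \<Longrightarrow> \<kappa> x v 0 = 0"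
  shows "Y1 = Y2"
proof
  fix w
  show "Y1 w = Y2 w"
  proof (cases "w \<in> tangent_bundle N")
    case False
    moreover have "Y1 \<in> extensional (tangent_bundle N)" "Y2 \<in> extensional (tangent_bundle N)"
      using Y1 Y2 unfolding gyroscopic_dynamics_def vector_field_def by blast+
    ultimately show ?thesis by (metis extensional_arb)
  next
    case w: True
    let ?T = "tangent_space (tangent_bundle N) w"
    have x: "fst w \<in> N" using w by (simp add: tangent_bundle_iff)
    note xU = N_in_U[OF x]
    have T: "Y1 w \<in> ?T" "Y2 w \<in> ?T"
      using Y1 Y2 w by (auto simp: gyroscopic_dynamics_def vector_field_def)
    note fT = fst_tangent[OF T(1)] fst_tangent[OF T(2)]
    have sub: "subspace (tangent_space N (fst w))" by (rule subspace_tangent_space[OF x])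
    have subT: "subspace ?T"
      by (rule smooth_retract.subspace_tangent_space[OF smooth_retract_tangent_bundle w])
    have eq: "ambient_ext_deriv lform w (Y1 w) Z + \<kappa> (fst w) (fst (Y1 w)) (fst Z) =
        ambient_ext_deriv lform w (Y2 w) Z + \<kappa> (fst w) (fst (Y2 w)) (fst Z)" if Z: "Z \<in> ?T" for Z
      using Y1 Y2 w Z unfolding gyroscopic_dynamics_iff by simp
    have lin: "linear (fderiv (\<lambda>y. g y a b) (fst w))" for a b
      by (rule linear_fderiv[OF smooth_on_differentiable[OF smooth_on_g xU]])
    have "fst (Y1 w) = fst (Y2 w)"
    proof (rule ccontr)
      let ?b = "fst (Y1 w) - fst (Y2 w)"
      assume "fst (Y1 w) \<noteq> fst (Y2 w)"
      moreover have b: "?b \<in> tangent_space N (fst w)"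
        using fT sub by (simp add: subspace_diff)
      ultimately have "g (fst w) ?b ?b > 0" using g_pos[OF x] by simp
      moreover have "g (fst w) ?b (fst (Y1 w)) = g (fst w) ?b (fst (Y2 w))"
        using eq[OF vertical_tangent[OF w b]] \<kappa>[OF x fT(1)] \<kappa>[OF x fT(2)]
        by (simp add: ambient_lform_eq[OF xU] g_simps linear_0[OF lin])
      ultimately show False by (simp add: g_simps)
    qed
    note fst_eq = this
    have "snd (Y1 w) = snd (Y2 w)"
    proof (rule ccontr)
      let ?b = "snd (Y1 w) - snd (Y2 w)"
      assume ne: "snd (Y1 w) \<noteq> snd (Y2 w)"
      have "Y1 w - Y2 w \<in> ?T" using subT T by (simp add: subspace_diff)
      moreover have "Y1 w - Y2 w = (0, ?b)" using fst_eq by (simp add: prod_eq_iff)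
      ultimately have "(0, ?b) \<in> ?T" by simp
      then have b: "?b \<in> tangent_space N (fst w)"
        by (rule vertical_tangentD[OF w])
      obtain c where c: "(?b, c) \<in> ?T" using horizontal_tangent[OF w b] by blast
      have "g (fst w) ?b ?b > 0" using g_pos[OF x b] ne by simp
      moreover have "g (fst w) (snd (Y1 w)) ?b = g (fst w) (snd (Y2 w)) ?b"
        using eq[OF c] fst_eq by (simp add: ambient_lform_eq[OF xU])
      ultimately show False by (simp add: g_simps)
    qed
    then show ?thesis using fst_eq by (simp add: prod_eq_iff)
  qed
qed

end

section \<open>Angular velocities\<close>

definition hat :: "real^3 \<Rightarrow> real^3^3" where
  "hat w = vector [vector [0, - w$3, w$2], vector [w$3, 0, - w$1], vector [- w$2, w$1, 0]]"

lemmas matrix3_simps = vec_eq_iff forall_3 sum_3 matrix_matrix_mult_def matrix_vector_mult_def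
  transpose_def row_def cross3_def inner_vec_def hat_def so3_vec_def mat_def

lemma linear_hat: "linear hat"
  by (rule linearI) (simp_all add: matrix3_simps)

lemma linear_so3_vec: "linear so3_vec"
  by (rule linearI) (simp_all add: matrix3_simps)

lemma linear_row: "linear (row i :: real^3^3 \<Rightarrow> real^3)"
  by (rule linearI) (simp_all add: row_def vec_eq_iff)

lemma linear_transpose: "linear (transpose :: real^3^3 \<Rightarrow> real^3^3)"
  by (rule linearI) (simp_all add: transpose_def vec_eq_iff)

lemma bilinear_matrix_mult: "bilinear ((**) :: real^3^3 \<Rightarrow> real^3^3 \<Rightarrow> real^3^3)"
  unfolding bilinear_def
  by (auto intro!: linearI simp: vec_eq_iff matrix_matrix_mult_def sum.distrib sum_distrib_left
      algebra_simps)

lemmas bounded_linear_hat = linear_hat[unfolded linear_conv_bounded_linear]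
lemmas bounded_linear_row = linear_row[unfolded linear_conv_bounded_linear]
lemmas bounded_linear_transpose = linear_transpose[unfolded linear_conv_bounded_linear]
lemmas bounded_bilinear_matrix_mult =
  bilinear_matrix_mult[unfolded bilinear_conv_bounded_bilinear]
lemmas bounded_bilinear_cross3 = bilinear_cross[unfolded bilinear_conv_bounded_bilinear]

lemmas so3_vec_simps = linear_add[OF linear_so3_vec] linear_scale[OF linear_so3_vec]
  linear_diff[OF linear_so3_vec] linear_neg[OF linear_so3_vec]

lemma so3_vec_hat: "so3_vec (hat w) = w"
  by (simp add: matrix3_simps)

lemma hat_so3_vec: "transpose B + B = 0 \<Longrightarrow> hat (so3_vec B) = B"
  by (simp add: matrix3_simps)

lemma transpose_hat: "transpose (hat w) = - hat w"
  by (simp add: matrix3_simps)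

lemma row_mult_hat: "row i (Q ** hat w) = cross3 (row i Q) w"
  by (simp add: matrix3_simps)

lemma so3_vec_hat_commutator: "so3_vec (hat a ** hat b) - so3_vec (hat b ** hat a) = cross3 a b"
  by (simp add: matrix3_simps algebra_simps)

lemma cross3_triple:
  "cross3 a (cross3 b c) = (a \<bullet> c) *\<^sub>R b - (a \<bullet> b) *\<^sub>R c"
  "cross3 (cross3 a b) c = (a \<bullet> c) *\<^sub>R b - (b \<bullet> c) *\<^sub>R a"
  by (simp_all add: vec_eq_iff forall_3 cross3_def inner_vec_def sum_3 algebra_simps)

lemmas matrix_mult_scaleR =
  bounded_bilinear.scaleR_right[OF bounded_bilinear_matrix_mult]
  bounded_bilinear.scaleR_left[OF bounded_bilinear_matrix_mult]

lemma norm_1_inner: "norm (x::real^3) = 1 \<longleftrightarrow> x \<bullet> x = 1"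
  by (simp add: norm_eq_sqrt_inner)

lemma SO3_D:
  assumes "Q \<in> SO3"
  shows "transpose Q ** Q = mat 1" "Q ** transpose Q = mat 1" "matrix_inv Q = transpose Q"
    "det Q = 1" "norm (row 1 Q) = 1" "cross3 (row 1 Q) (row 2 Q) = row 3 Q"
    "cross3 (row 2 Q) (row 3 Q) = row 1 Q" "cross3 (row 3 Q) (row 1 Q) = row 2 Q"
proof -
  have o: "orthogonal_matrix Q" and d: "det Q = 1"
    using assms by (auto simp: SO3_def rotation_matrix_def)
  show 1: "transpose Q ** Q = mat 1" "Q ** transpose Q = mat 1"
    using o by (auto simp: orthogonal_matrix_def)
  show "matrix_inv Q = transpose Q"
    unfolding matrix_inv_def
  proof (rule some_equality)
    show "P = transpose Q" if P: "Q ** P = mat 1 \<and> P ** Q = mat 1" for P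
      using 1 P by (metis matrix_mul_assoc matrix_mul_lid matrix_mul_rid)
  qed (use 1 in simp)
  show "det Q = 1" by (rule d)
  show "norm (row 1 Q) = 1" using o by (simp add: orthogonal_matrix_orthonormal_rows)
  have rt: "rotation_matrix (transpose Q)"
    using o d by (simp add: rotation_matrix_def orthogonal_matrix_transpose det_transpose)
  have r: "row i Q = transpose Q *v axis i 1" for i
    by (simp add: matrix_vector_mult_basis column_transpose)
  show "cross3 (row 1 Q) (row 2 Q) = row 3 Q" "cross3 (row 2 Q) (row 3 Q) = row 1 Q"
    "cross3 (row 3 Q) (row 1 Q) = row 2 Q"
    unfolding r cross_rotation_matrix[OF rt] by (simp_all add: cross_basis)
qed

lemma SO3_I: "transpose Q ** Q = mat 1 \<Longrightarrow> det Q = 1 \<Longrightarrow> Q \<in> SO3"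
  by (simp add: SO3_def rotation_matrix_def orthogonal_matrix)

lemma SO3_mult: "P \<in> SO3 \<Longrightarrow> Q \<in> SO3 \<Longrightarrow> P ** Q \<in> SO3"
  by (simp add: SO3_def rotation_matrix_def orthogonal_matrix_mul det_mul)

lemma S2_iff: "x \<in> S2 \<longleftrightarrow> norm x = 1"
  by (simp add: S2_def)

lemma row_SO3_in_S2: "Q \<in> SO3 \<Longrightarrow> row 1 Q \<in> S2"
  by (simp add: S2_iff SO3_D)

lemma SO3_row_surj:
  assumes "x \<in> S2"
  shows "\<exists>Q\<in>SO3. row 1 Q = x"
proof -
  have "norm x = 1" "2 \<le> CARD(3)" using assms by (auto simp: S2_iff)
  then obtain A :: "real^3^3" where A: "rotation_matrix A" "A *v axis 1 1 = x"
    using rotation_matrix_exists_basis by metis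
  have "row 1 (transpose A) = x"
    using A(2) by (simp add: matrix_vector_mult_basis row_transpose)
  moreover have "transpose A \<in> SO3"
    using A(1) by (simp add: SO3_def rotation_matrix_def orthogonal_matrix_transpose det_transpose)
  ultimately show ?thesis by blast
qed

lemma spin_SO3: "Q \<in> SO3 \<Longrightarrow> spin Q A = so3_vec (transpose Q ** A)"
  by (simp add: spin_def SO3_D)

lemma spin_mult_hat:
  assumes "Q \<in> SO3"
  shows "so3_vec (transpose Q ** (Q ** hat w)) = w"
  using SO3_D(1)[OF assms] by (simp add: matrix_mul_assoc so3_vec_hat)

text \<open>
  Rodrigues' formula, with \<open>sin\<close> and \<open>cos\<close> replaced by the rational parametrization of the circle.
  This yields rotations with velocity \<open>hat w\<close> at \<open>t = 0\<close> and reduces smoothness and orthogonality to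
  rational functions of \<open>t\<close>.
\<close>

definition rodrigues :: "real^3 \<Rightarrow> real \<Rightarrow> real^3^3" where
  "rodrigues w t = mat 1 + (t / (1 + (w \<bullet> w) / 4 * t\<^sup>2)) *\<^sub>R hat w
     + (t\<^sup>2 / 2 / (1 + (w \<bullet> w) / 4 * t\<^sup>2)) *\<^sub>R (hat w ** hat w)"

lemma rodrigues_gram:
  "transpose (mat 1 + a *\<^sub>R hat w + b *\<^sub>R (hat w ** hat w)) ** (mat 1 + a *\<^sub>R hat w + b *\<^sub>R (hat w ** hat w))
    = mat 1 + (2 * b - a\<^sup>2 - b\<^sup>2 * (w \<bullet> w)) *\<^sub>R (hat w ** hat w)"
  by (simp add: matrix3_simps power2_eq_square) algebra

lemma rodrigues_det:
  "det (mat 1 + a *\<^sub>R hat w + b *\<^sub>R (hat w ** hat w))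
    = 1 - (w \<bullet> w) * (2 * b - a\<^sup>2 - b\<^sup>2 * (w \<bullet> w))"
  by (simp add: matrix3_simps det_3 power2_eq_square) algebra

lemma rodrigues_in_SO3: "rodrigues w t \<in> SO3"
proof -
  define s where "s = 1 + (w \<bullet> w) / 4 * t\<^sup>2"
  have s: "s > 0" unfolding s_def by (intro add_pos_nonneg mult_nonneg_nonneg) auto
  have "2 * (t\<^sup>2 / 2 / s) - (t / s)\<^sup>2 - (t\<^sup>2 / 2 / s)\<^sup>2 * (w \<bullet> w)
      = t\<^sup>2 / s\<^sup>2 * (s - 1 - (w \<bullet> w) / 4 * t\<^sup>2)"
    using s by (simp add: power2_eq_square field_simps)
  also have "\<dots> = 0" by (simp add: s_def)
  finally have 0: "2 * (t\<^sup>2 / 2 / s) - (t / s)\<^sup>2 - (t\<^sup>2 / 2 / s)\<^sup>2 * (w \<bullet> w) = 0" .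
  show ?thesis
    unfolding rodrigues_def s_def[symmetric]
    by (rule SO3_I) (simp_all only: rodrigues_gram rodrigues_det 0 scaleR_zero_left mult_zero_right
        add_0_right diff_zero)
qed

lemma smooth_on_matrix_mult:
  "open U \<Longrightarrow> smooth_on U f \<Longrightarrow> smooth_on U g \<Longrightarrow> smooth_on U (\<lambda>x. (f x :: real^3^3) ** (g x :: real^3^3))"
  by (rule smooth_on_bounded_bilinear[OF bounded_bilinear_matrix_mult])

lemmas smooth_on_cross3 = smooth_on_bounded_bilinear[OF bounded_bilinear_cross3]
lemmas smooth_on_row = smooth_on_bounded_linear[OF bounded_linear_row]
lemmas smooth_on_hat = smooth_on_bounded_linear[OF bounded_linear_hat]
lemmas smooth_on_transpose = smooth_on_bounded_linear[OF bounded_linear_transpose]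

lemma curve_at_rodrigues:
  assumes "Q \<in> SO3"
  shows "curve_at SO3 Q (Q ** hat w) (\<lambda>t. Q ** rodrigues w t)"
proof -
  let ?c = "(w \<bullet> w) / 4"
  have pos: "1 + ?c * t\<^sup>2 \<noteq> 0" for t :: real
    using add_pos_nonneg[of 1 "?c * t\<^sup>2"] by (metis less_irrefl mult_nonneg_nonneg zero_le_power2
        inner_ge_zero zero_less_one divide_nonneg_nonneg zero_le_numeral)
  have "smooth_on {-1<..<1} (\<lambda>t. Q ** rodrigues w t)"
    unfolding rodrigues_def
    by (intro smooth_on_matrix_mult smooth_on_const smooth_on_add smooth_on_scaleR smooth_on_divide
        smooth_on_id smooth_on_power smooth_on_mult) (use pos in auto)
  moreover have "((\<lambda>t. rodrigues w t) has_vector_derivative hat w) (at 0)"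
  proof -
    have "((\<lambda>t. t / (1 + ?c * t\<^sup>2)) has_real_derivative 1) (at 0)"
      "((\<lambda>t. t\<^sup>2 / 2 / (1 + ?c * t\<^sup>2)) has_real_derivative 0) (at 0)"
      by (auto intro!: derivative_eq_intros)
    from has_vector_derivative_add[OF has_vector_derivative_add[OF has_vector_derivative_const
          has_vector_derivative_scaleR[OF this(1) has_vector_derivative_const]]
        has_vector_derivative_scaleR[OF this(2) has_vector_derivative_const]]
    show ?thesis unfolding rodrigues_def by simp
  qed
  then have "((\<lambda>t. Q ** rodrigues w t) has_vector_derivative Q ** hat w) (at 0)"
    by (rule bounded_linear.has_vector_derivative
        [OF bounded_bilinear.bounded_linear_right[OF bounded_bilinear_matrix_mult]])
  moreover have "Q ** rodrigues w 0 = Q" by (simp add: rodrigues_def)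
  ultimately show ?thesis
    unfolding curve_at_def using SO3_mult[OF assms rodrigues_in_SO3] by (auto intro!: exI[of _ 1])
qed

lemma tangent_space_SO3:
  assumes "Q \<in> SO3"
  shows "A \<in> tangent_space SO3 Q \<longleftrightarrow> (\<exists>w. A = Q ** hat w)"
proof
  assume A: "A \<in> tangent_space SO3 Q"
  have "((\<lambda>Q. transpose Q ** Q) has_derivative
      (\<lambda>A. transpose Q ** A + transpose A ** Q)) (at Q)"
    by (rule bounded_bilinear.FDERIV[OF bounded_bilinear_matrix_mult
          bounded_linear_imp_has_derivative[OF bounded_linear_transpose] has_derivative_ident])
  from tderiv_eqI[OF A open_UNIV UNIV_I this, of "\<lambda>_. mat 1"]
    tderiv_eqI[OF A open_UNIV UNIV_I has_derivative_const, of "\<lambda>_. mat 1 :: real^3^3" "mat 1"]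
  have "transpose Q ** A + transpose A ** Q = 0" by (simp add: SO3_D(1))
  then have "hat (so3_vec (transpose Q ** A)) = transpose Q ** A"
    by (intro hat_so3_vec) (simp add: matrix_transpose_mul add.commute)
  then have "Q ** hat (so3_vec (transpose Q ** A)) = A"
    using SO3_D(2)[OF assms] by (simp add: matrix_mul_assoc)
  then show "\<exists>w. A = Q ** hat w" by metis
next
  assume "\<exists>w. A = Q ** hat w"
  then show "A \<in> tangent_space SO3 Q"
    using curve_at_imp_tangent[OF curve_at_rodrigues[OF assms]] by blast
qed

section \<open>The rotation group and the sphere as retracts\<close>

text \<open>
  The Gram-Schmidt process on the first two rows, completed by their vector product.  Taking
  \<open>cross3 c a\<close> as the second row gives determinant 1.
\<close>

definition gram_schmidt :: "real^3^3 \<Rightarrow> real^3^3" where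
  "gram_schmidt Q = (let a = (1 / norm (row 1 Q)) *\<^sub>R row 1 Q;
     n = cross3 (row 1 Q) (row 2 Q); c = (1 / norm n) *\<^sub>R n in vector [a, cross3 c a, c])"

definition SO3_nbhd :: "(real^3^3) set" where
  "SO3_nbhd = {Q. cross3 (row 1 Q) (row 2 Q) \<noteq> 0}"

lemma row_vector: "row 1 (vector [a, b, c] :: real^3^3) = a" "row 2 (vector [a, b, c] :: real^3^3) = b"
  "row 3 (vector [a, b, c] :: real^3^3) = c"
  by (simp_all add: row_def vec_eq_iff)

lemma smooth_on_vector3:
  fixes f g h :: "'a::euclidean_space \<Rightarrow> 'b::euclidean_space"
  assumes "open U" "smooth_on U f" "smooth_on U g" "smooth_on U h"
  shows "smooth_on U (\<lambda>x. vector [f x, g x, h x] :: 'b^3)"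
proof (rule smooth_on_vec[OF assms(1)])
  fix i :: 3
  show "smooth_on U (\<lambda>x. (vector [f x, g x, h x] :: 'b^3) $ i)"
    using exhaust_3[of i] assms(2-) by auto
qed

lemma smooth_retract_SO3: "smooth_retract SO3 SO3_nbhd gram_schmidt"
proof
  have cont: "continuous_on UNIV (\<lambda>Q :: real^3^3. cross3 (row 1 Q) (row 2 Q))"
    by (intro continuous_on_cross linear_continuous_on bounded_linear_row)
  have eq: "SO3_nbhd = (\<lambda>Q. cross3 (row 1 Q) (row 2 Q)) -` (- {0})"
    by (auto simp: SO3_nbhd_def)
  show op: "open SO3_nbhd"
    unfolding eq by (rule open_vimage[OF _ cont]) auto
  have ne: "row 1 Q \<noteq> 0" "cross3 (row 1 Q) (row 2 Q) \<noteq> 0" if "Q \<in> SO3_nbhd" for Q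
    using that by (auto simp: SO3_nbhd_def)
  show "smooth_on SO3_nbhd gram_schmidt"
    unfolding gram_schmidt_def Let_def
    by (intro smooth_on_vector3 smooth_on_cross3 smooth_on_scaleR smooth_on_divide smooth_on_const
        smooth_on_norm smooth_on_row smooth_on_id op) (use ne in auto)
  show "SO3 \<subseteq> SO3_nbhd"
  proof
    fix Q assume Q: "Q \<in> SO3"
    then have "norm (row 3 Q) = 1"
      by (simp add: SO3_def rotation_matrix_def orthogonal_matrix_orthonormal_rows)
    then show "Q \<in> SO3_nbhd"
      using SO3_D(6)[OF Q] by (auto simp: SO3_nbhd_def)
  qed
  show "gram_schmidt Q \<in> SO3" if Q: "Q \<in> SO3_nbhd" for Q
  proof -
    define a where "a = (1 / norm (row 1 Q)) *\<^sub>R row 1 Q"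
    define n where "n = cross3 (row 1 Q) (row 2 Q)"
    define c where "c = (1 / norm n) *\<^sub>R n"
    have a: "norm a = 1" using ne[OF Q] by (simp add: a_def)
    have c: "norm c = 1" using ne[OF Q] by (simp add: c_def n_def)
    have ac: "a \<bullet> c = 0" by (simp add: a_def c_def n_def dot_cross_self)
    have ca: "norm (cross3 c a) = 1"
      using norm_cross_dot[of c a] a c ac by (simp add: inner_commute power2_eq_1_iff)
        (metis abs_norm_cancel abs_1 abs_minus_cancel)
    have g: "gram_schmidt Q = vector [a, cross3 c a, c]"
      by (simp add: gram_schmidt_def a_def n_def c_def Let_def)
    have "orthogonal_matrix (gram_schmidt Q)"
      unfolding orthogonal_matrix_orthonormal_rows g
      using a c ac ca by (simp add: forall_3 row_vector orthogonal_def dot_cross_self inner_commute)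
    moreover have "det (gram_schmidt Q) = 1"
    proof -
      have "det (gram_schmidt Q) = a \<bullet> cross3 (cross3 c a) c"
        unfolding g by (rule dot_cross_det[symmetric])
      then show ?thesis using a c ac by (simp add: cross3_triple norm_1_inner)
    qed
    ultimately show ?thesis by (simp add: SO3_def rotation_matrix_def)
  qed
  show "gram_schmidt Q = Q" if Q: "Q \<in> SO3" for Q
  proof -
    have "norm (row 1 Q) = 1" "norm (row 3 Q) = 1"
      using Q by (auto simp: SO3_def rotation_matrix_def orthogonal_matrix_orthonormal_rows)
    then have "gram_schmidt Q = vector [row 1 Q, row 2 Q, row 3 Q]"
      using SO3_D(6,8)[OF Q] by (simp add: gram_schmidt_def)
    also have "\<dots> = Q" by (simp add: vec_eq_iff forall_3 row_def)
    finally show ?thesis .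
  qed
qed

interpretation SO3: smooth_retract SO3 SO3_nbhd gram_schmidt
  by (rule smooth_retract_SO3)

definition normalize3 :: "real^3 \<Rightarrow> real^3" where
  "normalize3 x = (1 / norm x) *\<^sub>R x"

interpretation S2: smooth_retract S2 "- {0}" normalize3
proof
  show "smooth_on (- {0}) normalize3"
    unfolding normalize3_def
    by (intro smooth_on_scaleR smooth_on_divide smooth_on_const smooth_on_norm smooth_on_id) auto
qed (auto simp: S2_iff normalize3_def)

lemma tangent_space_S2:
  assumes "x \<in> S2"
  shows "a \<in> tangent_space S2 x \<longleftrightarrow> x \<bullet> a = 0"
proof
  assume a: "a \<in> tangent_space S2 x"
  have "((\<lambda>x. x \<bullet> x) has_derivative (\<lambda>a. x \<bullet> a + a \<bullet> x)) (at x)"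
    by (rule has_derivative_inner[OF has_derivative_ident has_derivative_ident])
  from tderiv_eqI[OF a open_UNIV UNIV_I this, of "\<lambda>_. 1"]
    tderiv_eqI[OF a open_UNIV UNIV_I has_derivative_const, of "\<lambda>_. 1 :: real" 1]
  show "x \<bullet> a = 0" by (simp add: S2_iff norm_1_inner inner_commute)
next
  assume 0: "x \<bullet> a = 0"
  obtain Q where Q: "Q \<in> SO3" "row 1 Q = x" using SO3_row_surj[OF assms] by blast
  have "Q ** hat (cross3 a x) \<in> tangent_space SO3 Q"
    using tangent_space_SO3[OF Q(1)] by blast
  then have "fderiv (row 1) Q (Q ** hat (cross3 a x)) \<in> tangent_space S2 (row 1 Q)"
    by (rule tangent_space_image[OF _ open_UNIV UNIV_I smooth_on_linear[OF bounded_linear_row]])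
      (rule row_SO3_in_S2)
  moreover have "fderiv (row 1) Q (Q ** hat (cross3 a x)) = cross3 x (cross3 a x)"
    using fderiv_eqI[OF bounded_linear_imp_has_derivative[OF bounded_linear_row]]
    by (simp add: row_mult_hat Q(2))
  ultimately show "a \<in> tangent_space S2 x"
    using assms 0 Q(2) by (simp add: S2_iff norm_1_inner cross3_triple)
qed

lemma submanifold_S2: "submanifold S2"
proof -
  let ?e = "axis 1 1 :: real^3"
  let ?F = "\<lambda>y :: real^3. (y \<bullet> y - 1) *\<^sub>R ?e"
  have D: "fderiv ?F x = (\<lambda>h. (2 * (x \<bullet> h)) *\<^sub>R ?e)" for x
    by (rule fderiv_eqI) (auto intro!: derivative_eq_intros simp: inner_commute fun_eq_iff)
  have R: "range (fderiv ?F x) = span {?e}" if "x \<in> S2" for x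
  proof -
    have "c *\<^sub>R ?e = (2 * (x \<bullet> (c / 2) *\<^sub>R x)) *\<^sub>R ?e" for c
      using that by (simp add: S2_iff norm_1_inner)
    then show ?thesis unfolding D span_singleton by blast
  qed
  have sm: "smooth_on UNIV ?F"
    by (intro smooth_on_scaleR smooth_on_diff smooth_on_inner smooth_on_id smooth_on_const) auto
  show ?thesis
    unfolding submanifold_def
  proof (rule exI[of _ "dim (span {?e})"], rule ballI, rule exI[of _ UNIV],
      rule exI[of _ "span {?e}"], rule exI[of _ ?F], intro conjI)
    show "range (fderiv ?F x) = span {?e}" if "x \<in> S2" for x by (rule R[OF that])
    show "?F ` UNIV \<subseteq> span {?e}" by (auto simp: span_base span_scale)
  qed (use sm in \<open>auto simp: S2_iff norm_1_inner axis_eq_0_iff\<close>)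
qed

lemma submanifold_SO3: "submanifold SO3"
proof -
  let ?F = "\<lambda>Q :: real^3^3. transpose Q ** Q - mat 1"
  let ?W = "{B :: real^3^3. transpose B = B}"
  let ?U = "{Q :: real^3^3. det Q > 0}"
  have F: "(?F has_derivative (\<lambda>A. transpose Q ** A + transpose A ** Q)) (at Q)" for Q
    using has_derivative_diff[OF bounded_bilinear.FDERIV[OF bounded_bilinear_matrix_mult
          bounded_linear_imp_has_derivative[OF bounded_linear_transpose] has_derivative_ident]
        has_derivative_const] by simp
  have W: "subspace ?W"
    by (rule subspaceI) (auto simp: linear_0[OF linear_transpose] linear_add[OF linear_transpose]
        linear_scale[OF linear_transpose])
  have R: "range (fderiv ?F Q) = ?W" if Q: "Q \<in> SO3" for Q
  proof -
    have "B = transpose Q ** ((1/2) *\<^sub>R (Q ** B)) + transpose ((1/2) *\<^sub>R (Q ** B)) ** Q"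
      if B: "transpose B = B" for B
    proof -
      have "transpose Q ** ((1/2) *\<^sub>R (Q ** B)) = (1/2) *\<^sub>R B"
        using SO3_D(1)[OF Q]
        by (simp add: matrix_mult_scaleR matrix_mul_assoc)
      moreover have "transpose ((1/2) *\<^sub>R (Q ** B)) ** Q = (1/2) *\<^sub>R B"
        using SO3_D(1)[OF Q] B
        by (simp add: linear_scale[OF linear_transpose] matrix_transpose_mul matrix_mult_scaleR
            matrix_mul_assoc[symmetric])
      ultimately show ?thesis by (simp flip: scaleR_left_distrib)
    qed
    then have "?W \<subseteq> range (\<lambda>A. transpose Q ** A + transpose A ** Q)" by blast
    then show ?thesis
      unfolding fderiv_eqI[OF F]
      by (auto simp: matrix_transpose_mul linear_add[OF linear_transpose] add.commute)
  qed
  have sm: "smooth_on ?U ?F" if "open ?U"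
    by (intro smooth_on_diff smooth_on_matrix_mult smooth_on_transpose smooth_on_id smooth_on_const that)
  have op: "open ?U"
    unfolding det_3 by (intro open_Collect_less continuous_intros)
  show ?thesis
    unfolding submanifold_def
  proof (rule exI[of _ "dim ?W"], rule ballI, rule exI[of _ ?U], rule exI[of _ ?W],
      rule exI[of _ ?F], intro conjI)
    fix Q assume Q: "Q \<in> SO3"
    show "SO3 \<inter> ?U = {Q \<in> ?U. ?F Q = 0}"
    proof (intro set_eqI iffI)
      fix P assume "P \<in> {Q \<in> ?U. ?F Q = 0}"
      then have P: "transpose P ** P = mat 1" "det P > 0" by auto
      then have "det P = 1 \<or> det P = -1"
        by (intro det_orthogonal_matrix) (simp add: orthogonal_matrix)
      then show "P \<in> SO3 \<inter> ?U" using P SO3_I by auto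
    qed (auto simp: SO3_D)
  qed (use op sm W R SO3_D(4) in \<open>auto simp: linear_diff[OF linear_transpose] matrix_transpose_mul\<close>)
qed

section \<open>The rigid body: metric, momentum and connection\<close>

definition body_vec :: "real^3^3 \<Rightarrow> real^3^3 \<Rightarrow> real^3" where
  "body_vec Q A = so3_vec (transpose Q ** A)"

lemma bilinear_body_vec: "bilinear body_vec"
  unfolding bilinear_def body_vec_def
  using bounded_bilinear.add_right[OF bounded_bilinear_matrix_mult]
    bounded_bilinear.add_left[OF bounded_bilinear_matrix_mult]
  by (auto intro!: linearI simp: so3_vec_simps linear_add[OF linear_transpose]
      linear_scale[OF linear_transpose] matrix_mult_scaleR)

lemmas bounded_bilinear_body_vec = bilinear_body_vec[unfolded bilinear_conv_bounded_bilinear]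

lemma body_vec_hat: "Q \<in> SO3 \<Longrightarrow> body_vec Q (Q ** hat w) = w"
  by (simp add: body_vec_def spin_mult_hat)

lemma body_vec_hat_hat:
  assumes "Q \<in> SO3"
  shows "body_vec (Q ** hat a) (Q ** hat b) = - so3_vec (hat a ** hat b)"
proof -
  have "transpose (Q ** hat a) ** (Q ** hat b) = - (hat a ** (transpose Q ** Q) ** hat b)"
    by (simp add: matrix_transpose_mul transpose_hat matrix_mul_assoc
        bounded_bilinear.minus_left[OF bounded_bilinear_matrix_mult])
  then show ?thesis
    unfolding body_vec_def by (simp add: SO3_D(1)[OF assms] so3_vec_simps)
qed

text \<open>
  The commutator of two angular velocities.  It accounts for the gyroscopic term of Euler's
  equations and for the curvature of the connection.
\<close>

lemma body_vec_commutator: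
  assumes "Q \<in> SO3"
  shows "body_vec (Q ** hat a) (Q ** hat b) - body_vec (Q ** hat b) (Q ** hat a) = - cross3 a b"
  unfolding body_vec_hat_hat[OF assms] so3_vec_hat_commutator[symmetric] by simp

lemma tangent_SO3_E:
  assumes "A \<in> tangent_space SO3 Q" "Q \<in> SO3"
  obtains w where "A = Q ** hat w"
  using assms tangent_space_SO3 by blast

lemma tangent_SO3_I: "Q \<in> SO3 \<Longrightarrow> Q ** hat w \<in> tangent_space SO3 Q"
  using tangent_space_SO3 by blast

lemma body_field_eq:
  assumes Q: "Q \<in> SO3"
  shows "body_field Q = Q ** hat (row 1 Q)"
proof -
  let ?E = "vector [vector [0, 0, 0], vector [0, 0, -1], vector [0, 1, 0]] :: real^3^3"
  let ?A = "mat 1 :: real^3^3"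
  have ax: "axis_rotation t = vector [vector [1, 0, 0], 0, 0] + cos t *\<^sub>R vector [0, vector [0, 1, 0],
      vector [0, 0, 1]] + sin t *\<^sub>R ?E" for t
    by (simp add: axis_rotation_def vec_eq_iff forall_3)
  have "((\<lambda>t. axis_rotation t) has_vector_derivative ?E) (at 0)"
    unfolding ax has_vector_derivative_def
    by (rule has_derivative_eq_rhs, (rule derivative_intros)+) (auto simp: fun_eq_iff)
  then have "((\<lambda>t. axis_rotation t ** Q) has_vector_derivative ?E ** Q) (at 0)"
    by (rule bounded_linear.has_vector_derivative
        [OF bounded_bilinear.bounded_linear_left[OF bounded_bilinear_matrix_mult]])
  then have "body_field Q = ?E ** Q"
    unfolding body_field_def by (rule vector_derivative_at)
  also have "\<dots> = Q ** (transpose Q ** (?E ** Q))"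
    using SO3_D(2)[OF Q] by (simp add: matrix_mul_assoc)
  also have "transpose Q ** (?E ** Q) = hat (cross3 (row 2 Q) (row 3 Q))"
    by (simp add: matrix3_simps algebra_simps)
  finally show ?thesis by (simp add: SO3_D(7)[OF Q])
qed

lemma tangent_map_body_proj:
  assumes "w \<in> tangent_bundle SO3"
  shows "tangent_map SO3 body_proj w = (row 1 (fst w), row 1 (snd w))"
  using assms tderiv_bounded_linear[OF bounded_linear_row, of "snd w" SO3 "fst w" 1]
  by (simp add: tangent_map_def case_prod_beta SO3.tangent_bundle_iff body_proj_def[abs_def])

lemma tderiv_body_proj:
  "A \<in> tangent_space SO3 Q \<Longrightarrow> tderiv SO3 body_proj Q A = row 1 A"
  using tderiv_bounded_linear[OF bounded_linear_row] by (simp add: body_proj_def[abs_def])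

locale rigid_body =
  fixes I1 I2 I3 :: real
  assumes I_pos: "I1 > 0" "I2 > 0" "I3 > 0"
begin

abbreviation ang_mom :: "real^3 \<Rightarrow> real^3" where
  "ang_mom w \<equiv> inertia I1 I2 I3 *v w"

abbreviation bm :: "real^3^3 \<Rightarrow> real^3^3 \<Rightarrow> real^3^3 \<Rightarrow> real" where
  "bm \<equiv> body_metric I1 I2 I3"

definition axis_moment :: "real^3 \<Rightarrow> real" where
  "axis_moment x = ang_mom x \<bullet> x"

definition cofactor_form :: "real^3 \<Rightarrow> real^3 \<Rightarrow> real" where
  "cofactor_form a b = I2 * I3 * a$1 * b$1 + I3 * I1 * a$2 * b$2 + I1 * I2 * a$3 * b$3"

lemma ang_mom_nth: "ang_mom w $ 1 = I1 * w$1" "ang_mom w $ 2 = I2 * w$2" "ang_mom w $ 3 = I3 * w$3"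
  by (simp_all add: inertia_def matrix_vector_mult_def sum_3)

lemma inner3: "x \<bullet> y = x$1 * y$1 + x$2 * y$2 + x$3 * y$3" for x y :: "real^3"
  by (simp add: inner_vec_def sum_3)

lemma cross3_nth: "cross3 x y $ 1 = x$2 * y$3 - x$3 * y$2" "cross3 x y $ 2 = x$3 * y$1 - x$1 * y$3"
  "cross3 x y $ 3 = x$1 * y$2 - x$2 * y$1"
  by (simp_all add: cross3_def)

lemma linear_ang_mom: "linear ang_mom"
  by (rule matrix_vector_mul_linear)

lemmas bounded_linear_ang_mom = linear_ang_mom[unfolded linear_conv_bounded_linear]
lemmas ang_mom_simps = linear_add[OF linear_ang_mom] linear_scale[OF linear_ang_mom] linear_diff[OF linear_ang_mom]

lemma ang_mom_sym: "ang_mom a \<bullet> b = ang_mom b \<bullet> a"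
  by (simp add: inner3 ang_mom_nth)

lemma axis_moment_eq: "axis_moment x = I1 * (x$1)\<^sup>2 + I2 * (x$2)\<^sup>2 + I3 * (x$3)\<^sup>2"
  by (simp add: axis_moment_def inner3 ang_mom_nth power2_eq_square)

lemma axis_moment_pos:
  assumes "x \<noteq> 0"
  shows "axis_moment x > 0"
proof -
  have "x$1 \<noteq> 0 \<or> x$2 \<noteq> 0 \<or> x$3 \<noteq> 0"
    using assms by (auto simp: vec_eq_iff forall_3)
  moreover have "I1 * (x$1)\<^sup>2 \<ge> 0" "I2 * (x$2)\<^sup>2 \<ge> 0" "I3 * (x$3)\<^sup>2 \<ge> 0"
    using I_pos by simp_all
  moreover have "x$1 \<noteq> 0 \<Longrightarrow> I1 * (x$1)\<^sup>2 > 0" "x$2 \<noteq> 0 \<Longrightarrow> I2 * (x$2)\<^sup>2 > 0"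
    "x$3 \<noteq> 0 \<Longrightarrow> I3 * (x$3)\<^sup>2 > 0"
    using I_pos by simp_all
  ultimately show ?thesis unfolding axis_moment_eq by linarith
qed

lemma S2_moment: "x \<in> S2 \<Longrightarrow> axis_moment x > 0"
  by (rule axis_moment_pos) (auto simp: S2_iff)

lemma SO3_moment: "Q \<in> SO3 \<Longrightarrow> axis_moment (row 1 Q) > 0"
  by (rule S2_moment[OF row_SO3_in_S2])

text \<open>
  Lagrange's identity for the inner product \<open>ang_mom a \<bullet> b\<close>.  The vector product turns that inner
  product into the one given by the cofactors of the inertia matrix, which is the origin of the
  formula for the reduced metric.
\<close>

lemma lagrange_identity:
  "axis_moment x * (ang_mom a \<bullet> b) - (ang_mom x \<bullet> a) * (ang_mom x \<bullet> b) = cofactor_form (cross3 x a) (cross3 x b)"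
  by (simp add: axis_moment_def cofactor_form_def inner3 ang_mom_nth cross3_nth algebra_simps)

text \<open>
  On rotations the transpose is the inverse; its use makes the metric polynomial in the matrix and
  hence defined and smooth on the whole ambient space.
\<close>

definition body_form :: "real^3^3 \<Rightarrow> real^3^3 \<Rightarrow> real^3^3 \<Rightarrow> real" where
  "body_form Q A B = ang_mom (body_vec Q A) \<bullet> body_vec Q B"

lemma body_metric_eq: "Q \<in> SO3 \<Longrightarrow> bm Q A B = body_form Q A B"
  by (simp add: body_metric_def body_form_def body_vec_def spin_SO3)

lemma body_form_hat: "Q \<in> SO3 \<Longrightarrow> body_form Q (Q ** hat a) (Q ** hat b) = ang_mom a \<bullet> b"
  by (simp add: body_form_def body_vec_hat)

lemma smooth_on_ang_mom: "open U \<Longrightarrow> smooth_on U f \<Longrightarrow> smooth_on U (\<lambda>x. ang_mom (f x))"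
  by (rule smooth_on_bounded_linear[OF bounded_linear_ang_mom])

lemmas smooth_on_body_vec = smooth_on_bounded_bilinear[OF bounded_bilinear_body_vec]

sublocale B: metric_retract SO3 SO3_nbhd gram_schmidt bm body_form
proof
  show "bilinear (body_form Q)" for Q
    unfolding bilinear_def body_form_def
    by (auto intro!: linearI simp: ang_mom_simps inner_simps
        bounded_bilinear.add_right[OF bounded_bilinear_body_vec]
        bounded_bilinear.scaleR_right[OF bounded_bilinear_body_vec])
  show "smooth_on SO3_nbhd (\<lambda>x. body_form x (X x) (Y x))"
    if "smooth_on SO3_nbhd X" "smooth_on SO3_nbhd Y" for X Y
    unfolding body_form_def
    by (intro smooth_on_inner smooth_on_ang_mom smooth_on_body_vec smooth_on_id that SO3.open_U)
  show "bm Q A B = body_form Q A B" if "Q \<in> SO3" for Q A B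
    by (rule body_metric_eq[OF that])
  show "body_form Q A B = body_form Q B A" for Q A B
    unfolding body_form_def by (rule ang_mom_sym)
  show "body_form Q A A > 0" if Q: "Q \<in> SO3" and A: "A \<in> tangent_space SO3 Q" "A \<noteq> 0" for Q A
  proof -
    obtain w where w: "A = Q ** hat w" using tangent_SO3_E[OF A(1) Q] .
    moreover have "w \<noteq> 0" using A(2) w by (auto simp: linear_0[OF linear_hat]
        bounded_bilinear.zero_right[OF bounded_bilinear_matrix_mult])
    ultimately show ?thesis
      using axis_moment_pos by (simp add: body_form_hat[OF Q] axis_moment_def)
  qed
qed

lemma momentum_hat:
  assumes "Q \<in> SO3"
  shows "momentum bm body_field (Q, Q ** hat w) = ang_mom (row 1 Q) \<bullet> w"
  using assms by (simp add: momentum_def body_metric_eq body_field_eq body_form_hat)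

lemma momentum_level_iff:
  "(Q, A) \<in> momentum_level SO3 bm body_field k \<longleftrightarrow>
    Q \<in> SO3 \<and> (\<exists>w. A = Q ** hat w \<and> ang_mom (row 1 Q) \<bullet> w = k)"
proof -
  have "(Q, A) \<in> momentum_level SO3 bm body_field k \<longleftrightarrow>
      Q \<in> SO3 \<and> (\<exists>w. A = Q ** hat w) \<and> momentum bm body_field (Q, A) = k"
    by (auto simp: momentum_level_def tangent_bundle_def tangent_space_SO3)
  then show ?thesis using momentum_hat by metis
qed

text \<open>
  The vector \<open>w\<close> with \<open>cross3 x w = u\<close> and \<open>ang_mom x \<bullet> w = k\<close>, when \<open>u\<close> is tangent to the sphere at
  \<open>x\<close>: the angular velocity of a motion with momentum \<open>k\<close> that moves \<open>x\<close> with velocity \<open>u\<close>.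
\<close>

definition ang_vel :: "real \<Rightarrow> real^3 \<Rightarrow> real^3 \<Rightarrow> real^3" where
  "ang_vel k x u = cross3 u x + ((k - ang_mom x \<bullet> cross3 u x) / axis_moment x) *\<^sub>R x"

lemma ang_vel_correct:
  assumes "x \<in> S2" "x \<bullet> u = 0"
  shows "cross3 x (ang_vel k x u) = u" "ang_mom x \<bullet> ang_vel k x u = k"
  using S2_moment[OF assms(1)] assms
  by (simp_all add: ang_vel_def cross_add_right cross_mult_right cross3_triple S2_iff norm_1_inner
      inner_simps) (simp add: axis_moment_def)

lemma ang_vel_unique:
  assumes "x \<in> S2"
  shows "ang_vel (ang_mom x \<bullet> w) x (cross3 x w) = w"
proof -
  have "cross3 (cross3 x w) x = w - (x \<bullet> w) *\<^sub>R x"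
    using assms by (simp add: cross3_triple S2_iff norm_1_inner inner_commute)
  then show ?thesis
    using S2_moment[OF assms]
    by (simp add: ang_vel_def inner_simps axis_moment_def)
qed

definition sphere_form :: "real^3 \<Rightarrow> real^3 \<Rightarrow> real^3 \<Rightarrow> real" where
  "sphere_form x a b = cofactor_form a b / axis_moment x"

abbreviation mt :: "real^3 \<Rightarrow> real^3 \<Rightarrow> real^3 \<Rightarrow> real" where
  "mt \<equiv> reduced_metric SO3 bm body_field body_proj"

text \<open>
  The orthogonal decomposition along the symmetry field.  For \<open>a = b\<close> it splits the kinetic energy
  into the reduced kinetic energy and the term that the momentum adds to the potential.
\<close>

lemma inner_ang_mom_split:
  assumes "x \<in> S2"
  shows "ang_mom a \<bullet> b = sphere_form x (cross3 x a) (cross3 x b) + (ang_mom x \<bullet> a) * (ang_mom x \<bullet> b) / axis_moment x"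
  using S2_moment[OF assms] lagrange_identity[of x a b] by (simp add: sphere_form_def field_simps)

lemma reduced_metric_eq:
  assumes x: "x \<in> S2" and a: "a \<in> tangent_space S2 x" and b: "b \<in> tangent_space S2 x"
  shows "mt x a b = sphere_form x a b"
  unfolding reduced_metric_def
proof (rule the_equality)
  show *: "\<forall>Q A B. (Q, A) \<in> momentum_level SO3 bm body_field 0 \<and>
      (Q, B) \<in> momentum_level SO3 bm body_field 0 \<and>
      tangent_map SO3 body_proj (Q, A) = (x, a) \<and> tangent_map SO3 body_proj (Q, B) = (x, b) \<longrightarrow>
      sphere_form x a b = bm Q A B"
  proof (intro allI impI, elim conjE)
    fix Q A B
    assume AB: "(Q, A) \<in> momentum_level SO3 bm body_field 0"
      "(Q, B) \<in> momentum_level SO3 bm body_field 0"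
      and p: "tangent_map SO3 body_proj (Q, A) = (x, a)" "tangent_map SO3 body_proj (Q, B) = (x, b)"
    have Q: "Q \<in> SO3" using AB by (simp add: momentum_level_iff)
    obtain u v where u: "A = Q ** hat u" "ang_mom (row 1 Q) \<bullet> u = 0"
      and v: "B = Q ** hat v" "ang_mom (row 1 Q) \<bullet> v = 0"
      using AB by (auto simp: momentum_level_iff)
    have T: "(Q, A) \<in> tangent_bundle SO3" "(Q, B) \<in> tangent_bundle SO3"
      using Q u v by (auto simp: SO3.tangent_bundle_iff tangent_SO3_I)
    have "row 1 Q = x" "row 1 A = a" "row 1 B = b"
      using p tangent_map_body_proj[OF T(1)] tangent_map_body_proj[OF T(2)] by auto
    then have "row 1 Q = x" "cross3 x u = a" "cross3 x v = b"
      by (auto simp: u v row_mult_hat)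
    then show "sphere_form x a b = bm Q A B"
      using inner_ang_mom_split[OF x, of u v] u v by (simp add: body_metric_eq Q body_form_hat)
  qed
  show "c = sphere_form x a b" if c: "\<forall>Q A B. (Q, A) \<in> momentum_level SO3 bm body_field 0 \<and>
      (Q, B) \<in> momentum_level SO3 bm body_field 0 \<and>
      tangent_map SO3 body_proj (Q, A) = (x, a) \<and> tangent_map SO3 body_proj (Q, B) = (x, b) \<longrightarrow>
      c = bm Q A B" for c
  proof -
    obtain Q where Q: "Q \<in> SO3" "row 1 Q = x" using SO3_row_surj[OF x] by blast
    have "(Q, Q ** hat (ang_vel 0 x u)) \<in> momentum_level SO3 bm body_field 0 \<and>
      tangent_map SO3 body_proj (Q, Q ** hat (ang_vel 0 x u)) = (x, u)"
      if "u \<in> tangent_space S2 x" for u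
      using that Q ang_vel_correct[OF x, of u]
      by (auto simp: momentum_level_iff tangent_map_body_proj SO3.tangent_bundle_iff tangent_SO3_I
          tangent_space_S2[OF x] row_mult_hat)
    then show ?thesis
      using c * a b by metis
  qed
qed

lemma sphere_form_eq: "sphere_form x a a = I1 * I2 * I3 * ((a$1)\<^sup>2 / I1 + (a$2)\<^sup>2 / I2 + (a$3)\<^sup>2 / I3) / axis_moment x"
proof -
  have "I1 * I2 * I3 * ((a$1)\<^sup>2 / I1 + (a$2)\<^sup>2 / I2 + (a$3)\<^sup>2 / I3) = cofactor_form a a"
    using I_pos by (simp add: cofactor_form_def power2_eq_square field_simps)
  then show ?thesis by (simp add: sphere_form_def)
qed

lemma smooth_on_axis_moment:
  "open U \<Longrightarrow> smooth_on U f \<Longrightarrow> smooth_on U (\<lambda>x. axis_moment (f x))"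
  unfolding axis_moment_def by (intro smooth_on_inner smooth_on_ang_mom)

lemma open_nonzero: "open (- {0 :: real^3})"
  by auto

sublocale S: metric_retract S2 "- {0}" normalize3 mt sphere_form
proof
  show "bilinear (sphere_form x)" for x
    unfolding bilinear_def sphere_form_def cofactor_form_def
    by (auto intro!: linearI simp: algebra_simps add_divide_distrib)
  show "smooth_on (- {0}) (\<lambda>x. sphere_form x (X x) (Y x))"
    if "smooth_on (- {0}) X" "smooth_on (- {0}) Y" for X Y
    unfolding sphere_form_def cofactor_form_def
    by (intro smooth_on_divide smooth_on_add smooth_on_mult smooth_on_nth smooth_on_const
        smooth_on_axis_moment smooth_on_id that open_nonzero) (use axis_moment_pos in force)
  show "mt x a b = sphere_form x a b"
    if "x \<in> S2" "a \<in> tangent_space S2 x" "b \<in> tangent_space S2 x" for x a b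
    by (rule reduced_metric_eq[OF that])
  show "sphere_form x a b = sphere_form x b a" for x a b
    by (simp add: sphere_form_def cofactor_form_def algebra_simps)
  show "sphere_form x a a > 0" if x: "x \<in> S2" and a: "a \<noteq> 0" for x a
  proof -
    have "a$1 \<noteq> 0 \<or> a$2 \<noteq> 0 \<or> a$3 \<noteq> 0"
      using a by (auto simp: vec_eq_iff forall_3)
    moreover have "I2 * I3 * (a$1)\<^sup>2 \<ge> 0" "I3 * I1 * (a$2)\<^sup>2 \<ge> 0" "I1 * I2 * (a$3)\<^sup>2 \<ge> 0"
      using I_pos by simp_all
    moreover have "a$1 \<noteq> 0 \<Longrightarrow> I2 * I3 * (a$1)\<^sup>2 > 0" "a$2 \<noteq> 0 \<Longrightarrow> I3 * I1 * (a$2)\<^sup>2 > 0"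
      "a$3 \<noteq> 0 \<Longrightarrow> I1 * I2 * (a$3)\<^sup>2 > 0"
      using I_pos by simp_all
    ultimately have "I2 * I3 * (a$1)\<^sup>2 + I3 * I1 * (a$2)\<^sup>2 + I1 * I2 * (a$3)\<^sup>2 > 0" by linarith
    then have "cofactor_form a a > 0" by (simp add: cofactor_form_def power2_eq_square mult.assoc)
    then show ?thesis using S2_moment[OF x] by (simp add: sphere_form_def)
  qed
qed

lemma reduced_potential_eq:
  assumes x: "x \<in> S2"
  shows "reduced_potential SO3 bm (Vt \<circ> body_proj) body_field body_proj k x
    = Vt x + k\<^sup>2 / (2 * axis_moment x)"
  unfolding reduced_potential_def
proof (rule the_equality)
  have m: "bm Q (body_field Q) (body_field Q) = axis_moment (row 1 Q)" if "Q \<in> SO3" for Q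
    using that by (simp add: body_metric_eq body_field_eq body_form_hat axis_moment_def)
  show "\<forall>Q\<in>SO3. body_proj Q = x \<longrightarrow> Vt x + k\<^sup>2 / (2 * axis_moment x) =
      (Vt \<circ> body_proj) Q + k\<^sup>2 / (2 * bm Q (body_field Q) (body_field Q))"
    by (auto simp: m body_proj_def)
  then show "c = Vt x + k\<^sup>2 / (2 * axis_moment x)"
    if "\<forall>Q\<in>SO3. body_proj Q = x \<longrightarrow> c =
      (Vt \<circ> body_proj) Q + k\<^sup>2 / (2 * bm Q (body_field Q) (body_field Q))" for c
    using that SO3_row_surj[OF x] by (metis body_proj_def)
qed

section \<open>The form of gyroscopic forces\<close>

definition connection :: "real^3^3 \<Rightarrow> real^3^3 \<Rightarrow> real" where
  "connection Q A = (ang_mom (row 1 Q) \<bullet> body_vec Q A) / axis_moment (row 1 Q)"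

text \<open>
  The density of the curvature of the connection with respect to the area form of the sphere.
\<close>

definition curvature :: "real^3 \<Rightarrow> real" where
  "curvature x = ((I2 + I3 - I1) * I1 * (x$1)\<^sup>2 + (I3 + I1 - I2) * I2 * (x$2)\<^sup>2
    + (I1 + I2 - I3) * I3 * (x$3)\<^sup>2) / (axis_moment x)\<^sup>2"

lemma linear_connection: "linear (connection Q)"
  unfolding connection_def
  by (auto intro!: linearI simp: inner_simps add_divide_distrib
      bounded_bilinear.add_right[OF bounded_bilinear_body_vec]
      bounded_bilinear.scaleR_right[OF bounded_bilinear_body_vec])

lemma connection_form_eq:
  assumes "Q \<in> SO3" "A \<in> tangent_space SO3 Q"
  shows "connection_form bm body_field Q A = connection Q A"
  using assms
  by (auto simp: connection_form_def body_metric_eq body_field_eq body_form_hat tangent_space_SO3 connection_def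
      body_vec_hat axis_moment_def)

lemma has_derivative_connection:
  assumes "axis_moment (row 1 Q) > 0"
  shows "((\<lambda>Q. connection Q B) has_derivative (\<lambda>A.
    ((ang_mom (row 1 Q) \<bullet> body_vec A B + ang_mom (row 1 A) \<bullet> body_vec Q B) * axis_moment (row 1 Q)
      - (ang_mom (row 1 Q) \<bullet> body_vec Q B) * (2 * (ang_mom (row 1 Q) \<bullet> row 1 A)))
    / (axis_moment (row 1 Q) * axis_moment (row 1 Q)))) (at Q)"
proof -
  have i: "((\<lambda>Q. ang_mom (row 1 Q)) has_derivative (\<lambda>A. ang_mom (row 1 A))) (at Q)"
    by (intro bounded_linear.has_derivative[OF bounded_linear_ang_mom]
        bounded_linear_imp_has_derivative bounded_linear_row)
  have v: "((\<lambda>Q. body_vec Q B) has_derivative (\<lambda>A. body_vec A B)) (at Q)"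
    by (intro bounded_linear_imp_has_derivative
        bounded_bilinear.bounded_linear_left[OF bounded_bilinear_body_vec])
  have r: "(row 1 has_derivative row 1) (at Q)"
    by (intro bounded_linear_imp_has_derivative bounded_linear_row)
  have m: "((\<lambda>Q. axis_moment (row 1 Q)) has_derivative (\<lambda>A. 2 * (ang_mom (row 1 Q) \<bullet> row 1 A))) (at Q)"
    unfolding axis_moment_def
    by (rule has_derivative_eq_rhs[OF has_derivative_inner[OF i r]]) (simp add: ang_mom_sym fun_eq_iff)
  show ?thesis
    unfolding connection_def
    by (rule has_derivative_divide'[OF has_derivative_inner[OF i v] m]) (use assms in simp)
qed

text \<open>
  The left-hand side is the exterior derivative of the connection form by the quotient rule, times
  the square of the moment.  Both sides are cubic in \<open>x\<close>, which need not be a unit vector.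
\<close>

lemma curvature_identity:
  "(ang_mom (cross3 x a) \<bullet> b - ang_mom (cross3 x b) \<bullet> a - ang_mom x \<bullet> cross3 a b) * axis_moment x
    - 2 * ((ang_mom x \<bullet> b) * (ang_mom x \<bullet> cross3 x a) - (ang_mom x \<bullet> a) * (ang_mom x \<bullet> cross3 x b))
    = ((I2 + I3 - I1) * I1 * (x$1)\<^sup>2 + (I3 + I1 - I2) * I2 * (x$2)\<^sup>2
    + (I1 + I2 - I3) * I3 * (x$3)\<^sup>2) * (x \<bullet> cross3 a b)"
  by (simp add: axis_moment_eq inner3 ang_mom_nth cross3_nth power2_eq_square algebra_simps)

lemma ambient_ext_deriv_connection:
  assumes Q: "Q \<in> SO3" and A: "A \<in> tangent_space SO3 Q" and B: "B \<in> tangent_space SO3 Q"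
  shows "ambient_ext_deriv connection Q A B = curvature (row 1 Q) * (row 1 Q \<bullet> cross3 (row 1 A) (row 1 B))"
proof -
  obtain a b where a: "A = Q ** hat a" and b: "B = Q ** hat b"
    using tangent_SO3_E A B Q by metis
  let ?x = "row 1 Q"
  let ?D = "axis_moment ?x"
  note D = SO3_moment[OF Q]
  have cc: "ang_mom ?x \<bullet> body_vec A B - ang_mom ?x \<bullet> body_vec B A = - (ang_mom ?x \<bullet> cross3 a b)"
    unfolding a b inner_diff_right[symmetric] body_vec_commutator[OF Q] by simp
  have "ambient_ext_deriv connection Q A B =
     ((ang_mom (cross3 ?x a) \<bullet> b - ang_mom (cross3 ?x b) \<bullet> a + (ang_mom ?x \<bullet> body_vec A B - ang_mom ?x \<bullet> body_vec B A)) * ?D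
      - 2 * ((ang_mom ?x \<bullet> b) * (ang_mom ?x \<bullet> cross3 ?x a) - (ang_mom ?x \<bullet> a) * (ang_mom ?x \<bullet> cross3 ?x b))) / ?D\<^sup>2"
    unfolding ambient_ext_deriv_def fderiv_eqI[OF has_derivative_connection[OF D]]
    unfolding a b row_mult_hat body_vec_hat[OF Q]
    by (simp add: diff_divide_distrib add_divide_distrib power2_eq_square algebra_simps)
  also have "\<dots> = curvature ?x * (?x \<bullet> cross3 a b)"
    unfolding cc using curvature_identity[of ?x a b] by (simp add: curvature_def)
  also have "?x \<bullet> cross3 a b = ?x \<bullet> cross3 (row 1 A) (row 1 B)"
  proof -
    have "cross3 (cross3 ?x a) (cross3 ?x b) = (?x \<bullet> cross3 a b) *\<^sub>R ?x"
      by (simp add: vec_eq_iff forall_3 cross3_nth inner3 algebra_simps)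
    then show ?thesis
      using SO3_D(5)[OF Q] by (simp add: a b row_mult_hat norm_1_inner)
  qed
  finally show ?thesis .
qed

definition curvature_form :: "real^3 \<Rightarrow> real^3 \<Rightarrow> real^3 \<Rightarrow> real" where
  "curvature_form x a b = (if x \<in> S2 \<and> a \<in> tangent_space S2 x \<and> b \<in> tangent_space S2 x
    then curvature x * (x \<bullet> cross3 a b) else 0)"

lemma row_tangent: "Q \<in> SO3 \<Longrightarrow> A \<in> tangent_space SO3 Q \<Longrightarrow> row 1 A \<in> tangent_space S2 (row 1 Q)"
  by (auto simp: tangent_space_SO3 tangent_space_S2[OF row_SO3_in_S2] row_mult_hat dot_cross_self)

lemma row_tangent_surj:
  assumes "Q \<in> SO3" "a \<in> tangent_space S2 (row 1 Q)"
  shows "\<exists>A\<in>tangent_space SO3 Q. row 1 A = a"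
  using ang_vel_correct(1)[OF row_SO3_in_S2[OF assms(1)]] tangent_SO3_I[OF assms(1)] assms(2)
    tangent_space_S2[OF row_SO3_in_S2[OF assms(1)]] row_mult_hat by metis

lemma ext_deriv_connection:
  assumes Q: "Q \<in> SO3" and A: "A \<in> tangent_space SO3 Q" and B: "B \<in> tangent_space SO3 Q"
  shows "ext_deriv SO3 (connection_form bm body_field) Q A B = ambient_ext_deriv connection Q A B"
  by (rule SO3.ext_deriv_eq[OF Q A B linear_connection _ connection_form_eq])
    (use has_derivative_connection[OF SO3_moment[OF Q]] differentiable_def in blast)+

lemma smooth_on_curvature: "smooth_on (- {0}) curvature"
  unfolding curvature_def[abs_def]
  by (intro smooth_on_divide smooth_on_add smooth_on_mult smooth_on_nth smooth_on_const
        smooth_on_axis_moment smooth_on_id smooth_on_power open_nonzero) (use axis_moment_pos in force)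

lemma smooth_map_scaled_curvature_form:
  assumes "vector_field S2 X" "vector_field S2 Y"
  shows "smooth_map S2 (\<lambda>x. k * curvature_form x (X x) (Y x))"
proof (rule S2.smooth_mapI)
  have XY: "smooth_on (- {0}) (\<lambda>y. X (normalize3 y))" "smooth_on (- {0}) (\<lambda>y. Y (normalize3 y))"
    using assms by (auto simp: vector_field_def S2.smooth_map_iff)
  show "smooth_on (- {0})
      (\<lambda>x. k * (curvature x * (x \<bullet> cross3 (X (normalize3 x)) (Y (normalize3 x)))))"
    by (intro smooth_on_mult smooth_on_const smooth_on_curvature smooth_on_inner smooth_on_id
        smooth_on_cross3 XY open_nonzero)
  show "k * curvature_form x (X x) (Y x) = k * (curvature x * (x \<bullet> cross3 (X (normalize3 x)) (Y (normalize3 x))))"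
    if "x \<in> S2" for x
    using assms that by (simp add: curvature_form_def S2.r_fix vector_field_def)
qed

lemma two_form_scaled_curvature_form: "two_form S2 (\<lambda>x a b. k * curvature_form x a b)"
  unfolding two_form_def
proof (intro conjI ballI allI impI)
  fix x u v w and r s :: real
  assume x: "x \<in> S2" and T: "u \<in> tangent_space S2 x" "v \<in> tangent_space S2 x" "w \<in> tangent_space S2 x"
  have "r *\<^sub>R u + s *\<^sub>R v \<in> tangent_space S2 x"
    using S2.subspace_tangent_space[OF x] T by (simp add: subspace_add subspace_scale)
  then show "k * curvature_form x (r *\<^sub>R u + s *\<^sub>R v) w = r * (k * curvature_form x u w) + s * (k * curvature_form x v w)"
    using x T by (simp add: curvature_form_def cross_add_left cross_mult_left inner_simps algebra_simps)
  show "k * curvature_form x u v = - (k * curvature_form x v u)"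
    using x T cross_skew[of u v] by (simp add: curvature_form_def)
qed (use smooth_map_scaled_curvature_form in \<open>auto simp: curvature_form_def\<close>)

text \<open>
  The projection is a submersion onto the sphere, so its pull-back determines a 2-form.
\<close>

lemma gyroscopic_form_eq: "gyroscopic_form SO3 bm body_field S2 body_proj = curvature_form"
  unfolding gyroscopic_form_def
proof (rule the_equality)
  have *: "curvature_form (body_proj Q) (tderiv SO3 body_proj Q A) (tderiv SO3 body_proj Q B) =
      ext_deriv SO3 (connection_form bm body_field) Q A B"
    if "Q \<in> SO3" "A \<in> tangent_space SO3 Q" "B \<in> tangent_space SO3 Q" for Q A B
    using that
    by (simp add: tderiv_body_proj ext_deriv_connection ambient_ext_deriv_connection curvature_form_def
        body_proj_def row_SO3_in_S2 row_tangent)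
  show "two_form S2 curvature_form \<and> (\<forall>Q\<in>SO3. \<forall>A\<in>tangent_space SO3 Q. \<forall>B\<in>tangent_space SO3 Q.
      curvature_form (body_proj Q) (tderiv SO3 body_proj Q A) (tderiv SO3 body_proj Q B) =
      ext_deriv SO3 (connection_form bm body_field) Q A B)"
    using * two_form_scaled_curvature_form[of 1] by simp
  fix g
  assume g: "two_form S2 g \<and> (\<forall>Q\<in>SO3. \<forall>A\<in>tangent_space SO3 Q. \<forall>B\<in>tangent_space SO3 Q.
      g (body_proj Q) (tderiv SO3 body_proj Q A) (tderiv SO3 body_proj Q B) =
      ext_deriv SO3 (connection_form bm body_field) Q A B)"
  show "g = curvature_form"
  proof (intro ext)
    fix x a b
    show "g x a b = curvature_form x a b"
    proof (cases "x \<in> S2 \<and> a \<in> tangent_space S2 x \<and> b \<in> tangent_space S2 x")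
      case False
      then show ?thesis using g by (auto simp: two_form_def curvature_form_def)
    next
      case True
      then obtain Q where Q: "Q \<in> SO3" "row 1 Q = x" using SO3_row_surj by blast
      obtain A B where "A \<in> tangent_space SO3 Q" "row 1 A = a" "B \<in> tangent_space SO3 Q" "row 1 B = b"
        using row_tangent_surj[OF Q(1)] True Q(2) by blast
      then show ?thesis
        using g *[of Q A B] Q by (auto simp: tderiv_body_proj body_proj_def)
    qed
  qed
qed

lemma tderiv_scaled_curvature_form:
  assumes Y: "vector_field S2 Y" and Z: "vector_field S2 Z" and x: "x \<in> S2"
    and a: "a \<in> tangent_space S2 x"
  shows "tderiv S2 (\<lambda>y. k * curvature_form y (Y y) (Z y)) x a =
    k * (curvature x * (x \<bullet> (cross3 (Y x) (fderiv (\<lambda>y. Z (normalize3 y)) x a)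
        + cross3 (fderiv (\<lambda>y. Y (normalize3 y)) x a) (Z x)) + a \<bullet> cross3 (Y x) (Z x))
      + fderiv curvature x a * (x \<bullet> cross3 (Y x) (Z x)))"
proof (rule tderiv_eqI[OF a open_nonzero S2.N_in_U[OF x]])
  have YZ: "smooth_on (- {0}) (\<lambda>y. Y (normalize3 y))" "smooth_on (- {0}) (\<lambda>y. Z (normalize3 y))"
    using Y Z by (auto simp: vector_field_def S2.smooth_map_iff)
  note D = smooth_on_has_derivative[OF _ S2.N_in_U[OF x]]
  show "((\<lambda>y. k * (curvature y * (y \<bullet> cross3 (Y (normalize3 y)) (Z (normalize3 y))))) has_derivative
    (\<lambda>a. k * (curvature x * (x \<bullet> (cross3 (Y x) (fderiv (\<lambda>y. Z (normalize3 y)) x a)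
        + cross3 (fderiv (\<lambda>y. Y (normalize3 y)) x a) (Z x)) + a \<bullet> cross3 (Y x) (Z x))
      + fderiv curvature x a * (x \<bullet> cross3 (Y x) (Z x))))) (at x)"
    using has_derivative_mult_right[OF has_derivative_mult[OF D[OF smooth_on_curvature]
        has_derivative_inner[OF has_derivative_ident
          bounded_bilinear.FDERIV[OF bounded_bilinear_cross3 D[OF YZ(1)] D[OF YZ(2)]]]], of k]
    unfolding S2.r_fix[OF x] .
  show "k * curvature_form y (Y y) (Z y) = k * (curvature y * (y \<bullet> cross3 (Y (normalize3 y)) (Z (normalize3 y))))"
    if "y \<in> S2" for y
    using that Y Z by (simp add: curvature_form_def S2.r_fix vector_field_def)
qed

lemma scalar_triple_tangent:
  assumes "x \<in> S2" "x \<bullet> a = 0" "x \<bullet> b = 0" "x \<bullet> c = 0"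
  shows "a \<bullet> cross3 b c = 0"
    and "(x \<bullet> cross3 b c) *\<^sub>R a - (x \<bullet> cross3 a c) *\<^sub>R b + (x \<bullet> cross3 a b) *\<^sub>R c = 0"
proof -
  have "(a \<bullet> cross3 b c) *\<^sub>R x =
      (x \<bullet> a) *\<^sub>R cross3 b c + (x \<bullet> b) *\<^sub>R cross3 c a + (x \<bullet> c) *\<^sub>R cross3 a b"
    by (simp add: vec_eq_iff forall_3 cross3_nth inner3 algebra_simps)
  moreover have "x \<noteq> 0" using assms(1) by (auto simp: S2_iff)
  ultimately show 1: "a \<bullet> cross3 b c = 0" using assms by simp
  have "(x \<bullet> cross3 b c) *\<^sub>R a - (x \<bullet> cross3 a c) *\<^sub>R b + (x \<bullet> cross3 a b) *\<^sub>R c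
      = (a \<bullet> cross3 b c) *\<^sub>R x"
    by (simp add: vec_eq_iff forall_3 cross3_nth inner3 algebra_simps)
  then show "(x \<bullet> cross3 b c) *\<^sub>R a - (x \<bullet> cross3 a c) *\<^sub>R b + (x \<bullet> cross3 a b) *\<^sub>R c = 0"
    using 1 by simp
qed

text \<open>
  Closedness is a matter of dimension: three vectors orthogonal to \<open>x\<close> are linearly dependent, and
  the terms with derivatives of the fields cancel against the Lie brackets.
\<close>

lemma closed_scaled_curvature_form: "closed_form S2 (\<lambda>x a b. k * curvature_form x a b)"
  unfolding closed_form_def
proof (intro allI impI ballI, elim conjE)
  fix X Y Z x
  assume X: "vector_field S2 X" and Y: "vector_field S2 Y" and Z: "vector_field S2 Z" and x: "x \<in> S2"
  have T: "X x \<in> tangent_space S2 x" "Y x \<in> tangent_space S2 x" "Z x \<in> tangent_space S2 x"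
    using X Y Z x by (auto simp: vector_field_def)
  then have o: "x \<bullet> X x = 0" "x \<bullet> Y x = 0" "x \<bullet> Z x = 0"
    using tangent_space_S2[OF x] by auto
  note B = S2.lie_bracket_tangent[OF X Y x] S2.lie_bracket_tangent[OF X Z x]
    S2.lie_bracket_tangent[OF Y Z x]
  note E = S2.lie_bracket_eq[OF X Y x] S2.lie_bracket_eq[OF X Z x] S2.lie_bracket_eq[OF Y Z x]
  define a where "a = X x"
  define b where "b = Y x"
  define c where "c = Z x"
  define dX where "dX = fderiv (\<lambda>y. X (normalize3 y)) x"
  define dY where "dY = fderiv (\<lambda>y. Y (normalize3 y)) x"
  define dZ where "dZ = fderiv (\<lambda>y. Z (normalize3 y)) x"
  note defs = a_def[symmetric] b_def[symmetric] c_def[symmetric] dX_def[symmetric] dY_def[symmetric]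
    dZ_def[symmetric]
  have lin: "linear (fderiv curvature x)"
    by (rule linear_fderiv[OF smooth_on_differentiable[OF smooth_on_curvature S2.N_in_U[OF x]]])
  have "fderiv curvature x ((x \<bullet> cross3 b c) *\<^sub>R a - (x \<bullet> cross3 a c) *\<^sub>R b + (x \<bullet> cross3 a b) *\<^sub>R c) = 0"
    using scalar_triple_tangent(2)[OF x o] linear_0[OF lin] by (simp add: defs)
  then have 1: "(x \<bullet> cross3 b c) * fderiv curvature x a - (x \<bullet> cross3 a c) * fderiv curvature x b
      + (x \<bullet> cross3 a b) * fderiv curvature x c = 0"
    by (simp add: linear_add[OF lin] linear_diff[OF lin] linear_scale[OF lin])
  have 2: "a \<bullet> cross3 b c = 0" "b \<bullet> cross3 a c = 0" "c \<bullet> cross3 a b = 0"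
    unfolding a_def b_def c_def using scalar_triple_tangent(1)[OF x] o by blast+
  have s: "cross3 b (dZ a) = - cross3 (dZ a) b" "cross3 a (dZ b) = - cross3 (dZ b) a"
    "cross3 a (dY c) = - cross3 (dY c) a"
    by (rule cross_skew)+
  have "tderiv S2 (\<lambda>y. k * curvature_form y (Y y) (Z y)) x (X x)
       - tderiv S2 (\<lambda>y. k * curvature_form y (X y) (Z y)) x (Y x)
       + tderiv S2 (\<lambda>y. k * curvature_form y (X y) (Y y)) x (Z x)
       - k * curvature_form x (lie_bracket S2 X Y x) (Z x)
       + k * curvature_form x (lie_bracket S2 X Z x) (Y x)
       - k * curvature_form x (lie_bracket S2 Y Z x) (X x)
     = k * ((x \<bullet> cross3 b c) * fderiv curvature x a - (x \<bullet> cross3 a c) * fderiv curvature x b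
      + (x \<bullet> cross3 a b) * fderiv curvature x c)"
    unfolding tderiv_scaled_curvature_form[OF Y Z x T(1)] tderiv_scaled_curvature_form[OF X Z x T(2)]
      tderiv_scaled_curvature_form[OF X Y x T(3)]
    using x T B
    by (simp add: curvature_form_def) (simp add: E defs 2 s bounded_bilinear.diff_left[OF bounded_bilinear_cross3] inner_add_right
        inner_diff_right algebra_simps)
  also have "\<dots> = 0" unfolding 1 by simp
  finally show "tderiv S2 (\<lambda>y. k * curvature_form y (Y y) (Z y)) x (X x)
       - tderiv S2 (\<lambda>y. k * curvature_form y (X y) (Z y)) x (Y x)
       + tderiv S2 (\<lambda>y. k * curvature_form y (X y) (Y y)) x (Z x)
       - k * curvature_form x (lie_bracket S2 X Y x) (Z x)
       + k * curvature_form x (lie_bracket S2 X Z x) (Y x)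
       - k * curvature_form x (lie_bracket S2 Y Z x) (X x) = 0" .
qed

end

section \<open>The motions of the body and of the reduced system\<close>

lemma natural_dynamics_iff_gyroscopic:
  "natural_dynamics M m V X \<longleftrightarrow> gyroscopic_dynamics M m V (\<lambda>_ _ _. 0) X"
  by (simp add: gyroscopic_dynamics_def natural_dynamics_def)

locale axisymmetric_body = rigid_body +
  fixes Vt :: "real^3 \<Rightarrow> real" and k :: real
  assumes smooth_Vt: "smooth_map S2 Vt"
begin

definition Vt_ext :: "real^3 \<Rightarrow> real" where
  "Vt_ext x = Vt (normalize3 x)"

lemma Vt_ext_S2: "x \<in> S2 \<Longrightarrow> Vt_ext x = Vt x"
  by (simp add: Vt_ext_def S2.r_fix)

lemma smooth_on_Vt_ext: "smooth_on (- {0}) Vt_ext"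
  using smooth_Vt unfolding Vt_ext_def[abs_def] S2.smooth_map_iff .

definition grad :: "real^3 \<Rightarrow> real^3" where
  "grad x = (\<Sum>b\<in>Basis. fderiv Vt_ext x b *\<^sub>R b)"

lemma grad_inner:
  assumes "x \<noteq> 0"
  shows "fderiv Vt_ext x a = grad x \<bullet> a"
proof -
  have "Vt_ext differentiable (at x)"
    using assms by (intro smooth_on_differentiable[OF smooth_on_Vt_ext]) simp
  from fderiv_basis_expansion[OF this, of a] show ?thesis
    by (simp add: grad_def inner_sum_left mult.commute inner_commute[of a])
qed

lemma smooth_on_grad: "smooth_on (- {0}) grad"
  unfolding grad_def[abs_def]
  by (intro smooth_on_sum smooth_on_scaleR smooth_on_fderiv smooth_on_Vt_ext smooth_on_const open_nonzero)

definition ang_mom_inv :: "real^3 \<Rightarrow> real^3" where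
  "ang_mom_inv w = vector [w$1 / I1, w$2 / I2, w$3 / I3]"

lemma ang_mom_ang_mom_inv: "ang_mom (ang_mom_inv w) = w"
  using I_pos by (simp add: ang_mom_inv_def vec_eq_iff forall_3 ang_mom_nth)

text \<open>Euler's equations with the torque of the potential.\<close>

definition ang_acc :: "real^3 \<Rightarrow> real^3 \<Rightarrow> real^3" where
  "ang_acc x w = ang_mom_inv (cross3 (ang_mom w) w + cross3 x (grad x))"

definition body_flow :: "(real^3^3) \<times> (real^3^3) \<Rightarrow> (real^3^3) \<times> (real^3^3)" where
  "body_flow w = (let \<omega> = body_vec (fst w) (snd w) in
    (snd w, snd w ** hat \<omega> + fst w ** hat (ang_acc (row 1 (fst w)) \<omega>)))"

definition red_flow :: "(real^3) \<times> (real^3) \<Rightarrow> (real^3) \<times> (real^3)" where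
  "red_flow w = (let \<omega> = ang_vel k (fst w) (snd w) in
    (snd w, cross3 (snd w) \<omega> + cross3 (fst w) (ang_acc (fst w) \<omega>)))"

abbreviation J :: "real \<Rightarrow> ((real^3^3) \<times> (real^3^3)) set" where
  "J c \<equiv> momentum_level SO3 bm body_field c"

lemma J_iff: "w \<in> J c \<longleftrightarrow> fst w \<in> SO3 \<and> (\<exists>\<omega>. snd w = fst w ** hat \<omega> \<and> ang_mom (row 1 (fst w)) \<bullet> \<omega> = c)"
  using momentum_level_iff[of "fst w" "snd w"] by simp

lemma J_subset: "J c \<subseteq> tangent_bundle SO3"
  by (auto simp: momentum_level_def)

lemma tangent_bundle_SO3_J:
  assumes "w \<in> tangent_bundle SO3"
  obtains c where "w \<in> J c"
  using assms by (auto simp: momentum_level_def)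

lemma body_flow_hat:
  "Q \<in> SO3 \<Longrightarrow> body_flow (Q, Q ** hat \<omega>) =
    (Q ** hat \<omega>, Q ** hat \<omega> ** hat \<omega> + Q ** hat (ang_acc (row 1 Q) \<omega>))"
  by (simp add: body_flow_def body_vec_hat)

text \<open>
  The condition says that the momentum is stationary.  Along the curve the angular velocity is
  corrected by a multiple of the first row of the rotation, so as to keep the momentum constant;
  the correction vanishes to second order.
\<close>

lemma tangent_J:
  assumes Q: "Q \<in> SO3" and c: "ang_mom (row 1 Q) \<bullet> \<omega> = c"
    and stat: "ang_mom (cross3 (row 1 Q) a) \<bullet> \<omega> + ang_mom (row 1 Q) \<bullet> \<omega>' = 0"
  shows "(Q ** hat a, Q ** hat a ** hat \<omega> + Q ** hat \<omega>') \<in> tangent_space (J c) (Q, Q ** hat \<omega>)"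
proof -
  obtain \<gamma> e where e: "e > 0" "smooth_on {-e<..<e} \<gamma>" "\<gamma> ` {-e<..<e} \<subseteq> SO3" and \<gamma>0: "\<gamma> 0 = Q"
    and d: "(\<gamma> has_vector_derivative Q ** hat a) (at 0)"
    using curve_at_rodrigues[OF Q, of a] unfolding curve_at_def by blast
  define x where "x t = row 1 (\<gamma> t)" for t
  define s where "s t = (c - ang_mom (x t) \<bullet> (\<omega> + t *\<^sub>R \<omega>')) / axis_moment (x t)" for t
  define \<delta> where "\<delta> t = (\<gamma> t, \<gamma> t ** hat (\<omega> + t *\<^sub>R \<omega>' + s t *\<^sub>R x t))" for t
  have \<gamma>S: "\<gamma> t \<in> SO3" if "t \<in> {-e<..<e}" for t using e(3) that by blast
  have pos: "axis_moment (x t) > 0" if "t \<in> {-e<..<e}" for t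
    unfolding x_def by (rule SO3_moment[OF \<gamma>S[OF that]])
  have "smooth_on {-e<..<e} \<delta>"
    unfolding \<delta>_def[abs_def] s_def x_def
    by (intro smooth_on_Pair smooth_on_matrix_mult smooth_on_hat smooth_on_add smooth_on_scaleR
        smooth_on_divide smooth_on_diff smooth_on_inner smooth_on_ang_mom smooth_on_row
        smooth_on_axis_moment smooth_on_const smooth_on_id e open_greaterThanLessThan)
      (use pos in \<open>force simp: x_def\<close>)
  moreover have "\<delta> t \<in> J c" if "t \<in> {-e<..<e}" for t
    using pos[OF that] \<gamma>S[OF that]
    by (auto simp: J_iff \<delta>_def s_def x_def[symmetric] inner_simps axis_moment_def[symmetric]
        intro!: exI[of _ "\<omega> + t *\<^sub>R \<omega>' + s t *\<^sub>R x t"])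
  moreover have "\<delta> 0 = (Q, Q ** hat \<omega>)"
    using c by (simp add: \<delta>_def s_def x_def \<gamma>0)
  moreover have "(\<delta> has_vector_derivative (Q ** hat a, Q ** hat a ** hat \<omega> + Q ** hat \<omega>')) (at 0)"
  proof -
    have x: "(x has_vector_derivative cross3 (row 1 Q) a) (at 0)"
      using bounded_linear.has_vector_derivative[OF bounded_linear_row d, of 1]
      by (simp add: x_def[abs_def] row_mult_hat)
    have x0: "x 0 = row 1 Q" by (simp add: x_def \<gamma>0)
    have l: "((\<lambda>t. \<omega> + t *\<^sub>R \<omega>') has_vector_derivative \<omega>') (at 0)"
      by (auto intro!: derivative_eq_intros simp: has_vector_derivative_def)
    note Lx = bounded_linear.has_vector_derivative[OF bounded_linear_ang_mom x]
    have "((\<lambda>t. ang_mom (x t) \<bullet> (\<omega> + t *\<^sub>R \<omega>')) has_vector_derivative 0) (at 0)"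
      using bounded_bilinear.has_vector_derivative[OF bounded_bilinear_inner Lx l] stat
      by (simp add: x0 add.commute)
    then have n: "((\<lambda>t. c - ang_mom (x t) \<bullet> (\<omega> + t *\<^sub>R \<omega>')) has_real_derivative 0) (at 0)"
      unfolding has_real_derivative_iff_has_vector_derivative
      using has_vector_derivative_diff[OF has_vector_derivative_const] by fastforce
    obtain m where m: "((\<lambda>t. axis_moment (x t)) has_real_derivative m) (at 0)"
      unfolding has_real_derivative_iff_has_vector_derivative axis_moment_def
      using bounded_bilinear.has_vector_derivative[OF bounded_bilinear_inner Lx x] by blast
    have "(s has_real_derivative 0) (at 0)"
      using DERIV_divide[OF n m] pos[of 0] e(1) c by (simp add: s_def[abs_def] x0)
    then have s: "((\<lambda>t. s t *\<^sub>R x t) has_vector_derivative 0) (at 0)"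
      using has_vector_derivative_scaleR[OF _ x, of s 0] c by (simp add: s_def x0)
    have "((\<lambda>t. \<gamma> t ** hat (\<omega> + t *\<^sub>R \<omega>' + s t *\<^sub>R x t)) has_vector_derivative
        \<gamma> 0 ** hat (\<omega>' + 0) + (Q ** hat a) ** hat (\<omega> + 0 *\<^sub>R \<omega>' + s 0 *\<^sub>R x 0)) (at 0)"
      by (rule bounded_bilinear.has_vector_derivative[OF bounded_bilinear_matrix_mult d
            bounded_linear.has_vector_derivative[OF bounded_linear_hat
              has_vector_derivative_add[OF l s]]])
    from has_vector_derivative_Pair[OF d this] show ?thesis
      using c by (simp add: \<delta>_def[abs_def] \<gamma>0 s_def x0 add.commute)
  qed
  ultimately have "curve_at (J c) (Q, Q ** hat \<omega>)
      (Q ** hat a, Q ** hat a ** hat \<omega> + Q ** hat \<omega>') \<delta>"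
    unfolding curve_at_def using e(1) by blast
  then show ?thesis by (rule curve_at_imp_tangent)
qed

text \<open>
  Noether's theorem: the torque of a function of \<open>x\<close> has no component along \<open>x\<close>, and the gyroscopic
  term compensates the change of \<open>x\<close> relative to the body.
\<close>

lemma body_flow_tangent_J:
  assumes "w \<in> J c"
  shows "body_flow w \<in> tangent_space (J c) w"
proof -
  obtain Q \<omega> where w: "w = (Q, Q ** hat \<omega>)" and Q: "Q \<in> SO3" and c: "ang_mom (row 1 Q) \<bullet> \<omega> = c"
    using assms by (metis J_iff prod.collapse)
  have "ang_mom (row 1 Q) \<bullet> ang_acc (row 1 Q) \<omega> = (cross3 (ang_mom \<omega>) \<omega> + cross3 (row 1 Q) (grad (row 1 Q))) \<bullet> row 1 Q"
    unfolding ang_mom_sym[of "row 1 Q"] ang_acc_def ang_mom_ang_mom_inv ..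
  moreover have "ang_mom (cross3 x \<omega>) \<bullet> \<omega> + (cross3 (ang_mom \<omega>) \<omega> + cross3 x g) \<bullet> x = 0" for x g
    by (simp add: inner3 ang_mom_nth cross3_nth algebra_simps)
  ultimately show ?thesis
    unfolding w body_flow_hat[OF Q] by (intro tangent_J[OF Q c]) simp
qed

text \<open>
  The retraction to the level \<open>k\<close> adds a multiple of the generator of the symmetry, which has spin
  \<open>x\<close>, to the velocity.  This leaves the motion of \<open>x\<close> unchanged.
\<close>

definition J_retraction :: "(real^3^3) \<times> (real^3^3) \<Rightarrow> (real^3^3) \<times> (real^3^3)" where
  "J_retraction w = (let Q = gram_schmidt (fst w); \<omega> = body_vec Q (snd w); x = row 1 Q in
    (Q, Q ** hat (\<omega> + ((k - ang_mom x \<bullet> \<omega>) / axis_moment x) *\<^sub>R x)))"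

lemma smooth_retract_J: "smooth_retract (J k) (SO3_nbhd \<times> UNIV) J_retraction"
proof
  note op = SO3.open_times_UNIV
  show "open (SO3_nbhd \<times> (UNIV :: (real^3^3) set))" by (rule op)
  have g: "smooth_on (SO3_nbhd \<times> UNIV) (\<lambda>w :: (real^3^3) \<times> (real^3^3). gram_schmidt (fst w))"
    by (rule smooth_on_compose[OF op SO3.open_U _ SO3.smooth_r])
      (auto intro!: smooth_on_fst smooth_on_id op)
  have pos: "axis_moment (row 1 (gram_schmidt (fst w))) > 0"
    if "w \<in> SO3_nbhd \<times> (UNIV :: (real^3^3) set)" for w
    using that SO3.r_in SO3_moment by auto
  show "smooth_on (SO3_nbhd \<times> UNIV) J_retraction"
    unfolding J_retraction_def Let_def
    by (intro smooth_on_Pair smooth_on_matrix_mult smooth_on_hat smooth_on_add smooth_on_scaleR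
        smooth_on_divide smooth_on_diff smooth_on_inner smooth_on_ang_mom smooth_on_row smooth_on_body_vec
        smooth_on_axis_moment smooth_on_const smooth_on_id smooth_on_snd g op)
      (use pos in force)
  show "J k \<subseteq> SO3_nbhd \<times> UNIV" using SO3.N_sub by (auto simp: J_iff)
  show "J_retraction w \<in> J k" if w: "w \<in> SO3_nbhd \<times> UNIV" for w
    using pos[OF w] w SO3.r_in
    by (auto simp: J_iff J_retraction_def Let_def inner_simps axis_moment_def[symmetric])
  show "J_retraction w = w" if "w \<in> J k" for w
    using that by (cases w) (auto simp: J_iff J_retraction_def Let_def SO3.r_fix body_vec_hat)
qed

lemma body_energy_derivative:
  assumes w: "w \<in> tangent_bundle SO3"
  shows "((\<lambda>w. body_form (fst w) (snd w) (snd w) / 2 + Vt_ext (row 1 (fst w))) has_derivative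
    (\<lambda>Z. ang_mom (body_vec (fst w) (snd w)) \<bullet> (body_vec (fst w) (snd Z) + body_vec (fst Z) (snd w))
      + grad (row 1 (fst w)) \<bullet> row 1 (fst Z))) (at w)"
proof -
  have Q: "fst w \<in> SO3" using w by (simp add: SO3.tangent_bundle_iff)
  then have ne: "row 1 (fst w) \<noteq> 0" using SO3_D(5) by force
  have f: "(fst has_derivative fst) (at w)" "(snd has_derivative snd) (at w)"
    by (simp_all add: bounded_linear_imp_has_derivative bounded_linear_fst bounded_linear_snd)
  have b: "((\<lambda>w. body_vec (fst w) (snd w)) has_derivative
      (\<lambda>Z. body_vec (fst w) (snd Z) + body_vec (fst Z) (snd w))) (at w)"
    by (rule bounded_bilinear.FDERIV[OF bounded_bilinear_body_vec f])
  have V: "((\<lambda>w. Vt_ext (row 1 (fst w))) has_derivative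
      (\<lambda>Z. fderiv Vt_ext (row 1 (fst w)) (row 1 (fst Z)))) (at w)"
    using ne
    by (intro has_derivative_compose[OF bounded_linear.has_derivative[OF bounded_linear_row f(1)]]
        smooth_on_has_derivative[OF smooth_on_Vt_ext]) simp
  show ?thesis
    unfolding body_form_def
    by (rule has_derivative_eq_rhs[OF has_derivative_add[OF bounded_linear.has_derivative[OF bounded_linear_divide[of 2]
        has_derivative_inner[OF bounded_linear.has_derivative[OF bounded_linear_ang_mom b] b]] V]])
      (simp add: fun_eq_iff ang_mom_sym[of "_ + _"] grad_inner[OF ne])
qed

lemma tderiv_body_energy:
  assumes w: "w \<in> tangent_bundle SO3" and N: "N \<subseteq> tangent_bundle SO3"
    and Z: "Z \<in> tangent_space N w"
  shows "tderiv N (energy bm (Vt \<circ> body_proj)) w Z =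
    ang_mom (body_vec (fst w) (snd w)) \<bullet> (body_vec (fst w) (snd Z) + body_vec (fst Z) (snd w))
      + grad (row 1 (fst w)) \<bullet> row 1 (fst Z)"
proof (rule tderiv_eqI[OF Z open_UNIV UNIV_I body_energy_derivative[OF w]])
  fix y assume "y \<in> N"
  then have "fst y \<in> SO3" using N by (auto simp: SO3.tangent_bundle_iff)
  then show "energy bm (Vt \<circ> body_proj) y = body_form (fst y) (snd y) (snd y) / 2 + Vt_ext (row 1 (fst y))"
    by (simp add: energy_def body_metric_eq Vt_ext_S2 row_SO3_in_S2 body_proj_def)
qed

lemma fderiv_body_form:
  "fderiv (\<lambda>y. body_form y A B) Q C =
    ang_mom (body_vec Q A) \<bullet> body_vec C B + ang_mom (body_vec C A) \<bullet> body_vec Q B"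
proof -
  have b: "((\<lambda>Q. body_vec Q A) has_derivative (\<lambda>C. body_vec C A)) (at Q)" for A
    by (intro bounded_linear_imp_has_derivative
        bounded_bilinear.bounded_linear_left[OF bounded_bilinear_body_vec])
  show ?thesis
    unfolding body_form_def
    using fderiv_eqI[OF has_derivative_inner[OF bounded_linear.has_derivative[OF bounded_linear_ang_mom b] b]]
    by simp
qed

text \<open>
  The velocity component of the test vector enters the Lagrange form and the energy with opposite
  signs and drops out.  What remains is Euler's equation, paired with the spin of the base component
  of the test vector.
\<close>

lemma body_flow_equation:
  assumes w: "w \<in> tangent_bundle SO3" and Z: "Z \<in> tangent_space (tangent_bundle SO3) w"
  shows "ambient_ext_deriv B.lform w (body_flow w) Z =
    - tderiv (tangent_bundle SO3) (energy bm (Vt \<circ> body_proj)) w Z"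
proof -
  obtain Q \<omega> where wQ: "w = (Q, Q ** hat \<omega>)" and Q: "Q \<in> SO3"
    using w by (metis SO3.tangent_bundle_iff prod.collapse tangent_space_SO3)
  obtain b B' where ZB: "Z = (Q ** hat b, B')"
    using SO3.fst_tangent[OF Z] wQ Q by (metis fst_conv prod.collapse tangent_space_SO3)
  let ?x = "row 1 Q"
  let ?A = "Q ** hat \<omega>" and ?B = "Q ** hat b" and ?\<omega>' = "ang_acc (row 1 Q) \<omega>"
  have QU: "fst w \<in> SO3_nbhd" using SO3.N_in_U[OF Q] wQ by simp
  have c: "ang_mom \<omega> \<bullet> body_vec ?A ?B = ang_mom \<omega> \<bullet> body_vec ?B ?A - ang_mom \<omega> \<bullet> cross3 \<omega> b"
  proof -
    have "ang_mom \<omega> \<bullet> (body_vec ?A ?B - body_vec ?B ?A) = - (ang_mom \<omega> \<bullet> cross3 \<omega> b)"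
      unfolding body_vec_commutator[OF Q] by simp
    then show ?thesis unfolding inner_diff_right by linarith
  qed
  have q: "body_vec Q (?A ** hat \<omega>) = so3_vec (hat \<omega> ** hat \<omega>)"
    using SO3_D(1)[OF Q] by (simp add: body_vec_def matrix_mul_assoc)
  have "ambient_ext_deriv B.lform w (body_flow w) Z =
     ang_mom \<omega> \<bullet> body_vec ?A ?B + ang_mom (body_vec ?A ?A) \<bullet> b
     + ang_mom (body_vec Q (?A ** hat \<omega>) + ?\<omega>') \<bullet> b
     - (ang_mom \<omega> \<bullet> body_vec ?B ?A + ang_mom (body_vec ?B ?A) \<bullet> \<omega>) - ang_mom (body_vec Q B') \<bullet> \<omega>"
    unfolding B.ambient_lform_eq[OF QU] fderiv_body_form unfolding wQ ZB body_flow_hat[OF Q]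
    by (simp add: body_form_def body_vec_hat[OF Q] bounded_bilinear.add_right[OF bounded_bilinear_body_vec])
  also have "\<dots> = ang_mom ?\<omega>' \<bullet> b - ang_mom \<omega> \<bullet> cross3 \<omega> b - ang_mom \<omega> \<bullet> (body_vec Q B' + body_vec ?B ?A)"
    unfolding c q body_vec_hat_hat[OF Q, of \<omega> \<omega>]
    by (simp add: ang_mom_simps linear_neg[OF linear_ang_mom] inner_simps ang_mom_sym[of _ \<omega>])
  also have "ang_mom ?\<omega>' \<bullet> b - ang_mom \<omega> \<bullet> cross3 \<omega> b = - (grad ?x \<bullet> row 1 ?B)"
    unfolding ang_acc_def ang_mom_ang_mom_inv row_mult_hat
    by (simp add: inner3 cross3_nth algebra_simps)
  finally show ?thesis
    unfolding tderiv_body_energy[OF w order_refl Z] unfolding wQ ZB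
    by (simp add: body_vec_hat[OF Q])
qed

lemma smooth_on_ang_mom_inv: "open U \<Longrightarrow> smooth_on U f \<Longrightarrow> smooth_on U (\<lambda>x. ang_mom_inv (f x))"
  unfolding ang_mom_inv_def
  by (intro smooth_on_vector3 smooth_on_divide smooth_on_nth smooth_on_const) (use I_pos in auto)

lemma smooth_on_ang_acc:
  assumes "open U" "smooth_on U f" "smooth_on U h" "\<And>y. y \<in> U \<Longrightarrow> f y \<noteq> 0"
  shows "smooth_on U (\<lambda>y. ang_acc (f y) (h y))"
proof -
  have "smooth_on U (\<lambda>y. grad (f y))"
    by (rule smooth_on_compose[OF assms(1) open_nonzero assms(2) smooth_on_grad]) (use assms(4) in auto)
  then show ?thesis
    unfolding ang_acc_def
    by (intro smooth_on_ang_mom_inv smooth_on_add smooth_on_cross3 smooth_on_ang_mom assms)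
qed

lemma smooth_on_ang_vel:
  assumes "open U" "smooth_on U f" "smooth_on U h" "\<And>y. y \<in> U \<Longrightarrow> f y \<noteq> 0"
  shows "smooth_on U (\<lambda>y. ang_vel k (f y) (h y))"
  unfolding ang_vel_def
  by (intro smooth_on_add smooth_on_cross3 smooth_on_scaleR smooth_on_divide smooth_on_diff
      smooth_on_inner smooth_on_ang_mom smooth_on_axis_moment smooth_on_const assms)
    (use axis_moment_pos[OF assms(4)] in force)

lemma body_flow_dynamics:
  "natural_dynamics SO3 bm (Vt \<circ> body_proj) (restrict body_flow (tangent_bundle SO3))"
proof -
  note op = SO3.open_times_UNIV
  have ne: "row 1 (fst w) \<noteq> 0" if "w \<in> SO3_nbhd \<times> (UNIV :: (real^3^3) set)" for w
    using that by (auto simp: SO3_nbhd_def)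
  have "smooth_on (SO3_nbhd \<times> UNIV) body_flow"
    unfolding body_flow_def[abs_def] Let_def
    by (intro smooth_on_Pair smooth_on_matrix_mult smooth_on_add smooth_on_hat smooth_on_body_vec
        smooth_on_ang_acc smooth_on_row smooth_on_fst smooth_on_snd smooth_on_id op ne)
  then have sm: "smooth_map (tangent_bundle SO3) (restrict body_flow (tangent_bundle SO3))"
    by (rule smooth_retract.smooth_mapI[OF SO3.smooth_retract_tangent_bundle]) simp
  have T: "body_flow w \<in> tangent_space (tangent_bundle SO3) w" if w: "w \<in> tangent_bundle SO3" for w
  proof -
    obtain c where "w \<in> J c" using tangent_bundle_SO3_J[OF w] .
    from body_flow_tangent_J[OF this] show ?thesis using tangent_space_mono[OF J_subset] by blast
  qed
  have "gyroscopic_dynamics SO3 bm (Vt \<circ> body_proj) (\<lambda>_ _ _. 0)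
      (restrict body_flow (tangent_bundle SO3))"
    unfolding B.gyroscopic_dynamics_iff vector_field_def
    using sm T body_flow_equation by simp
  then show ?thesis
    by (simp only: natural_dynamics_iff_gyroscopic)
qed

lemma natural_dynamics_unique:
  assumes "natural_dynamics SO3 bm (Vt \<circ> body_proj) X"
  shows "X = restrict body_flow (tangent_bundle SO3)"
  using assms body_flow_dynamics unfolding natural_dynamics_iff_gyroscopic
  by (rule B.gyroscopic_dynamics_unique) simp

section \<open>Reduction\<close>

definition \<rho> :: "(real^3^3) \<times> (real^3^3) \<Rightarrow> (real^3) \<times> (real^3)" where
  "\<rho> w = (row 1 (fst w), row 1 (snd w))"

lemma bounded_linear_\<rho>: "bounded_linear \<rho>"
  unfolding \<rho>_def[abs_def]
  by (intro bounded_linear_Pair bounded_linear_compose[OF bounded_linear_row]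
      bounded_linear_fst bounded_linear_snd)

lemma \<rho>_tangent_bundle: "w \<in> tangent_bundle SO3 \<Longrightarrow> \<rho> w \<in> tangent_bundle S2"
  by (auto simp: \<rho>_def SO3.tangent_bundle_iff S2.tangent_bundle_iff row_SO3_in_S2 row_tangent)

lemma \<rho>_body_flow:
  assumes "w \<in> J k"
  shows "\<rho> (body_flow w) = red_flow (\<rho> w)"
proof -
  obtain Q \<omega> where w: "w = (Q, Q ** hat \<omega>)" and Q: "Q \<in> SO3" and c: "ang_mom (row 1 Q) \<bullet> \<omega> = k"
    using assms by (metis J_iff prod.collapse)
  have "ang_vel k (row 1 Q) (cross3 (row 1 Q) \<omega>) = \<omega>"
    using ang_vel_unique[OF row_SO3_in_S2[OF Q], of \<omega>] c by simp
  then show ?thesis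
    unfolding w body_flow_hat[OF Q]
    by (simp add: \<rho>_def red_flow_def linear_add[OF linear_row] row_mult_hat)
qed

text \<open>
  Near a point of the sphere a rotation with first row \<open>x\<close> and an angular velocity are smooth
  functions of \<open>x\<close> and \<open>u\<close>.  This section of \<open>\<rho>\<close> over an open set lifts tangent vectors.
\<close>

lemma \<rho>_lift:
  assumes w: "w \<in> tangent_bundle S2"
  shows "\<exists>v\<in>J k. \<rho> v = w \<and>
    (\<forall>Z\<in>tangent_space (tangent_bundle S2) w. \<exists>Z'\<in>tangent_space (J k) v. \<rho> Z' = Z)"
proof -
  obtain x u where xu: "w = (x, u)" by fastforce
  then have x: "x \<in> S2" and u: "u \<in> tangent_space S2 x" using w by (auto simp: S2.tangent_bundle_iff)
  obtain Q where Q: "Q \<in> SO3" "row 1 Q = x" using SO3_row_surj[OF x] by blast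
  define M where "M y = (vector [y, row 2 Q, row 3 Q] :: real^3^3)" for y
  define W where "W = {y. cross3 y (row 2 Q) \<noteq> 0}"
  define s where "s w = (gram_schmidt (M (fst w)),
    gram_schmidt (M (fst w)) ** hat (ang_vel k (fst w) (snd w)))" for w
  have WM: "y \<in> W \<longleftrightarrow> M y \<in> SO3_nbhd" for y by (simp add: W_def M_def SO3_nbhd_def row_vector)
  have "open W"
  proof -
    have "W = (\<lambda>y. cross3 y (row 2 Q)) -` (- {0})" by (auto simp: W_def)
    moreover have "open \<dots>"
      by (intro open_vimage continuous_on_cross continuous_intros)
    ultimately show ?thesis by simp
  qed
  then have oW: "open (W \<times> (UNIV :: (real^3) set))" by (intro open_Times) auto
  have "M x = Q" using Q(2) by (auto simp: M_def vec_eq_iff forall_3 row_def)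
  then have wW: "w \<in> W \<times> UNIV" using SO3.N_in_U[OF Q(1)] WM xu by simp
  have g: "smooth_on (W \<times> UNIV) (\<lambda>w :: (real^3) \<times> (real^3). gram_schmidt (M (fst w)))"
  proof (rule smooth_on_compose[OF oW SO3.open_U _ SO3.smooth_r])
    show "smooth_on (W \<times> UNIV) (\<lambda>w :: (real^3) \<times> (real^3). M (fst w))"
      unfolding M_def
      by (rule smooth_on_vector3[OF oW smooth_on_fst[OF oW smooth_on_id] smooth_on_const
            smooth_on_const])
    show "(\<lambda>w :: (real^3) \<times> (real^3). M (fst w)) ` (W \<times> UNIV) \<subseteq> SO3_nbhd"
      by (rule image_subsetI) (simp add: WM[symmetric] mem_Times_iff)
  qed
  have sm: "smooth_on (W \<times> UNIV) s"
    unfolding s_def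
    by (intro smooth_on_Pair smooth_on_matrix_mult smooth_on_hat smooth_on_ang_vel g smooth_on_fst
        smooth_on_snd smooth_on_id oW) (auto simp: W_def)
  have s: "s y \<in> J k \<and> \<rho> (s y) = y" if y: "y \<in> tangent_bundle S2" "y \<in> W \<times> UNIV" for y
  proof -
    have y1: "fst y \<in> S2" "fst y \<bullet> snd y = 0"
      using y(1) by (auto simp: S2.tangent_bundle_iff tangent_space_S2)
    have G: "gram_schmidt (M (fst y)) \<in> SO3"
      using y(2) WM SO3.r_in by auto
    have R: "row 1 (gram_schmidt (M (fst y))) = fst y"
      using y1 by (simp add: gram_schmidt_def Let_def row_vector M_def S2_iff)
    show ?thesis
      using ang_vel_correct[OF y1] G R by (auto simp: s_def J_iff \<rho>_def row_mult_hat prod_eq_iff)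
  qed
  show ?thesis
  proof (rule bexI[of _ "s w"], intro conjI ballI)
    show "s w \<in> J k" "\<rho> (s w) = w" using s[OF w wW] by auto
    fix Z assume Z: "Z \<in> tangent_space (tangent_bundle S2) w"
    show "\<exists>Z'\<in>tangent_space (J k) (s w). \<rho> Z' = Z"
    proof (rule bexI[of _ "fderiv s w Z"])
      show "fderiv s w Z \<in> tangent_space (J k) (s w)"
        by (rule tangent_space_image[OF Z oW wW sm]) (use s in blast)
      have "\<rho> (fderiv s w Z) = tderiv (tangent_bundle S2) (\<lambda>y. \<rho> (s y)) w Z"
        by (rule tderiv_eqI[OF Z oW wW bounded_linear.has_derivative[OF bounded_linear_\<rho>
              smooth_on_has_derivative[OF sm wW]], symmetric]) simp
      also have "\<dots> = Z"
        by (rule tderiv_eqI[OF Z oW wW has_derivative_ident]) (use s in blast)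
      finally show "\<rho> (fderiv s w Z) = Z" .
    qed
  qed
qed

text \<open>
  By the orthogonal decomposition the Lagrange form of the body and the sum of the two pull-backs
  agree on tangent vectors of the level, which is a retract; hence so do their exterior derivatives.
\<close>

lemma lform_J_ext_deriv:
  assumes w: "w \<in> J k" and Z: "Z \<in> tangent_space (J k) w" and Z': "Z' \<in> tangent_space (J k) w"
  shows "ambient_ext_deriv B.lform w Z Z' = ambient_ext_deriv S.lform (\<rho> w) (\<rho> Z) (\<rho> Z')
    + k * ambient_ext_deriv connection (fst w) (fst Z) (fst Z')"
proof -
  define \<beta> where "\<beta> w Z = B.lform w Z - S.lform (\<rho> w) (\<rho> Z) - k * connection (fst w) (fst Z)" for w Z
  have Q: "fst w \<in> SO3" using w by (simp add: J_iff)
  have lin: "linear (\<beta> y)" for y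
    using bounded_linear.linear[OF bounded_linear_\<rho>]
    by (intro linearI) (simp_all add: \<beta>_def linear_add linear_scale B.linear_lform S.linear_lform
        linear_connection algebra_simps)
  have \<rho>U: "fst (\<rho> w) \<in> - {0}" using S2.N_in_U[OF row_SO3_in_S2[OF Q]] by (simp add: \<rho>_def)
  have D: "((\<lambda>w. \<beta> w V) has_derivative (\<lambda>Z. fderiv (\<lambda>w. B.lform w V) w Z
      - fderiv (\<lambda>y. S.lform y (\<rho> V)) (\<rho> w) (\<rho> Z)
      - k * fderiv (\<lambda>Q. connection Q (fst V)) (fst w) (fst Z))) (at w)" for V
    unfolding \<beta>_def
  proof (intro has_derivative_diff has_derivative_mult_right)
    show "((\<lambda>w. B.lform w V) has_derivative fderiv (\<lambda>w. B.lform w V) w) (at w)"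
      by (rule has_derivative_fderiv[OF B.lform_differentiable[OF SO3.N_in_U[OF Q]]])
    show "((\<lambda>w. S.lform (\<rho> w) (\<rho> V)) has_derivative
        (\<lambda>Z. fderiv (\<lambda>y. S.lform y (\<rho> V)) (\<rho> w) (\<rho> Z))) (at w)"
      by (rule has_derivative_compose[OF bounded_linear_imp_has_derivative[OF bounded_linear_\<rho>]
            has_derivative_fderiv[OF S.lform_differentiable[OF \<rho>U]]])
    have "(\<lambda>Q. connection Q (fst V)) differentiable (at (fst w))"
      using has_derivative_connection[OF SO3_moment[OF Q]] differentiable_def by blast
    then show "((\<lambda>w. connection (fst w) (fst V)) has_derivative
        (\<lambda>Z. fderiv (\<lambda>Q. connection Q (fst V)) (fst w) (fst Z))) (at w)"
      by (rule has_derivative_compose[OF bounded_linear_imp_has_derivative[OF bounded_linear_fst]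
            has_derivative_fderiv])
  qed
  have "ambient_ext_deriv \<beta> w Z Z' = 0"
  proof (rule smooth_retract.ambient_ext_deriv_zero_on[OF smooth_retract_J w Z Z' lin])
    show "(\<lambda>y. \<beta> y V) differentiable (at w)" for V
      using D differentiable_def by blast
    fix y V assume y: "y \<in> J k" and V: "V \<in> tangent_space (J k) y"
    obtain Q a where yQ: "y = (Q, Q ** hat a)" and Q: "Q \<in> SO3" and c: "ang_mom (row 1 Q) \<bullet> a = k"
      using y by (metis J_iff prod.collapse)
    have "fst V \<in> tangent_space SO3 Q"
      using SO3.fst_tangent[of V y] V tangent_space_mono[OF J_subset] yQ by auto
    then obtain b where b: "fst V = Q ** hat b" using tangent_SO3_E Q by blast
    show "\<beta> y V = 0"
      using inner_ang_mom_split[OF row_SO3_in_S2[OF Q], of a b]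
      by (simp add: \<beta>_def B.lform_def S.lform_def yQ b body_form_hat Q \<rho>_def row_mult_hat connection_def
          body_vec_hat c)
  qed
  then show ?thesis
    unfolding ambient_ext_deriv_def fderiv_eqI[OF D] by (simp add: algebra_simps)
qed

abbreviation Vk :: "real^3 \<Rightarrow> real" where
  "Vk \<equiv> reduced_potential SO3 bm (Vt \<circ> body_proj) body_field body_proj k"

lemma smooth_on_Vk: "smooth_on (- {0}) (\<lambda>x. Vt_ext x + k\<^sup>2 / (2 * axis_moment x))"
  by (intro smooth_on_add smooth_on_Vt_ext smooth_on_divide smooth_on_mult smooth_on_const
      smooth_on_axis_moment smooth_on_id open_nonzero) (use axis_moment_pos in force)

lemma Vk_eq: "x \<in> S2 \<Longrightarrow> Vk x = Vt_ext x + k\<^sup>2 / (2 * axis_moment x)"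
  by (simp add: reduced_potential_eq Vt_ext_S2)

text \<open>
  By the decomposition of the kinetic energy the reduced potential absorbs \<open>k\<^sup>2 / (2 * axis_moment x)\<close>.
\<close>

lemma energy_J:
  assumes w: "w \<in> J k"
  shows "energy bm (Vt \<circ> body_proj) w = energy mt Vk (\<rho> w)"
proof -
  obtain Q a where wQ: "w = (Q, Q ** hat a)" and Q: "Q \<in> SO3" and c: "ang_mom (row 1 Q) \<bullet> a = k"
    using w by (metis J_iff prod.collapse)
  note x = row_SO3_in_S2[OF Q]
  have T: "cross3 (row 1 Q) a \<in> tangent_space S2 (row 1 Q)"
    by (simp add: tangent_space_S2[OF x] dot_cross_self)
  show ?thesis
    using inner_ang_mom_split[OF x, of a a] S2_moment[OF x]
    by (simp add: energy_def wQ \<rho>_def body_metric_eq[OF Q] body_form_hat[OF Q] row_mult_hat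
        S.n_eq[OF x T T] reduced_potential_eq[OF x] c body_proj_def field_simps power2_eq_square)
qed

lemma tderiv_energy_J:
  assumes w: "w \<in> J k" and Z: "Z \<in> tangent_space (J k) w"
  shows "tderiv (tangent_bundle SO3) (energy bm (Vt \<circ> body_proj)) w Z =
    tderiv (tangent_bundle S2) (energy mt Vk) (\<rho> w) (\<rho> Z)"
proof -
  let ?E = "\<lambda>w. sphere_form (fst w) (snd w) (snd w) / 2 + (Vt_ext (fst w) + k\<^sup>2 / (2 * axis_moment (fst w)))"
  note op = S2.open_times_UNIV
  have "smooth_on ((- {0}) \<times> UNIV) ?E"
  proof (intro smooth_on_add)
    show "smooth_on ((- {0}) \<times> UNIV) (\<lambda>w :: (real^3) \<times> (real^3). sphere_form (fst w) (snd w) (snd w) / 2)"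
      unfolding sphere_form_def cofactor_form_def
      by (intro smooth_on_divide smooth_on_add smooth_on_mult smooth_on_nth smooth_on_const
          smooth_on_axis_moment smooth_on_id smooth_on_fst smooth_on_snd op)
        (use axis_moment_pos in force)+
    show "smooth_on ((- {0}) \<times> UNIV) (\<lambda>w :: (real^3) \<times> (real^3). Vt_ext (fst w))"
      by (rule smooth_on_compose[OF op open_nonzero _ smooth_on_Vt_ext])
        (auto intro!: smooth_on_fst smooth_on_id op)
    show "smooth_on ((- {0}) \<times> UNIV) (\<lambda>w :: (real^3) \<times> (real^3). k\<^sup>2 / (2 * axis_moment (fst w)))"
      by (intro smooth_on_divide smooth_on_mult smooth_on_const
          smooth_on_axis_moment smooth_on_id smooth_on_fst op) (use axis_moment_pos in force)
  qed (rule op)+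
  note sm = this
  have wT: "w \<in> tangent_bundle SO3" using w J_subset by blast
  then have \<rho>w: "\<rho> w \<in> tangent_bundle S2" by (rule \<rho>_tangent_bundle)
  have \<rho>U: "\<rho> w \<in> (- {0}) \<times> UNIV" using \<rho>w S2.N_in_U by (auto simp: S2.tangent_bundle_iff mem_Times_iff)
  note D = smooth_on_has_derivative[OF sm \<rho>U]
  have ZT: "Z \<in> tangent_space (tangent_bundle SO3) w"
    using Z tangent_space_mono[OF J_subset] by blast
  have \<rho>Z: "\<rho> Z \<in> tangent_space (tangent_bundle S2) (\<rho> w)"
    using tangent_space_image[OF ZT open_UNIV UNIV_I smooth_on_linear[OF bounded_linear_\<rho>]
        \<rho>_tangent_bundle]
      fderiv_eqI[OF bounded_linear_imp_has_derivative[OF bounded_linear_\<rho>]] by metis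
  have E: "energy mt Vk y = ?E y" if "y \<in> tangent_bundle S2" for y
    using that by (simp add: energy_def S2.tangent_bundle_iff S.n_eq Vk_eq)
  have "tderiv (tangent_bundle S2) (energy mt Vk) (\<rho> w) (\<rho> Z) = fderiv ?E (\<rho> w) (\<rho> Z)"
    by (rule tderiv_eqI[OF \<rho>Z open_UNIV UNIV_I D E])
  also have "\<dots> = tderiv (J k) (energy bm (Vt \<circ> body_proj)) w Z"
  proof (rule tderiv_eqI[OF Z open_UNIV UNIV_I, symmetric])
    show "((\<lambda>w. ?E (\<rho> w)) has_derivative (\<lambda>Z. fderiv ?E (\<rho> w) (\<rho> Z))) (at w)"
      by (rule has_derivative_compose[OF bounded_linear_imp_has_derivative[OF bounded_linear_\<rho>] D])
    show "energy bm (Vt \<circ> body_proj) y = ?E (\<rho> y)" if "y \<in> J k" for y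
      using energy_J[OF that] E \<rho>_tangent_bundle J_subset that by fastforce
  qed
  also have "\<dots> = tderiv (tangent_bundle SO3) (energy bm (Vt \<circ> body_proj)) w Z"
    by (simp only: tderiv_body_energy[OF wT J_subset Z] tderiv_body_energy[OF wT order_refl ZT])
  finally show ?thesis by simp
qed

abbreviation kg :: "real^3 \<Rightarrow> real^3 \<Rightarrow> real^3 \<Rightarrow> real" where
  "kg \<equiv> \<lambda>x a b. k * curvature_form x a b"

lemma red_flow_tangent:
  assumes "w \<in> tangent_bundle S2"
  shows "red_flow w \<in> tangent_space (tangent_bundle S2) w"
proof -
  obtain v where v: "v \<in> J k" "\<rho> v = w" using \<rho>_lift[OF assms] by blast
  have "fderiv \<rho> v (body_flow v) \<in> tangent_space (tangent_bundle S2) (\<rho> v)"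
    by (rule tangent_space_image[OF body_flow_tangent_J[OF v(1)] open_UNIV UNIV_I
          smooth_on_linear[OF bounded_linear_\<rho>]]) (use \<rho>_tangent_bundle J_subset in blast)
  then show ?thesis
    using \<rho>_body_flow[OF v(1)] v(2)
      fderiv_eqI[OF bounded_linear_imp_has_derivative[OF bounded_linear_\<rho>]] by simp
qed

text \<open>
  The equation is checked on a lift to the level of the momentum.  There the body flow is tangent and
  satisfies its own equation, and both the 2-form and the energy are pull-backs from the sphere; the
  exterior derivative of \<open>k\<close> times the connection form becomes the form of gyroscopic forces.
\<close>

lemma red_flow_dynamics:
  "gyroscopic_dynamics S2 mt Vk kg (restrict red_flow (tangent_bundle S2))"
proof -
  note op = S2.open_times_UNIV
  have "smooth_on ((- {0}) \<times> UNIV) red_flow"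
    unfolding red_flow_def[abs_def] Let_def
    by (intro smooth_on_Pair smooth_on_add smooth_on_cross3 smooth_on_ang_acc smooth_on_ang_vel
        smooth_on_fst smooth_on_snd smooth_on_id op) auto
  then have sm: "smooth_map (tangent_bundle S2) (restrict red_flow (tangent_bundle S2))"
    by (rule smooth_retract.smooth_mapI[OF S2.smooth_retract_tangent_bundle]) simp
  have "ambient_ext_deriv S.lform w (red_flow w) Z + kg (fst w) (fst (red_flow w)) (fst Z) =
      - tderiv (tangent_bundle S2) (energy mt Vk) w Z"
    if w: "w \<in> tangent_bundle S2" and Z: "Z \<in> tangent_space (tangent_bundle S2) w" for w Z
  proof -
    obtain v Z' where v: "v \<in> J k" "\<rho> v = w" and Z': "Z' \<in> tangent_space (J k) v" "\<rho> Z' = Z"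
      using \<rho>_lift[OF w] Z by blast
    have vT: "v \<in> tangent_bundle SO3" using v J_subset by blast
    then have Q: "fst v \<in> SO3" by (simp add: SO3.tangent_bundle_iff)
    note X = body_flow_tangent_J[OF v(1)]
    have T: "body_flow v \<in> tangent_space (tangent_bundle SO3) v"
      "Z' \<in> tangent_space (tangent_bundle SO3) v"
      using X Z' tangent_space_mono[OF J_subset] by blast+
    have "ambient_ext_deriv connection (fst v) (fst (body_flow v)) (fst Z') =
        curvature_form (row 1 (fst v)) (row 1 (fst (body_flow v))) (row 1 (fst Z'))"
      using ambient_ext_deriv_connection[OF Q SO3.fst_tangent[OF T(1)] SO3.fst_tangent[OF T(2)]]
      by (simp add: curvature_form_def row_SO3_in_S2[OF Q] row_tangent[OF Q] SO3.fst_tangent[OF T(1)]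
          SO3.fst_tangent[OF T(2)])
    also have "\<dots> = curvature_form (fst w) (fst (red_flow w)) (fst Z)"
      unfolding v(2)[symmetric] Z'(2)[symmetric] \<rho>_body_flow[OF v(1), symmetric]
      by (simp add: \<rho>_def)
    finally show ?thesis
      using lform_J_ext_deriv[OF v(1) X Z'(1)] body_flow_equation[OF vT T(2)]
        tderiv_energy_J[OF v(1) Z'(1)] \<rho>_body_flow[OF v(1)] v(2) Z'(2)
      by simp
  qed
  then show ?thesis
    unfolding S.gyroscopic_dynamics_iff vector_field_def using sm red_flow_tangent by simp
qed

lemma gyroscopic_dynamics_S2_unique:
  assumes "gyroscopic_dynamics S2 mt Vk kg Y"
  shows "Y = restrict red_flow (tangent_bundle S2)"
  by (rule S.gyroscopic_dynamics_unique[OF assms red_flow_dynamics]) (simp add: curvature_form_def)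

lemma tderiv_tangent_map_J:
  assumes w: "w \<in> J k" and Z: "Z \<in> tangent_space (J k) w"
  shows "tderiv (J k) (tangent_map SO3 body_proj) w Z = \<rho> Z"
  by (rule tderiv_eqI[OF Z open_UNIV UNIV_I bounded_linear_imp_has_derivative[OF bounded_linear_\<rho>]])
    (use J_subset tangent_map_body_proj in \<open>auto simp: \<rho>_def\<close>)

text \<open>
  Since \<open>\<rho>\<close> maps the level onto the tangent bundle of the sphere, a field related to the body flow
  is determined everywhere.
\<close>

lemma reduced_system_iff:
  "reduced_system SO3 bm (Vt \<circ> body_proj) body_field S2 body_proj k Y \<longleftrightarrow>
    Y = restrict red_flow (tangent_bundle S2)"
proof
  have \<rho>: "tangent_map SO3 body_proj w = \<rho> w" if "w \<in> J k" for w
    using tangent_map_body_proj[of w] that J_subset unfolding \<rho>_def by blast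
  let ?X = "restrict body_flow (tangent_bundle SO3)"
  have X: "?X w \<in> tangent_space (J k) w \<and>
      tderiv (J k) (tangent_map SO3 body_proj) w (?X w) = red_flow (\<rho> w)" if w: "w \<in> J k" for w
  proof -
    have "?X w = body_flow w" using w J_subset by (intro restrict_apply') blast
    then show ?thesis
      using body_flow_tangent_J[OF w] tderiv_tangent_map_J[OF w] \<rho>_body_flow[OF w] by simp
  qed
  {
    assume Y: "reduced_system SO3 bm (Vt \<circ> body_proj) body_field S2 body_proj k Y"
    then have eq: "\<forall>w\<in>J k. red_flow (\<rho> w) = Y (\<rho> w)"
      unfolding reduced_system_def using natural_dynamics_unique X \<rho> by metis
    have Ye: "Y \<in> extensional (tangent_bundle S2)"
      using Y by (simp add: reduced_system_def vector_field_def)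
    show "Y = restrict red_flow (tangent_bundle S2)"
    proof (rule extensionalityI[OF Ye restrict_extensional])
      fix w assume w: "w \<in> tangent_bundle S2"
      then obtain v where "v \<in> J k" "\<rho> v = w" using \<rho>_lift by blast
      then show "Y w = restrict red_flow (tangent_bundle S2) w" using eq w by auto
    qed
  next
    assume Y: "Y = restrict red_flow (tangent_bundle S2)"
    have "Y (\<rho> w) = red_flow (\<rho> w)" if "w \<in> J k" for w
      unfolding Y by (rule restrict_apply') (use that J_subset \<rho>_tangent_bundle in blast)
    moreover have "vector_field (tangent_bundle S2) Y"
      using red_flow_dynamics by (simp add: Y gyroscopic_dynamics_def)
    ultimately show "reduced_system SO3 bm (Vt \<circ> body_proj) body_field S2 body_proj k Y"
      unfolding reduced_system_def using body_flow_dynamics X \<rho> by auto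
  }
qed

lemma natural_system_SO3: "natural_system SO3 bm (Vt \<circ> body_proj)"
  unfolding natural_system_def
proof (intro conjI submanifold_SO3 B.riemannian_metric)
  have "smooth_on SO3_nbhd (\<lambda>Q. Vt_ext (row 1 Q))"
    by (rule smooth_on_compose[OF SO3.open_U open_nonzero _ smooth_on_Vt_ext])
      (intro smooth_on_row smooth_on_id SO3.open_U, auto simp: SO3_nbhd_def)
  then show "smooth_map SO3 (Vt \<circ> body_proj)"
    by (rule SO3.smooth_mapI) (simp add: Vt_ext_S2 row_SO3_in_S2 body_proj_def)
qed

lemma gyroscopic_system_S2: "gyroscopic_system S2 mt Vk kg"
  unfolding gyroscopic_system_def
  by (intro conjI submanifold_S2 S.riemannian_metric two_form_scaled_curvature_form closed_scaled_curvature_form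
      S2.smooth_mapI[OF smooth_on_Vk] Vk_eq)

end

theorem mainTheorem4:
  fixes I1 I2 I3 k :: real and Vt :: "real^3 \<Rightarrow> real"
  assumes "I1 > 0" and "I2 > 0" and "I3 > 0"
    and "I1 < I2 + I3" and "I2 < I3 + I1" and "I3 < I1 + I2"
    and "smooth_map S2 Vt"
  shows
    "let m = body_metric I1 I2 I3;
         V = Vt \<circ> body_proj;
         mt = reduced_metric SO3 m body_field body_proj;
         Vk = reduced_potential SO3 m V body_field body_proj k;
         gt = gyroscopic_form SO3 m body_field S2 body_proj;
         kgt = (\<lambda>\<nu> a b. k * gt \<nu> a b);
         D = (\<lambda>\<nu>::real^3. I1 * (\<nu>$1)\<^sup>2 + I2 * (\<nu>$2)\<^sup>2 + I3 * (\<nu>$3)\<^sup>2)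
     in natural_system SO3 m V \<and> (\<exists>!X. natural_dynamics SO3 m V X) \<and>
        gyroscopic_system S2 mt Vk kgt \<and> (\<exists>!Y. gyroscopic_dynamics S2 mt Vk kgt Y) \<and>
        (\<forall>Y. reduced_system SO3 m V body_field S2 body_proj k Y
             \<longleftrightarrow> gyroscopic_dynamics S2 mt Vk kgt Y) \<and>
        (\<forall>\<nu>\<in>S2. \<forall>a\<in>tangent_space S2 \<nu>.
           mt \<nu> a a = I1 * I2 * I3 * ((a$1)\<^sup>2 / I1 + (a$2)\<^sup>2 / I2 + (a$3)\<^sup>2 / I3) / D \<nu>) \<and>
        (\<forall>\<nu>\<in>S2. Vk \<nu> = Vt \<nu> + k\<^sup>2 / (2 * D \<nu>)) \<and>
        (\<forall>\<nu>\<in>S2. \<forall>a\<in>tangent_space S2 \<nu>. \<forall>b\<in>tangent_space S2 \<nu>.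
           kgt \<nu> a b =
             k * (((I2 + I3 - I1) * I1 * (\<nu>$1)\<^sup>2 + (I3 + I1 - I2) * I2 * (\<nu>$2)\<^sup>2
                    + (I1 + I2 - I3) * I3 * (\<nu>$3)\<^sup>2) / (D \<nu>)\<^sup>2)
               * (\<nu>$1 * wedge 2 3 a b + \<nu>$2 * wedge 3 1 a b + \<nu>$3 * wedge 1 2 a b)) \<and>
        (\<exists>F. smooth_map S2 F \<and> (\<forall>\<nu>\<in>S2. F \<nu> > 0) \<and>
           (\<forall>\<nu>\<in>S2. \<forall>a\<in>tangent_space S2 \<nu>. \<forall>b\<in>tangent_space S2 \<nu>.
              kgt \<nu> a b = k * sphere_volume \<nu> a b * F \<nu>))"
proof -
  interpret axisymmetric_body I1 I2 I3 Vt k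
    using assms by unfold_locales
  have det: "x$1 * wedge 2 3 a b + x$2 * wedge 3 1 a b + x$3 * wedge 1 2 a b = x \<bullet> cross3 a b"
    for x a b :: "real^3"
    by (simp add: wedge_def inner3 cross3_nth algebra_simps)
  have vol: "sphere_volume x a b = x \<bullet> cross3 a b" for x a b
    by (simp add: sphere_volume_def dot_cross_det)
  have curvature_pos: "curvature x > 0" if x: "x \<in> S2" for x
  proof -
    \<comment> \<open>The triangle inequalities make the numerator the axial moment of another body.\<close>
    interpret I': rigid_body "(I2 + I3 - I1) * I1" "(I3 + I1 - I2) * I2" "(I1 + I2 - I3) * I3"
      using assms by unfold_locales simp_all
    show ?thesis
      using I'.S2_moment[OF x] S2_moment[OF x] by (simp add: curvature_def I'.axis_moment_eq)
  qed
  have f1: "\<exists>!X. natural_dynamics SO3 bm (Vt \<circ> body_proj) X"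
    using body_flow_dynamics natural_dynamics_unique by blast
  have f2: "\<exists>!Y. gyroscopic_dynamics S2 mt Vk kg Y"
    using red_flow_dynamics gyroscopic_dynamics_S2_unique by blast
  have f3: "reduced_system SO3 bm (Vt \<circ> body_proj) body_field S2 body_proj k Y \<longleftrightarrow>
      gyroscopic_dynamics S2 mt Vk kg Y" for Y
    using reduced_system_iff red_flow_dynamics gyroscopic_dynamics_S2_unique by metis
  have f4: "mt x a a = I1 * I2 * I3 * ((a$1)\<^sup>2 / I1 + (a$2)\<^sup>2 / I2 + (a$3)\<^sup>2 / I3)
      / (I1 * (x$1)\<^sup>2 + I2 * (x$2)\<^sup>2 + I3 * (x$3)\<^sup>2)"
    if "x \<in> S2" "a \<in> tangent_space S2 x" for x a
    using that by (simp only: reduced_metric_eq sphere_form_eq axis_moment_eq)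
  have f5: "Vk x = Vt x + k\<^sup>2 / (2 * (I1 * (x$1)\<^sup>2 + I2 * (x$2)\<^sup>2 + I3 * (x$3)\<^sup>2))"
    if "x \<in> S2" for x
    using that by (simp only: reduced_potential_eq axis_moment_eq)
  have f6: "kg x a b =
      k * (((I2 + I3 - I1) * I1 * (x$1)\<^sup>2 + (I3 + I1 - I2) * I2 * (x$2)\<^sup>2
        + (I1 + I2 - I3) * I3 * (x$3)\<^sup>2) / (I1 * (x$1)\<^sup>2 + I2 * (x$2)\<^sup>2 + I3 * (x$3)\<^sup>2)\<^sup>2)
      * (x$1 * wedge 2 3 a b + x$2 * wedge 3 1 a b + x$3 * wedge 1 2 a b)"
    if "x \<in> S2" "a \<in> tangent_space S2 x" "b \<in> tangent_space S2 x" for x a b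
    unfolding det using that by (simp add: curvature_form_def curvature_def axis_moment_eq)
  have f7: "\<exists>F. smooth_map S2 F \<and> (\<forall>x\<in>S2. F x > 0) \<and>
      (\<forall>x\<in>S2. \<forall>a\<in>tangent_space S2 x. \<forall>b\<in>tangent_space S2 x.
        kg x a b = k * sphere_volume x a b * F x)"
    using S2.smooth_mapI[OF smooth_on_curvature] curvature_pos
    by (intro exI[of _ curvature]) (simp add: curvature_form_def vol mult.commute)
  show ?thesis
    unfolding Let_def gyroscopic_form_eq
    by (intro conjI allI ballI natural_system_SO3 gyroscopic_system_S2 f1 f2 f3 f4 f5 f6 f7)
qed

end
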